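(* Let $\lambda>0$ be a universal constant with the property that every finitely generated non-elementary Kleinian group $\Gamma$ with $\mathfrak{D}_\Gamma<\lambda$ is a classical Schottky group. For an integer $k\ge 2$ let $\mathfrak{J}_{k,o}^{\lambda}\subset\mathfrak{J}_k$ be the set of (conjugacy classes of) rank $k$ classical Schottky groups $\Gamma$ with $\mathfrak{D}_\Gamma<\lambda$. Then $\mathfrak{J}_{k,o}^{\lambda}$, with the structure induced from $\mathfrak{J}_k$, is a $(3k-3)$-dimensional complex manifold.
   Context: A Kleinian group is a finitely generated, torsion-free, discrete subgroup $\Gamma$ of $\mathrm{PSL}(2,\mathbb{C})$. Its limit set is $\Lambda_\Gamma=\overline{\Gamma x}\cap\partial\mathbb{H}^3$ for any $x\in\mathbb{H}^3$; $\Gamma$ is non-elementary if $\Lambda_\Gamma$ has more than two points. $\mathfrak{D}_\Gamma$ denotes the Hausdorff dimension of $\Lambda_\Gamma$. A Schottky group of rank $k$ is a subgroup of $\mathrm{PSL}(2,\mathbb{C})$ generated by $\gamma_1,\dots,\gamma_k$ for which there are pairwise disjoint closed topological disks $D_1,D_1',\dots,D_k,D_k'\subset\overline{\mathbb{C}}$ bounded by Jordan curves, such that $\gamma_i(\partial D_i)=\partial D_i'$ and $\gamma_i(\mathrm{int}\,D_i)\cap \mathrm{int}\,D_i'=\emptyset$ for all $i$; the tuple $(\gamma_1,\dots,\gamma_k)$ is a marking. If for some choice of generators the disks can be chosen so that all the curves $\partial D_i,\partial D_i'$ are circles, the group is called a classical Schottky group. $\mathfrak{J}_k$ is Schottky space: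 the space of rank $k$ (marked) Schottky groups $(\gamma_1,\dots,\gamma_k)\in\mathrm{PSL}(2,\mathbb{C})^k$ up to conjugation in $\mathrm{PSL}(2,\mathbb{C})$; equivalently, the quasiconformal deformation space of a fixed rank $k$ classical Schottky group. It is a complex manifold of dimension $3k-3$ (embedded in $\mathbb{C}^{3k-3}$). *)

theory Defs
  imports "HOL-Analysis.Analysis" "HOL-Algebra.Coset" "HOL-Algebra.Generated_Groups"
begin

section \<open>Quotient topology\<close>

definition quotient_topology :: "'a topology \<Rightarrow> ('a \<Rightarrow> 'b) \<Rightarrow> 'b topology" where
  "quotient_topology X f =
     topology (\<lambda>U. U \<subseteq> f ` topspace X \<and> openin X {x \<in> topspace X. f x \<in> U})"

lemma openin_quotient_topology:
  "openin (quotient_topology X f) U \<longleftrightarrow>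
     U \<subseteq> f ` topspace X \<and> openin X {x \<in> topspace X. f x \<in> U}"
proof -
  have "istopology (\<lambda>U. U \<subseteq> f ` topspace X \<and> openin X {x \<in> topspace X. f x \<in> U})"
    unfolding istopology_def
  proof (intro conjI allI impI)
    fix S T
    assume S: "S \<subseteq> f ` topspace X \<and> openin X {x \<in> topspace X. f x \<in> S}"
      and T: "T \<subseteq> f ` topspace X \<and> openin X {x \<in> topspace X. f x \<in> T}"
    have eq: "{x \<in> topspace X. f x \<in> S \<inter> T} =
        {x \<in> topspace X. f x \<in> S} \<inter> {x \<in> topspace X. f x \<in> T}" by blast
    show "openin X {x \<in> topspace X. f x \<in> S \<inter> T}"
      unfolding eq using S T by (intro openin_Int) blast+
    show "S \<inter> T \<subseteq> f ` topspace X" using S by auto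
  next
    fix K
    assume K: "\<forall>S\<in>K. S \<subseteq> f ` topspace X \<and> openin X {x \<in> topspace X. f x \<in> S}"
    have "{x \<in> topspace X. f x \<in> \<Union>K} = (\<Union>S\<in>K. {x \<in> topspace X. f x \<in> S})" by blast
    then show "openin X {x \<in> topspace X. f x \<in> \<Union>K}" using K by auto
    show "\<Union>K \<subseteq> f ` topspace X" using K by auto
  qed
  then show ?thesis by (simp add: quotient_topology_def)
qed

lemma topspace_quotient_topology [simp]: "topspace (quotient_topology X f) = f ` topspace X"
proof -
  have "{x \<in> topspace X. f x \<in> f ` topspace X} = topspace X" by auto
  then have "openin (quotient_topology X f) (f ` topspace X)"
    by (simp add: openin_quotient_topology)
  moreover have "topspace (quotient_topology X f) \<subseteq> f ` topspace X"
    using openin_quotient_topology[of X f] openin_topspace by blast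
  ultimately show ?thesis by (metis openin_subset subset_antisym)
qed

lemma quotient_map_quotient_topology: "quotient_map X (quotient_topology X f) f"
  by (simp add: quotient_map_def openin_quotient_topology)


section \<open>The group PSL(2,C)\<close>

definition SL2C :: "(complex^2^2) monoid" where
  "SL2C = \<lparr>carrier = {A. det A = 1}, mult = (**), one = mat 1\<rparr>"

type_synonym psl = "(complex^2^2) set"

definition PSL2C :: "psl monoid" where
  "PSL2C = SL2C Mod {mat 1, - mat 1}"

text \<open>For an invertible \<open>A\<close>, not necessarily of determinant 1, the set \<open>psl_class A\<close> consists of the
  two multiples of \<open>A\<close> that lie in SL(2,C).  On SL(2,C) this is the projection to PSL(2,C);
  in general it realises the identification of PGL(2,C) with PSL(2,C).\<close>

definition psl_class :: "complex^2^2 \<Rightarrow> psl" where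
  "psl_class A = {B \<in> carrier SL2C. \<exists>c. B = (\<chi> i j. c * A $ i $ j)}"

definition PSL2C_topology :: "psl topology" where
  "PSL2C_topology = quotient_topology (top_of_set (carrier SL2C)) psl_class"


section \<open>The Riemann sphere and hyperbolic space\<close>

text \<open>In the type \<open>complex option\<close> the point at infinity is \<open>None\<close>.\<close>

definition riemann_sphere :: "complex option topology" where
  "riemann_sphere = Alexandroff_compactification euclidean"

definition moebius_map :: "complex^2^2 \<Rightarrow> complex option \<Rightarrow> complex option" where
  "moebius_map A \<xi> = (case \<xi> of
       None \<Rightarrow> if A$2$1 = 0 then None else Some (A$1$1 / A$2$1)
     | Some z \<Rightarrow> if A$2$1 * z + A$2$2 = 0 then None
                 else Some ((A$1$1 * z + A$1$2) / (A$2$1 * z + A$2$2)))"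

text \<open>The upper half-space model is \<open>{(z, t). t > 0}\<close>; this is the Poincare extension of the
  Moebius transformation of a matrix of determinant 1.\<close>

definition poincare_extension :: "complex^2^2 \<Rightarrow> complex \<times> real \<Rightarrow> complex \<times> real" where
  "poincare_extension A = (\<lambda>(z, t).
     let N = (cmod (A$2$1 * z + A$2$2))\<^sup>2 + (cmod (A$2$1))\<^sup>2 * t\<^sup>2
     in (((A$1$1 * z + A$1$2) * cnj (A$2$1 * z + A$2$2)
            + A$1$1 * cnj (A$2$1) * complex_of_real (t\<^sup>2)) / complex_of_real N,
         t / N))"

text \<open>The two representatives \<open>A\<close> and \<open>- A\<close> of an element of PSL(2,C) act in the same way, so
  the choice of representative is immaterial.\<close>

definition sphere_action :: "psl \<Rightarrow> complex option \<Rightarrow> complex option" where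
  "sphere_action g = moebius_map (SOME A. A \<in> g)"

definition hyp_action :: "psl \<Rightarrow> complex \<times> real \<Rightarrow> complex \<times> real" where
  "hyp_action g = poincare_extension (SOME A. A \<in> g)"

text \<open>Hyperbolic space together with its boundary: the closed upper half-space and the point at
  infinity.\<close>

definition closed_hyperbolic_space :: "(complex \<times> real) option topology" where
  "closed_hyperbolic_space = Alexandroff_compactification (top_of_set {p. snd p \<ge> 0})"

definition boundary_point :: "complex option \<Rightarrow> (complex \<times> real) option" where
  "boundary_point = map_option (\<lambda>z. (z, 0))"

text \<open>The limit set does not depend on the base point; we use \<open>(0, 1)\<close>.\<close>

definition limit_set :: "psl set \<Rightarrow> complex option set" where
  "limit_set \<Gamma> = {\<xi>. boundary_point \<xi> \<in>
     closed_hyperbolic_space closure_of ((\<lambda>g. Some (hyp_action g (0, 1))) ` \<Gamma>)}"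


section \<open>Hausdorff dimension\<close>

text \<open>Only exponents \<open>s > 0\<close> are used, so \<open>0 powr s = 0\<close> gives the usual convention for
  one-point and empty covering sets.  Boundedness is required because \<open>diameter\<close> is
  meaningful for bounded sets only.\<close>

definition hausdorff_premeasure :: "real \<Rightarrow> real \<Rightarrow> 'a::metric_space set \<Rightarrow> ennreal" where
  "hausdorff_premeasure \<delta> s A =
     (INF U \<in> {U :: nat \<Rightarrow> 'a set.
                 A \<subseteq> (\<Union>i. U i) \<and> (\<forall>i. bounded (U i) \<and> diameter (U i) \<le> \<delta>)}.
        \<Sum>i. ennreal (diameter (U i) powr s))"

definition hausdorff_measure :: "real \<Rightarrow> 'a::metric_space set \<Rightarrow> ennreal" where
  "hausdorff_measure s A = (SUP \<delta> \<in> {0<..}. hausdorff_premeasure \<delta> s A)"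

definition hausdorff_dimension :: "'a::metric_space set \<Rightarrow> ennreal" where
  "hausdorff_dimension A = Inf {ennreal s | s. s > 0 \<and> hausdorff_measure s A = 0}"

text \<open>Inverse stereographic projection onto the unit sphere of \<open>complex \<times> real\<close>.  The dimension
  of a subset of the Riemann sphere is taken with respect to the resulting chordal metric.\<close>

definition to_unit_sphere :: "complex option \<Rightarrow> complex \<times> real" where
  "to_unit_sphere \<xi> = (case \<xi> of
       None \<Rightarrow> (0, 1)
     | Some z \<Rightarrow> (2 * z / complex_of_real ((cmod z)\<^sup>2 + 1), ((cmod z)\<^sup>2 - 1) / ((cmod z)\<^sup>2 + 1)))"

definition limit_set_dimension :: "psl set \<Rightarrow> ennreal" where
  "limit_set_dimension \<Gamma> = hausdorff_dimension (to_unit_sphere ` limit_set \<Gamma>)"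


section \<open>Kleinian groups\<close>

definition kleinian_group :: "psl set \<Rightarrow> bool" where
  "kleinian_group \<Gamma> \<longleftrightarrow>
     subgroup \<Gamma> PSL2C \<and>
     (\<exists>S. finite S \<and> S \<subseteq> carrier PSL2C \<and> generate PSL2C S = \<Gamma>) \<and>
     (\<forall>g\<in>\<Gamma>. \<forall>n::nat. n > 0 \<and> g [^]\<^bsub>PSL2C\<^esub> n = \<one>\<^bsub>PSL2C\<^esub> \<longrightarrow> g = \<one>\<^bsub>PSL2C\<^esub>) \<and>
     subtopology PSL2C_topology \<Gamma> = discrete_topology \<Gamma>"

definition non_elementary :: "psl set \<Rightarrow> bool" where
  "non_elementary \<Gamma> \<longleftrightarrow> infinite (limit_set \<Gamma>) \<or> card (limit_set \<Gamma>) > 2"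


section \<open>Schottky groups\<close>

definition jordan_curve :: "complex option set \<Rightarrow> bool" where
  "jordan_curve C \<longleftrightarrow>
     C \<subseteq> topspace riemann_sphere \<and>
     subtopology riemann_sphere C homeomorphic_space top_of_set (sphere (0::complex) 1)"

definition closed_jordan_disk :: "complex option set \<Rightarrow> bool" where
  "closed_jordan_disk D \<longleftrightarrow>
     D \<subseteq> topspace riemann_sphere \<and>
     closedin riemann_sphere D \<and>
     subtopology riemann_sphere D homeomorphic_space top_of_set (cball (0::complex) 1) \<and>
     jordan_curve (riemann_sphere frontier_of D)"

definition circle_on_sphere :: "complex option set \<Rightarrow> bool" where
  "circle_on_sphere C \<longleftrightarrow>
     (\<exists>a r. r > 0 \<and> C = Some ` sphere a r) \<or>
     (\<exists>n b. n \<noteq> 0 \<and> C = insert None (Some ` {z. n \<bullet> z = b}))"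

text \<open>The generators are indexed by a set \<open>I\<close>, and the rank is the cardinality of \<open>I\<close>.\<close>

definition schottky_disks ::
  "'i set \<Rightarrow> ('i \<Rightarrow> psl) \<Rightarrow> ('i \<Rightarrow> complex option set) \<Rightarrow> ('i \<Rightarrow> complex option set) \<Rightarrow> bool" where
  "schottky_disks I \<gamma> D D' \<longleftrightarrow>
     (\<forall>i\<in>I. closed_jordan_disk (D i) \<and> closed_jordan_disk (D' i)) \<and>
     disjoint_family_on D I \<and> disjoint_family_on D' I \<and>
     (\<forall>i\<in>I. \<forall>j\<in>I. D i \<inter> D' j = {}) \<and>
     (\<forall>i\<in>I. sphere_action (\<gamma> i) ` (riemann_sphere frontier_of D i)
               = riemann_sphere frontier_of D' i \<and>
             sphere_action (\<gamma> i) ` (riemann_sphere interior_of D i)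
               \<inter> riemann_sphere interior_of D' i = {})"

definition schottky_marking :: "'i set \<Rightarrow> ('i \<Rightarrow> psl) \<Rightarrow> bool" where
  "schottky_marking I \<gamma> \<longleftrightarrow>
     \<gamma> ` I \<subseteq> carrier PSL2C \<and> (\<exists>D D'. schottky_disks I \<gamma> D D')"

definition classical_schottky_marking :: "'i set \<Rightarrow> ('i \<Rightarrow> psl) \<Rightarrow> bool" where
  "classical_schottky_marking I \<gamma> \<longleftrightarrow>
     \<gamma> ` I \<subseteq> carrier PSL2C \<and>
     (\<exists>D D'. schottky_disks I \<gamma> D D' \<and>
        (\<forall>i\<in>I. circle_on_sphere (riemann_sphere frontier_of D i) \<and>
                circle_on_sphere (riemann_sphere frontier_of D' i)))"

definition classical_schottky_group_of_rank :: "nat \<Rightarrow> psl set \<Rightarrow> bool" where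
  "classical_schottky_group_of_rank k \<Gamma> \<longleftrightarrow>
     (\<exists>\<gamma> :: nat \<Rightarrow> psl. classical_schottky_marking {..<k} \<gamma> \<and> \<Gamma> = generate PSL2C (\<gamma> ` {..<k}))"

definition classical_schottky_group :: "psl set \<Rightarrow> bool" where
  "classical_schottky_group \<Gamma> \<longleftrightarrow> (\<exists>k\<ge>1. classical_schottky_group_of_rank k \<Gamma>)"


section \<open>Complex manifolds\<close>

definition holomorphic_map_on ::
  "(complex^'a \<Rightarrow> complex^'b) \<Rightarrow> (complex^'a) set \<Rightarrow> bool" where
  "holomorphic_map_on f S \<longleftrightarrow>
     open S \<and>
     (\<forall>x\<in>S. \<exists>f'. (f has_derivative f') (at x) \<and> Vector_Spaces.linear (*s) (*s) f')"

text \<open>A chart is a pair of a domain and a map; the values of the map outside of the domain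
  are irrelevant.  The dimension of the manifold is \<open>CARD('n)\<close>.\<close>

definition complex_manifold ::
  "'a topology \<Rightarrow> ('a set \<times> ('a \<Rightarrow> complex^'n)) set \<Rightarrow> bool" where
  "complex_manifold X \<A> \<longleftrightarrow>
     Hausdorff_space X \<and> second_countable X \<and>
     (\<forall>(U, \<phi>) \<in> \<A>. openin X U \<and> open (\<phi> ` U) \<and>
        homeomorphic_map (subtopology X U) (top_of_set (\<phi> ` U)) \<phi>) \<and>
     (\<Union>(U, \<phi>) \<in> \<A>. U) = topspace X \<and>
     (\<forall>(U, \<phi>) \<in> \<A>. \<forall>(V, \<psi>) \<in> \<A>.
        holomorphic_map_on (\<lambda>w. \<psi> (inv_into U \<phi> w)) (\<phi> ` (U \<inter> V)))"

definition induced_charts ::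
  "'a set \<Rightarrow> ('a set \<times> ('a \<Rightarrow> complex^'n)) set \<Rightarrow> ('a set \<times> ('a \<Rightarrow> complex^'n)) set" where
  "induced_charts S \<A> = (\<lambda>(U, \<phi>). (U \<inter> S, \<phi>)) ` \<A>"


section \<open>Schottky space\<close>

text \<open>The index type \<open>'k\<close> of the generators determines the rank \<open>CARD('k)\<close>.\<close>

definition conjugacy_class :: "('k \<Rightarrow> psl) \<Rightarrow> ('k \<Rightarrow> psl) set" where
  "conjugacy_class \<gamma> =
     {\<lambda>i. g \<otimes>\<^bsub>PSL2C\<^esub> \<gamma> i \<otimes>\<^bsub>PSL2C\<^esub> inv\<^bsub>PSL2C\<^esub> g | g. g \<in> carrier PSL2C}"

definition schottky_space :: "('k::finite \<Rightarrow> psl) set topology" where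
  "schottky_space =
     quotient_topology
       (subtopology (product_topology (\<lambda>_. PSL2C_topology) UNIV) {\<gamma>. schottky_marking UNIV \<gamma>})
       conjugacy_class"

text \<open>A point of \<open>complex^('k \<times> 2 \<times> 2)\<close> is a \<open>'k\<close>-tuple of 2 by 2 matrices; those with
  invertible entries form an open set which maps to the tuples in PSL(2,C) by a holomorphic
  submersion.\<close>

definition matrix_entry :: "complex^('k::finite \<times> 2 \<times> 2) \<Rightarrow> 'k \<Rightarrow> complex^2^2" where
  "matrix_entry M i = (\<chi> a b. M $ (i, a, b))"

definition invertible_tuples :: "(complex^('k::finite \<times> 2 \<times> 2)) set" where
  "invertible_tuples = {M. \<forall>i. det (matrix_entry M i) \<noteq> 0}"

definition tuple_class :: "complex^('k::finite \<times> 2 \<times> 2) \<Rightarrow> ('k \<Rightarrow> psl) set" where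
  "tuple_class M = conjugacy_class (\<lambda>i. psl_class (matrix_entry M i))"

text \<open>The complex structure of Schottky space is the quotient structure, that is, the one for
  which the projection from marked Schottky groups in the complex manifold of tuples in PSL(2,C)
  is a holomorphic submersion.  Its holomorphic charts are the homeomorphisms \<open>\<phi>\<close> onto open
  sets such that \<open>\<phi>\<close> composed with the projection is holomorphic and the inverse of \<open>\<phi>\<close> lifts
  locally to a holomorphic map into tuples of matrices.\<close>

definition schottky_charts ::
  "(('k::finite \<Rightarrow> psl) set set \<times> (('k \<Rightarrow> psl) set \<Rightarrow> complex^'n)) set" where
  "schottky_charts = {(U, \<phi>).
     openin schottky_space U \<and> open (\<phi> ` U) \<and>
     homeomorphic_map (subtopology schottky_space U) (top_of_set (\<phi> ` U)) \<phi> \<and>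
     holomorphic_map_on (\<lambda>M. \<phi> (tuple_class M)) {M \<in> invertible_tuples. tuple_class M \<in> U} \<and>
     (\<forall>w \<in> \<phi> ` U. \<exists>W s. w \<in> W \<and> W \<subseteq> \<phi> ` U \<and> holomorphic_map_on s W \<and>
        (\<forall>v\<in>W. s v \<in> invertible_tuples \<and> tuple_class (s v) \<in> U \<and> \<phi> (tuple_class (s v)) = v))}"

definition small_classical_locus :: "real \<Rightarrow> ('k::finite \<Rightarrow> psl) set set" where
  "small_classical_locus lam =
     {conjugacy_class \<gamma> | \<gamma>. schottky_marking UNIV \<gamma> \<and>
        classical_schottky_group_of_rank CARD('k) (generate PSL2C (range \<gamma>)) \<and>
        limit_set_dimension (generate PSL2C (range \<gamma>)) < ennreal lam}"

end

theory Submission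
  imports Defs
begin

text \<open>Schottky space has a global holomorphic chart: the generators of a Schottky group are loxodromic
  without common fixed points, so every class has a unique representative for which the first generator
  attracts to \<open>0\<close> and repels from \<open>\<infinity>\<close> and the second one attracts to \<open>1\<close>; the remaining matrix entries are
  \<open>3k - 3\<close> holomorphic coordinates.  Hence Schottky space is a Hausdorff, second countable manifold, and it
  remains to see that the locus is open.

  Being (classically) Schottky is stable because a small perturbation of a generator moves its target disk
  only slightly; since the given generators are free by ping-pong, the words that relate them to classical
  generators satisfy the same relations after the perturbation.

  For the dimension, rotate infinity into the fundamental domain.  The map \<open>A\<close> of a reduced word
  contracts the opposite disks by the factor \<open>csize A\<close> up to fixed constants, and this factor is
  multiplicative up to a constant.  If the limit set has \<open>s\<close>-dimensional measure zero, then charging each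
  covering set to the longest word whose image contains its part of the limit set gives a finite complete
  set of words with \<open>\<Sum> csize\<^sup>s\<close> as small as desired.  Conversely, such a finite sum below a fixed constant
  iterates to covers with arbitrarily small sum.  A finite sum being small is an open condition, so the
  dimension stays below the bound under perturbation.\<close>


section \<open>Matrix model of PSL(2,C) and of words in its generators\<close>

section \<open>Two by two matrices\<close>

text \<open>Openness asks only that a strict inequality survives. So
  \<open>limit_set_dimension < lam\<close> is traded for a finite certificate: an exponent s below
  the bound and a finite cut W with \<Sum> (csize / \<delta>^2)^s < 1. The factor 1 / \<delta>^2
  absorbs the error in the multiplicativity of the sizes; with it they are submultiplicative and the
  certificate can be iterated. Sizes are read off the lower left entry, which is nonzero for all
  nonempty reduced words once infinity lies outside all disks; this is what the rotations are for,
  and they preserve chordal distance. The locus is defined by the existence of a representative, so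
  the two directions are unsymmetric: a given group of small dimension must be carried to its
  rotated copy, but for a perturbed group the rotated copy itself is a good representative. A
  further obstacle is that the classical disks may belong to generators other than the marking. Each
  system is written in words of the other; perturbing along these words keeps the disks, and
  freeness of the marking guarantees that the perturbed systems still generate the same
  group.\<close>

definition mat2 :: "complex \<Rightarrow> complex \<Rightarrow> complex \<Rightarrow> complex \<Rightarrow> complex^2^2" where
  "mat2 a b c d = vector [vector [a, b], vector [c, d]]"

lemma mat2_nth [simp]:
  "mat2 a b c d $ 1 $ 1 = a" "mat2 a b c d $ 1 $ 2 = b"
  "mat2 a b c d $ 2 $ 1 = c" "mat2 a b c d $ 2 $ 2 = d"
  by (simp_all add: mat2_def)

text \<open>The adjugate replaces the inverse: it is polynomial in the entries and differs from the
  inverse by a scalar, which Moebius maps and PSL classes ignore. Tuples therefore need only be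
  invertible, not normalised to determinant 1.\<close>

definition adj2 :: "complex^2^2 \<Rightarrow> complex^2^2" where
  "adj2 A = mat2 (A$2$2) (- A$1$2) (- A$2$1) (A$1$1)"

definition scale2 :: "complex \<Rightarrow> complex^2^2 \<Rightarrow> complex^2^2" where
  "scale2 c A = (\<chi> i j. c * A $ i $ j)"

lemma scale2_nth [simp]: "scale2 c A $ i $ j = c * A $ i $ j"
  by (simp add: scale2_def)

lemma adj2_nth [simp]:
  "adj2 A $ 1 $ 1 = A$2$2" "adj2 A $ 1 $ 2 = - A$1$2"
  "adj2 A $ 2 $ 1 = - A$2$1" "adj2 A $ 2 $ 2 = A$1$1"
  by (simp_all add: adj2_def)

lemma mat2_eq_iff:
  "A = B \<longleftrightarrow> A$1$1 = B$1$1 \<and> A$1$2 = B$1$2 \<and> A$2$1 = B$2$1 \<and> A$2$2 = B$2$2"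
  for A B :: "complex^2^2"
  by (auto simp: vec_eq_iff forall_2)

lemma vec2_eq_iff: "v = w \<longleftrightarrow> v$1 = w$1 \<and> v$2 = w$2" for v w :: "complex^2"
  by (auto simp: vec_eq_iff forall_2)

lemma mult2_nth [simp]: "(A ** B) $ i $ j = A$i$1 * B$1$j + A$i$2 * B$2$j"
  for A B :: "complex^2^2"
  by (simp add: matrix_matrix_mult_def sum_2)

lemma multv2_nth [simp]: "(A *v x) $ i = A$i$1 * x$1 + A$i$2 * x$2"
  for A :: "complex^2^2"
  by (simp add: matrix_vector_mult_def sum_2)

lemma one2_nth [simp]: "(mat 1 :: complex^2^2) $ 1 $ 1 = 1" "(mat 1 :: complex^2^2) $ 1 $ 2 = 0"
  "(mat 1 :: complex^2^2) $ 2 $ 1 = 0" "(mat 1 :: complex^2^2) $ 2 $ 2 = 1"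
  by (simp_all add: mat_def)

lemma det_scale2 [simp]: "det (scale2 c A) = c\<^sup>2 * det A"
  by (simp add: det_2 algebra_simps power2_eq_square)

lemma det_adj2 [simp]: "det (adj2 A) = det A"
  by (simp add: det_2 algebra_simps)

lemma det_mat2 [simp]: "det (mat2 a b c d) = a * d - b * c"
  by (simp add: det_2)

lemma adj2_mult [simp]: "adj2 A ** A = scale2 (det A) (mat 1)" "A ** adj2 A = scale2 (det A) (mat 1)"
  by (simp_all add: mat2_eq_iff det_2 algebra_simps)

lemma adj2_of_mult: "adj2 (A ** B) = adj2 B ** adj2 A"
  by (simp add: mat2_eq_iff algebra_simps)

lemma adj2_adj2 [simp]: "adj2 (adj2 A) = A"
  by (simp add: mat2_eq_iff)

lemma scale2_scale2 [simp]: "scale2 c (scale2 d A) = scale2 (c * d) A"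
  by (simp add: mat2_eq_iff)

lemma scale2_one [simp]: "scale2 1 A = A"
  by (simp add: mat2_eq_iff)

lemma scale2_mult [simp]: "scale2 c A ** B = scale2 c (A ** B)" "A ** scale2 c B = scale2 c (A ** B)"
  by (simp_all add: mat2_eq_iff algebra_simps)

lemma adj2_scale2 [simp]: "adj2 (scale2 c A) = scale2 c (adj2 A)"
  by (simp add: mat2_eq_iff)

lemma adj2_one [simp]: "adj2 (mat 1) = mat 1"
  by (simp add: mat2_eq_iff)

lemma multv2_eq_0:
  fixes A :: "complex^2^2"
  assumes "det A \<noteq> 0" "A *v v = 0" shows "v = 0"
proof -
  have "adj2 A *v (A *v v) = scale2 (det A) (mat 1) *v v"
    by (simp add: matrix_vector_mul_assoc)
  then have "scale2 (det A) (mat 1) *v v = 0" using assms by simp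
  then show ?thesis using assms(1) by (simp add: vec2_eq_iff)
qed

lemma tendsto_mult2 [tendsto_intros]:
  fixes f g :: "'a \<Rightarrow> complex^2^2"
  assumes "(f \<longlongrightarrow> A) F" "(g \<longlongrightarrow> B) F"
  shows "((\<lambda>x. f x ** g x) \<longlongrightarrow> A ** B) F"
  unfolding matrix_matrix_mult_def by (intro tendsto_intros assms)

lemma tendsto_adj2 [tendsto_intros]:
  assumes "(f \<longlongrightarrow> A) F" shows "((\<lambda>x. adj2 (f x)) \<longlongrightarrow> adj2 A) F"
proof (intro vec_tendstoI)
  fix i j :: 2
  show "((\<lambda>x. adj2 (f x) $ i $ j) \<longlongrightarrow> adj2 A $ i $ j) F"
    using exhaust_2[of i] exhaust_2[of j]
    by (elim disjE; simp; intro tendsto_minus tendsto_vec_nth assms)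
qed

lemma tendsto_det2 [tendsto_intros]:
  fixes f :: "'a \<Rightarrow> complex^2^2"
  assumes "(f \<longlongrightarrow> A) F" shows "((\<lambda>x. det (f x)) \<longlongrightarrow> det A) F"
  unfolding det_2 by (intro tendsto_intros assms)


section \<open>Moebius maps in homogeneous coordinates\<close>

definition proj :: "complex^2 \<Rightarrow> complex option" where
  "proj v = (if v$2 = 0 then None else Some (v$1 / v$2))"

definition homog :: "complex option \<Rightarrow> complex^2" where
  "homog \<xi> = (case \<xi> of None \<Rightarrow> vector [1, 0] | Some z \<Rightarrow> vector [z, 1])"

lemma homog_nonzero [simp]: "homog \<xi> \<noteq> 0"
  by (auto simp: homog_def vec2_eq_iff split: option.splits)

lemma proj_homog [simp]: "proj (homog \<xi>) = \<xi>"
  by (auto simp: homog_def proj_def split: option.splits)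

lemma moebius_map_proj:
  assumes "det A \<noteq> 0" "v \<noteq> 0"
  shows "moebius_map A (proj v) = proj (A *v v)"
proof (cases "v$2 = 0")
  case True
  then show ?thesis using assms by (auto simp: proj_def moebius_map_def vec2_eq_iff)
next
  case False
  have "A$2$1 * (v$1/v$2) + A$2$2 = (A$2$1 * v$1 + A$2$2 * v$2) / v$2"
    and "A$1$1 * (v$1/v$2) + A$1$2 = (A$1$1 * v$1 + A$1$2 * v$2) / v$2"
    using False by (simp_all add: field_simps)
  then show ?thesis using False by (auto simp: proj_def moebius_map_def)
qed

lemma moebius_map_eq: "det A \<noteq> 0 \<Longrightarrow> moebius_map A \<xi> = proj (A *v homog \<xi>)"
  by (metis moebius_map_proj homog_nonzero proj_homog)

lemma moebius_map_mult:
  assumes "det A \<noteq> 0" "det B \<noteq> 0"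
  shows "moebius_map (A ** B) \<xi> = moebius_map A (moebius_map B \<xi>)"
proof -
  have "B *v homog \<xi> \<noteq> 0" using multv2_eq_0[OF assms(2)] by fastforce
  then show ?thesis using assms
    by (simp add: moebius_map_eq[of "A ** B"] moebius_map_eq[of B] moebius_map_proj det_mul
        matrix_vector_mul_assoc)
qed

lemma moebius_map_scale2 [simp]: "c \<noteq> 0 \<Longrightarrow> moebius_map (scale2 c A) = moebius_map A"
proof (rule ext)
  fix \<xi> assume c: "c \<noteq> 0"
  have "c * A $ 2 $ 1 * x + c * A $ 2 $ 2 = c * (A $ 2 $ 1 * x + A $ 2 $ 2)"
    "c * A $ 1 $ 1 * x + c * A $ 1 $ 2 = c * (A $ 1 $ 1 * x + A $ 1 $ 2)" for x
    by (simp_all add: algebra_simps)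
  then show "moebius_map (scale2 c A) \<xi> = moebius_map A \<xi>"
    using c by (auto simp: moebius_map_def split: option.splits)
qed

lemma moebius_map_one [simp]: "moebius_map (mat 1) \<xi> = \<xi>"
  by (simp add: moebius_map_def split: option.splits)

lemma moebius_map_adj2 [simp]:
  assumes "det A \<noteq> 0"
  shows "moebius_map (adj2 A) (moebius_map A \<xi>) = \<xi>" "moebius_map A (moebius_map (adj2 A) \<xi>) = \<xi>"
  using assms by (simp_all add: moebius_map_mult[symmetric])

lemma bij_moebius_map: "det A \<noteq> 0 \<Longrightarrow> bij (moebius_map A)"
  by (rule o_bij[of "moebius_map (adj2 A)"]) (auto simp: fun_eq_iff)


section \<open>Matrix representatives of elements of PSL(2,C)\<close>

lemma mem_psl_class: "B \<in> psl_class A \<longleftrightarrow> det B = 1 \<and> (\<exists>c. B = scale2 c A)"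
  by (auto simp: psl_class_def SL2C_def scale2_def)

lemma mem_psl_classE:
  assumes "B \<in> psl_class A"
  obtains c where "c \<noteq> 0" "B = scale2 c A" "c\<^sup>2 * det A = 1"
proof -
  from assms obtain c where "det B = 1" "B = scale2 c A" by (auto simp: mem_psl_class)
  then show ?thesis using that[of c] by (cases "c = 0") auto
qed

lemma psl_class_scale2 [simp]:
  assumes c: "c \<noteq> 0" shows "psl_class (scale2 c A) = psl_class A"
proof (intro Set.set_eqI iffI)
  fix B
  show "B \<in> psl_class (scale2 c A) \<Longrightarrow> B \<in> psl_class A"
    by (auto simp: mem_psl_class)
  assume "B \<in> psl_class A"
  then obtain d where "det B = 1" "B = scale2 d A" by (auto simp: mem_psl_class)
  then show "B \<in> psl_class (scale2 c A)"
    using c by (auto simp: mem_psl_class intro!: exI[of _ "d / c"])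
qed

lemma psl_class_nonempty: "det A \<noteq> 0 \<Longrightarrow> \<exists>B. B \<in> psl_class A"
  by (rule exI[of _ "scale2 (1 / csqrt (det A)) A"])
     (auto simp: mem_psl_class power_divide)

lemma psl_class_some:
  assumes "det A \<noteq> 0"
  obtains c where "c \<noteq> 0" "(SOME B. B \<in> psl_class A) = scale2 c A" "c\<^sup>2 * det A = 1"
  using mem_psl_classE[OF someI_ex[OF psl_class_nonempty[OF assms]]] by blast

lemma psl_class_eq_iff:
  assumes "det A \<noteq> 0" "det B \<noteq> 0"
  shows "psl_class A = psl_class B \<longleftrightarrow> (\<exists>c. c \<noteq> 0 \<and> A = scale2 c B)"
proof
  assume eq: "psl_class A = psl_class B"
  obtain C where C: "C \<in> psl_class A" using psl_class_nonempty assms by blast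
  obtain c where c: "c \<noteq> 0" "C = scale2 c A" using mem_psl_classE[OF C] by blast
  have "C \<in> psl_class B" using C eq by simp
  then obtain d where d: "d \<noteq> 0" "C = scale2 d B" using mem_psl_classE by blast
  have "A = scale2 (1/c) C" using c by simp
  then have "A = scale2 (d / c) B" using d(2) by simp
  then show "\<exists>c. c \<noteq> 0 \<and> A = scale2 c B" using c(1) d(1) by (intro exI[of _ "d / c"]) simp
qed auto

lemma sphere_action_psl_class [simp]: "det A \<noteq> 0 \<Longrightarrow> sphere_action (psl_class A) = moebius_map A"
  unfolding sphere_action_def by (metis moebius_map_scale2 psl_class_some)

text \<open>The determinant-one representative is \<open>scale2 c A\<close> with |c|^2 |det A| = 1,
  so |c|^2 cancels in the first coordinate and turns the height 1 / N into |det A| / N. Orbit points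
  are thus computed from any invertible representative.\<close>

lemma hyp_action_psl_class:
  assumes "det A \<noteq> 0"
  defines "N \<equiv> (cmod (A$2$1))\<^sup>2 + (cmod (A$2$2))\<^sup>2"
  shows "hyp_action (psl_class A) (0, 1) =
    ((A$1$1 * cnj (A$2$1) + A$1$2 * cnj (A$2$2)) / complex_of_real N, cmod (det A) / N)"
proof -
  obtain c where c: "c \<noteq> 0" "(SOME B. B \<in> psl_class A) = scale2 c A" "c\<^sup>2 * det A = 1"
    using psl_class_some[OF assms(1)] .
  have cm: "(cmod c)\<^sup>2 * cmod (det A) = 1"
    using arg_cong[OF c(3), of cmod] by (simp add: norm_mult norm_power)
  have cc: "c * cnj c = complex_of_real ((cmod c)\<^sup>2)" by (rule complex_norm_square[symmetric])
  have 1: "c * A$1$2 * cnj (c * A$2$2) + c * A$1$1 * cnj (c * A$2$1) =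
      complex_of_real ((cmod c)\<^sup>2) * (A$1$1 * cnj (A$2$1) + A$1$2 * cnj (A$2$2))"
    unfolding cc[symmetric] by (simp add: algebra_simps)
  have 2: "(cmod (c * A$2$2))\<^sup>2 + (cmod (c * A$2$1))\<^sup>2 = (cmod c)\<^sup>2 * N"
    by (simp add: N_def norm_mult power_mult_distrib algebra_simps)
  have 3: "1 / ((cmod c)\<^sup>2 * N) = cmod (det A) / N"
  proof -
    have "cmod (det A) = 1 / (cmod c)\<^sup>2" using cm c(1) by (simp add: field_simps)
    then show ?thesis by simp
  qed
  have 4: "complex_of_real ((cmod c)\<^sup>2) * X / complex_of_real ((cmod c)\<^sup>2 * N) = X / complex_of_real N" for X
    using c(1) by simp
  show ?thesis
    unfolding hyp_action_def poincare_extension_def c(2) split_conv Let_def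
    using 1 2 3 4 by simp
qed

lemma group_SL2C: "group SL2C"
proof (rule groupI)
  fix A assume "A \<in> carrier SL2C"
  then show "\<exists>B\<in>carrier SL2C. B \<otimes>\<^bsub>SL2C\<^esub> A = \<one>\<^bsub>SL2C\<^esub>"
    by (intro bexI[of _ "adj2 A"]) (auto simp: SL2C_def)
qed (auto simp: SL2C_def det_mul matrix_mul_assoc matrix_mul_lid)

lemma neg_one_scale2: "- (mat 1 :: complex^2^2) = scale2 (-1) (mat 1)"
  by (simp add: mat2_eq_iff)

lemma minus_scale2: "- A = scale2 (-1) A"
  by (simp add: mat2_eq_iff)

lemma normal_center: "{mat 1, - mat 1} \<lhd> SL2C"
proof -
  interpret group SL2C by (rule group_SL2C)
  have inv: "inv\<^bsub>SL2C\<^esub> A = adj2 A" if "det A = 1" for A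
    using that by (intro inv_equality) (auto simp: SL2C_def)
  have sub: "subgroup {mat 1, - mat 1} SL2C"
  proof (rule subgroupI)
    show "{mat 1, - mat 1} \<subseteq> carrier SL2C" by (auto simp: SL2C_def det_2)
    show "inv\<^bsub>SL2C\<^esub> a \<in> {mat 1, - mat 1}" if "a \<in> {mat 1, - mat 1}" for a
      using that by (auto simp: inv neg_one_scale2)
    show "a \<otimes>\<^bsub>SL2C\<^esub> b \<in> {mat 1, - mat 1}"
      if "a \<in> {mat 1, - mat 1}" "b \<in> {mat 1, - mat 1}" for a b
      using that by (auto simp: SL2C_def mat2_eq_iff)
  qed auto
  show ?thesis
    unfolding normal_inv_iff
  proof (intro conjI ballI sub)
    fix x h assume x: "x \<in> carrier SL2C" and "h \<in> {mat 1, - mat 1 :: complex^2^2}"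
    then show "x \<otimes>\<^bsub>SL2C\<^esub> h \<otimes>\<^bsub>SL2C\<^esub> inv\<^bsub>SL2C\<^esub> x \<in> {mat 1, - mat 1}"
      by (auto simp: SL2C_def inv[unfolded SL2C_def] neg_one_scale2)
  qed
qed

lemma group_PSL2C: "group PSL2C"
  unfolding PSL2C_def by (rule normal.factorgroup_is_group[OF normal_center])

lemma psl_class_det_1:
  assumes "det A = 1" shows "psl_class A = {A, - A}"
proof (intro Set.set_eqI iffI)
  fix B assume "B \<in> psl_class A"
  then obtain c where "B = scale2 c A" "c\<^sup>2 * det A = 1" by (rule mem_psl_classE)
  then show "B \<in> {A, - A}" using assms by (auto simp: power2_eq_1_iff minus_scale2)
next
  fix B assume "B \<in> {A, - A}"
  then show "B \<in> psl_class A" using assms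
    by (auto simp: mem_psl_class minus_scale2 intro: exI[of _ 1] exI[of _ "-1"])
qed

lemma psl_class_coset:
  assumes "det A = 1" shows "psl_class A = {mat 1, - mat 1} #>\<^bsub>SL2C\<^esub> A"
  by (auto simp: psl_class_det_1[OF assms] r_coset_def SL2C_def mat2_eq_iff)

lemma carrier_PSL2C: "carrier PSL2C = psl_class ` {A. det A = 1}"
  by (auto simp: PSL2C_def FactGroup_def RCOSETS_def psl_class_coset) (auto simp: SL2C_def)

lemma psl_class_det1_rep:
  assumes "det A \<noteq> 0"
  obtains B c where "det B = 1" "c \<noteq> 0" "B = scale2 c A" "psl_class A = psl_class B"
  using psl_class_some[OF assms] psl_class_scale2 det_scale2 by metis

lemma psl_class_in_carrier [simp]: "det A \<noteq> 0 \<Longrightarrow> psl_class A \<in> carrier PSL2C"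
  unfolding carrier_PSL2C by (metis (mono_tags, lifting) imageI mem_Collect_eq psl_class_det1_rep)

lemma carrier_PSL2CE:
  assumes "g \<in> carrier PSL2C" obtains A where "det A = 1" "g = psl_class A"
  using assms by (auto simp: carrier_PSL2C)

lemma psl_class_mult [simp]:
  assumes "det A \<noteq> 0" "det B \<noteq> 0"
  shows "psl_class A \<otimes>\<^bsub>PSL2C\<^esub> psl_class B = psl_class (A ** B)"
proof -
  interpret normal "{mat 1, - mat 1}" SL2C by (rule normal_center)
  obtain A' c where A': "det A' = 1" "c \<noteq> 0" "A' = scale2 c A" "psl_class A = psl_class A'"
    using psl_class_det1_rep[OF assms(1)] .
  obtain B' d where B': "det B' = 1" "d \<noteq> 0" "B' = scale2 d B" "psl_class B = psl_class B'"
    using psl_class_det1_rep[OF assms(2)] .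
  have "psl_class A' \<otimes>\<^bsub>PSL2C\<^esub> psl_class B' = psl_class (A' ** B')"
  proof -
    have mem: "A' \<in> carrier SL2C" "B' \<in> carrier SL2C" using A'(1) B'(1) by (auto simp: SL2C_def)
    have "psl_class A' \<otimes>\<^bsub>PSL2C\<^esub> psl_class B' = psl_class A' <#>\<^bsub>SL2C\<^esub> psl_class B'"
      by (simp only: PSL2C_def FactGroup_def monoid.select_convs)
    also have "\<dots> = {mat 1, - mat 1} #>\<^bsub>SL2C\<^esub> (A' \<otimes>\<^bsub>SL2C\<^esub> B')"
      unfolding psl_class_coset[OF A'(1)] psl_class_coset[OF B'(1)] by (rule rcos_sum[OF mem])
    also have "A' \<otimes>\<^bsub>SL2C\<^esub> B' = A' ** B'" by (simp only: SL2C_def monoid.select_convs)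
    also have "{mat 1, - mat 1} #>\<^bsub>SL2C\<^esub> (A' ** B') = psl_class (A' ** B')"
      using A'(1) B'(1) by (intro psl_class_coset[symmetric]) (simp add: det_mul)
    finally show ?thesis .
  qed
  also have "A' ** B' = scale2 (c * d) (A ** B)" by (simp add: A'(3) B'(3) mult.commute)
  also have "psl_class \<dots> = psl_class (A ** B)" using A'(2) B'(2) by simp
  finally show ?thesis by (simp only: A'(4) B'(4))
qed

lemma one_PSL2C: "\<one>\<^bsub>PSL2C\<^esub> = psl_class (mat 1)"
  unfolding PSL2C_def FactGroup_def by (simp add: psl_class_det_1)

lemma inv_psl_class [simp]:
  assumes "det A \<noteq> 0"
  shows "inv\<^bsub>PSL2C\<^esub> psl_class A = psl_class (adj2 A)"
proof -
  interpret group PSL2C by (rule group_PSL2C)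
  show ?thesis using assms by (intro inv_equality) (auto simp: one_PSL2C)
qed


section \<open>Words in the generators\<close>

type_synonym 'i letter = "'i \<times> bool"

definition flip :: "'i letter \<Rightarrow> 'i letter" where
  "flip x = (fst x, \<not> snd x)"

definition letter_mat :: "('i \<Rightarrow> complex^2^2) \<Rightarrow> 'i letter \<Rightarrow> complex^2^2" where
  "letter_mat M x = (if snd x then M (fst x) else adj2 (M (fst x)))"

primrec word_mat :: "('i \<Rightarrow> complex^2^2) \<Rightarrow> 'i letter list \<Rightarrow> complex^2^2" where
  "word_mat M [] = mat 1"
| "word_mat M (x # w) = letter_mat M x ** word_mat M w"

definition reduced :: "'i letter list \<Rightarrow> bool" where
  "reduced w \<longleftrightarrow> successively (\<lambda>x y. y \<noteq> flip x) w"

lemma flip_flip [simp]: "flip (flip x) = x"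
  by (simp add: flip_def)

lemma flip_neq [simp]: "flip x \<noteq> x" "x \<noteq> flip x"
  by (auto simp: flip_def prod_eq_iff)

lemma reduced_simps [simp]:
  "reduced []" "reduced [x]" "reduced (x # y # w) \<longleftrightarrow> y \<noteq> flip x \<and> reduced (y # w)"
  by (simp_all add: reduced_def)

lemma reduced_append:
  "reduced (u @ v) \<longleftrightarrow> reduced u \<and> reduced v \<and> (u = [] \<or> v = [] \<or> hd v \<noteq> flip (last u))"
  by (auto simp: reduced_def successively_append_iff)

lemma reduced_take: "reduced w \<Longrightarrow> reduced (take n w)"
  and reduced_drop: "reduced w \<Longrightarrow> reduced (drop n w)"
  by (metis append_take_drop_id reduced_append)+

lemma word_mat_append: "word_mat M (u @ v) = word_mat M u ** word_mat M v"
  by (induction u) (simp_all add: matrix_mul_assoc)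

lemma det_letter_mat [simp]: "det (letter_mat M x) = det (M (fst x))"
  by (simp add: letter_mat_def)

lemma det_word_mat: "(\<And>i. det (M i) \<noteq> 0) \<Longrightarrow> det (word_mat M w) \<noteq> 0"
  by (induction w) (simp_all add: det_mul)

lemma letter_mat_flip [simp]:
  "letter_mat M x ** letter_mat M (flip x) = scale2 (det (M (fst x))) (mat 1)"
  by (simp add: letter_mat_def flip_def)

lemma tendsto_word_mat:
  assumes "\<And>i. ((\<lambda>x. N x i) \<longlongrightarrow> M i) F"
  shows "((\<lambda>x. word_mat (N x) w) \<longlongrightarrow> word_mat M w) F"
proof (induction w)
  case (Cons a w)
  have "((\<lambda>x. letter_mat (N x) a) \<longlongrightarrow> letter_mat M a) F"
    using assms by (cases "snd a") (simp_all add: letter_mat_def tendsto_adj2)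
  then show ?case using Cons by (simp add: tendsto_mult2)
qed simp

text \<open>Conjugation is taken with \<open>adj2 B\<close>, so each letter contributes a factor det
  B and the two words agree only up to a nonzero scalar.\<close>

lemma word_mat_conj:
  assumes "det B \<noteq> 0"
  shows "\<exists>c. c \<noteq> 0 \<and> word_mat (\<lambda>i. B ** M i ** adj2 B) w = scale2 c (B ** word_mat M w ** adj2 B)"
proof (induction w)
  case Nil
  show ?case using assms by (intro exI[of _ "1 / det B"]) (simp add: mat2_eq_iff det_2)
next
  case (Cons x w)
  then obtain c where c: "c \<noteq> 0"
    "word_mat (\<lambda>i. B ** M i ** adj2 B) w = scale2 c (B ** word_mat M w ** adj2 B)" by blast
  have l: "letter_mat (\<lambda>i. B ** M i ** adj2 B) x = B ** letter_mat M x ** adj2 B"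
    by (simp add: letter_mat_def adj2_of_mult matrix_mul_assoc)
  have "(B ** letter_mat M x ** adj2 B) ** (B ** word_mat M w ** adj2 B)
      = B ** letter_mat M x ** (adj2 B ** B) ** word_mat M w ** adj2 B"
    by (simp only: matrix_mul_assoc)
  also have "\<dots> = scale2 (det B) (B ** (letter_mat M x ** word_mat M w) ** adj2 B)"
    by (simp add: matrix_mul_assoc)
  finally show ?case using c assms l by (intro exI[of _ "c * det B"]) simp
qed

text \<open>The reduced form and the scalar are the same for all tuples, so relations between free
  generators persist under deformation.\<close>

lemma free_reduction:
  "\<exists>w'. reduced w' \<and> fst ` set w' \<subseteq> fst ` set w \<and>
     (\<forall>M. (\<forall>i. det (M i) \<noteq> 0) \<longrightarrow> (\<exists>c. c \<noteq> 0 \<and> word_mat M w = scale2 c (word_mat M w')))"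
proof (induction w)
  case Nil
  show ?case by (rule exI[of _ "[]"]) (auto intro: exI[of _ 1])
next
  case (Cons x w)
  then obtain w' where w': "reduced w'" "fst ` set w' \<subseteq> fst ` set w"
    "\<And>M. (\<forall>i. det (M i) \<noteq> 0) \<Longrightarrow> \<exists>c. c \<noteq> 0 \<and> word_mat M w = scale2 c (word_mat M w')"
    by blast
  show ?case
  proof (cases "w' \<noteq> [] \<and> hd w' = flip x")
    case True
    then obtain v where v: "w' = flip x # v" by (cases w') auto
    show ?thesis
    proof (intro exI[of _ v] conjI allI impI)
      show "reduced v" using w'(1) v by (cases v) auto
      show "fst ` set v \<subseteq> fst ` set (x # w)" using w'(2) v by auto
      fix M :: "'a \<Rightarrow> complex^2^2" assume M: "\<forall>i. det (M i) \<noteq> 0"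
      obtain c where c: "c \<noteq> 0" "word_mat M w = scale2 c (word_mat M w')" using w'(3)[OF M] by blast
      have "word_mat M (x # w) = scale2 c (letter_mat M x ** letter_mat M (flip x) ** word_mat M v)"
        by (simp add: c v matrix_mul_assoc del: letter_mat_flip)
      also have "\<dots> = scale2 (c * det (M (fst x))) (word_mat M v)"
        by simp
      finally show "\<exists>c. c \<noteq> 0 \<and> word_mat M (x # w) = scale2 c (word_mat M v)"
        using c M by (intro exI[of _ "c * det (M (fst x))"]) simp
    qed
  next
    case False
    show ?thesis
    proof (intro exI[of _ "x # w'"] conjI allI impI)
      show "reduced (x # w')" using w'(1) False by (cases w') auto
      show "fst ` set (x # w') \<subseteq> fst ` set (x # w)" using w'(2) by auto
      fix M :: "'a \<Rightarrow> complex^2^2" assume M: "\<forall>i. det (M i) \<noteq> 0"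
      show "\<exists>c. c \<noteq> 0 \<and> word_mat M (x # w) = scale2 c (word_mat M (x # w'))"
        using w'(3)[OF M] by auto
    qed
  qed
qed

lemma generate_eq_words:
  fixes M :: "'i \<Rightarrow> complex^2^2"
  assumes M: "\<And>i. det (M i) \<noteq> 0"
  shows "generate PSL2C ((\<lambda>i. psl_class (M i)) ` I) =
    (\<lambda>w. psl_class (word_mat M w)) ` {w. fst ` set w \<subseteq> I}" (is "?L = ?R")
proof
  show "?L \<subseteq> ?R"
  proof
    fix g assume "g \<in> ?L"
    then show "g \<in> ?R"
    proof induction
      case one
      show ?case by (rule image_eqI[of _ _ "[]"]) (simp_all add: one_PSL2C)
    next
      case (incl h)
      then obtain i where i: "i \<in> I" "h = psl_class (M i)" by blast
      show ?case by (rule image_eqI[of _ _ "[(i, True)]"])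
          (use i in \<open>simp_all add: letter_mat_def matrix_mul_rid\<close>)
    next
      case (inv h)
      then obtain i where i: "i \<in> I" "h = psl_class (M i)" by blast
      show ?case by (rule image_eqI[of _ _ "[(i, False)]"])
          (use i M in \<open>simp_all add: letter_mat_def matrix_mul_rid\<close>)
    next
      case (eng h1 h2)
      then obtain w1 w2 where "h1 = psl_class (word_mat M w1)" "fst ` set w1 \<subseteq> I"
        "h2 = psl_class (word_mat M w2)" "fst ` set w2 \<subseteq> I" by blast
      then show ?case
        by (intro image_eqI[of _ _ "w1 @ w2"]) (simp_all add: word_mat_append det_word_mat M image_Un)
    qed
  qed
  show "?R \<subseteq> ?L"
  proof
    fix g assume "g \<in> ?R"
    then obtain w where w: "g = psl_class (word_mat M w)" "fst ` set w \<subseteq> I" by blast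
    have "psl_class (word_mat M w) \<in> ?L" using w(2)
    proof (induction w)
      case Nil
      then show ?case by (simp add: one_PSL2C[symmetric] generate.one)
    next
      case (Cons x w)
      have "psl_class (letter_mat M x) \<in> ?L"
      proof (cases "snd x")
        case True
        then show ?thesis using Cons.prems by (auto simp: letter_mat_def intro!: generate.incl)
      next
        case False
        then have "psl_class (letter_mat M x) = inv\<^bsub>PSL2C\<^esub> psl_class (M (fst x))"
          by (simp add: letter_mat_def M)
        then show ?thesis using Cons.prems by (auto intro!: generate.inv)
      qed
      then have "psl_class (letter_mat M x) \<otimes>\<^bsub>PSL2C\<^esub> psl_class (word_mat M w) \<in> ?L"
        using Cons by (intro generate.eng) auto
      then show ?case by (simp add: M det_word_mat)
    qed
    then show "g \<in> ?L" using w by simp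
  qed
qed

lemma generate_eq_reduced_words:
  fixes M :: "'i \<Rightarrow> complex^2^2"
  assumes M: "\<And>i. det (M i) \<noteq> 0"
  shows "generate PSL2C ((\<lambda>i. psl_class (M i)) ` I) =
    (\<lambda>w. psl_class (word_mat M w)) ` {w. reduced w \<and> fst ` set w \<subseteq> I}"
proof -
  have red: "\<exists>w'. reduced w' \<and> fst ` set w' \<subseteq> I \<and> psl_class (word_mat M w) = psl_class (word_mat M w')"
    if "fst ` set w \<subseteq> I" for w
    using free_reduction[of w] M that by (metis (no_types, lifting) psl_class_scale2 subset_trans)
  then show ?thesis unfolding generate_eq_words[OF M]
  proof (intro subset_antisym subsetI)
    fix g assume "g \<in> (\<lambda>w. psl_class (word_mat M w)) ` {w. fst ` set w \<subseteq> I}"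
    then obtain w where "fst ` set w \<subseteq> I" "g = psl_class (word_mat M w)" by blast
    then show "g \<in> (\<lambda>w. psl_class (word_mat M w)) ` {w. reduced w \<and> fst ` set w \<subseteq> I}"
      using red[of w] by blast
  qed auto
qed


text \<open>The boundary of the free group on the letters; its elements code limit points of the
  group.\<close>

definition infinite_words :: "(nat \<Rightarrow> 'i letter) set" where
  "infinite_words = {\<omega>. \<forall>n. \<omega> (Suc n) \<noteq> flip (\<omega> n)}"

definition initial :: "(nat \<Rightarrow> 'i letter) \<Rightarrow> nat \<Rightarrow> 'i letter list" where
  "initial \<omega> n = map \<omega> [0..<n]"

lemma length_initial [simp]: "length (initial \<omega> n) = n"
  by (simp add: initial_def)

lemma initial_eq_Nil [simp]: "initial \<omega> n = [] \<longleftrightarrow> n = 0"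
  by (simp add: initial_def)

lemma reduced_map_upt: "\<omega> \<in> infinite_words \<Longrightarrow> reduced (map \<omega> [m..<n])"
proof (induction n)
  case (Suc n)
  show ?case
  proof (cases "m \<le> n")
    case True
    have "reduced (map \<omega> [m..<n] @ [\<omega> n])"
      unfolding reduced_append
    proof (intro conjI)
      show "map \<omega> [m..<n] = [] \<or> [\<omega> n] = [] \<or> hd [\<omega> n] \<noteq> flip (last (map \<omega> [m..<n]))"
        using Suc.prems by (cases n) (auto simp: infinite_words_def last_map)
    qed (use Suc in auto)
    then show ?thesis using True by simp
  qed simp
qed simp

lemma reduced_initial: "\<omega> \<in> infinite_words \<Longrightarrow> reduced (initial \<omega> n)"
  unfolding initial_def by (rule reduced_map_upt)

lemma initial_split: "m \<le> n \<Longrightarrow> initial \<omega> n = initial \<omega> m @ map \<omega> [m..<n]"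
  unfolding initial_def by (metis le0 le_add_diff_inverse map_append upt_add_eq_append)

lemma hd_initial: "0 < n \<Longrightarrow> hd (initial \<omega> n) = \<omega> 0"
  by (simp add: initial_def hd_map)

section \<open>Contraction estimates for reduced words\<close>

section \<open>Size and centre of a Moebius map\<close>

text \<open>The squared radius of the isometric circle of A, unchanged when A is scaled. The
  derivative satisfies |A'(z)| = csize A / |z - pole A|^2, so away from the pole this number is the
  contraction rate.\<close>

definition csize :: "complex^2^2 \<Rightarrow> real" where
  "csize A = cmod (det A) / (cmod (A$2$1))\<^sup>2"

text \<open>The image of infinity; \<open>pole\<close> below is the preimage of infinity. Both are
  meaningful only when \<open>A$2$1\<close> is nonzero.\<close>

definition centre :: "complex^2^2 \<Rightarrow> complex" where
  "centre A = A$1$1 / A$2$1"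

definition pole :: "complex^2^2 \<Rightarrow> complex" where
  "pole A = - A$2$2 / A$2$1"

definition act :: "complex^2^2 \<Rightarrow> complex \<Rightarrow> complex" where
  "act A z = (A$1$1 * z + A$1$2) / (A$2$1 * z + A$2$2)"

lemma csize_nonneg [simp]: "0 \<le> csize A"
  by (simp add: csize_def)

lemma csize_pos: "det A \<noteq> 0 \<Longrightarrow> A$2$1 \<noteq> 0 \<Longrightarrow> 0 < csize A"
  by (simp add: csize_def)

lemma denominator_pole: "A$2$1 \<noteq> 0 \<Longrightarrow> A$2$1 * z + A$2$2 = A$2$1 * (z - pole A)"
  by (simp add: pole_def field_simps)

lemma act_diff:
  assumes "A$2$1 \<noteq> 0" "z \<noteq> pole A" "z' \<noteq> pole A"
  shows "cmod (act A z - act A z') =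
    csize A * cmod (z - z') / (cmod (z - pole A) * cmod (z' - pole A))"
proof -
  have "act A z - act A z' = det A * (z - z') / ((A$2$1)\<^sup>2 * (z - pole A) * (z' - pole A))"
  proof -
    have nz: "A$2$1 * z + A$2$2 \<noteq> 0" "A$2$1 * z' + A$2$2 \<noteq> 0"
      using assms by (simp_all add: denominator_pole)
    have "act A z - act A z' = det A * (z - z') / ((A$2$1 * z + A$2$2) * (A$2$1 * z' + A$2$2))"
      using nz by (simp add: act_def det_2 divide_simps) (simp add: algebra_simps)
    also have "\<dots> = det A * (z - z') / ((A$2$1 * (z - pole A)) * (A$2$1 * (z' - pole A)))"
      by (simp only: denominator_pole[OF assms(1)])
    finally show ?thesis by (simp add: power2_eq_square mult_ac)
  qed
  then show ?thesis by (simp add: norm_divide norm_mult norm_power csize_def)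
qed

lemma act_centre:
  assumes "A$2$1 \<noteq> 0" "z \<noteq> pole A"
  shows "cmod (act A z - centre A) = csize A / cmod (z - pole A)"
proof -
  have nz: "A$2$1 * z + A$2$2 \<noteq> 0" using assms by (simp add: denominator_pole)
  have "act A z - centre A = - det A / (A$2$1 * (A$2$1 * z + A$2$2))"
    using nz assms by (simp add: act_def centre_def det_2 divide_simps) (simp add: algebra_simps)
  also have "\<dots> = - det A / ((A$2$1)\<^sup>2 * (z - pole A))"
    by (simp add: denominator_pole[OF assms(1)] power2_eq_square mult.assoc)
  finally show ?thesis by (simp add: norm_divide norm_mult norm_power csize_def)
qed

text \<open>The lower left entry of \<open>A ** B\<close> is
  \<open>A$2$1 * B$2$1 * (centre B - pole A)\<close>. Hence sizes multiply up to the distance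
  between the image of infinity under B and the preimage of infinity under A, which ping-pong bounds
  on both sides.\<close>

lemma csize_mult:
  assumes "A$2$1 \<noteq> 0" "B$2$1 \<noteq> 0"
  shows "csize (A ** B) = csize A * csize B / (cmod (centre B - pole A))\<^sup>2"
    and "centre B \<noteq> pole A \<Longrightarrow> centre (A ** B) = act A (centre B)"
proof -
  have "(A ** B)$2$1 = A$2$1 * B$2$1 * (centre B - pole A)"
    using assms by (simp add: centre_def pole_def field_simps)
  then show "csize (A ** B) = csize A * csize B / (cmod (centre B - pole A))\<^sup>2"
    unfolding csize_def by (simp add: det_mul norm_mult power_mult_distrib)
  assume "centre B \<noteq> pole A"
  then have "A$2$1 * centre B + A$2$2 \<noteq> 0" using assms by (simp add: denominator_pole)
  then have "A$2$1 * B$1$1 + A$2$2 * B$2$1 \<noteq> 0" using assms by (simp add: centre_def field_simps)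
  then show "centre (A ** B) = act A (centre B)"
    using assms by (simp add: centre_def act_def divide_simps)
qed

text \<open>Lets the boundary point A(infinity) stand in for the orbit point. With bottom row c, d
  the horizontal distance is |det A| |d| / (|c| (|c|^2 + |d|^2)), and |c| |d| \<le> |c|^2 +
  |d|^2.\<close>

lemma hyp_action_centre:
  assumes "det A \<noteq> 0" "A$2$1 \<noteq> 0"
  shows "cmod (fst (hyp_action (psl_class A) (0, 1)) - centre A) \<le> csize A"
    and "0 < snd (hyp_action (psl_class A) (0, 1))"
    and "snd (hyp_action (psl_class A) (0, 1)) \<le> csize A"
proof -
  define N where "N = (cmod (A$2$1))\<^sup>2 + (cmod (A$2$2))\<^sup>2"
  have N: "0 < N" using assms by (simp add: N_def add_pos_nonneg)
  have Nc: "complex_of_real N = A$2$1 * cnj (A$2$1) + A$2$2 * cnj (A$2$2)"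
    by (simp add: N_def complex_norm_square[symmetric])
  have h: "hyp_action (psl_class A) (0, 1) =
    ((A$1$1 * cnj (A$2$1) + A$1$2 * cnj (A$2$2)) / complex_of_real N, cmod (det A) / N)"
    using hyp_action_psl_class[OF assms(1)] by (simp add: N_def)
  have "fst (hyp_action (psl_class A) (0, 1)) - centre A
      = ((A$1$1 * cnj (A$2$1) + A$1$2 * cnj (A$2$2)) * A$2$1 - A$1$1 * complex_of_real N)
          / (A$2$1 * complex_of_real N)"
    unfolding h centre_def fst_conv using N assms(2) by (simp add: divide_simps)
  also have "\<dots> = - (det A * cnj (A$2$2)) / (A$2$1 * complex_of_real N)"
    unfolding Nc by (simp add: det_2 algebra_simps)
  finally have "cmod (fst (hyp_action (psl_class A) (0, 1)) - centre A)
      = cmod (det A) * cmod (A$2$2) / (cmod (A$2$1) * N)"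
    using N by (simp add: norm_divide norm_mult)
  also have "\<dots> \<le> csize A"
  proof -
    have "2 * (cmod (A$2$2) * cmod (A$2$1)) \<le> N"
      using sum_squares_bound[of "cmod (A$2$2)" "cmod (A$2$1)"] by (simp add: N_def algebra_simps)
    then have "cmod (A$2$2) * cmod (A$2$1) \<le> N"
      using mult_nonneg_nonneg[OF norm_ge_zero norm_ge_zero, of "A$2$2" "A$2$1"] by linarith
    then have "cmod (A$2$2) / (cmod (A$2$1) * N) \<le> 1 / (cmod (A$2$1))\<^sup>2"
      using N assms by (simp add: divide_simps power2_eq_square)
    then show ?thesis unfolding csize_def
      using mult_left_mono[of _ _ "cmod (det A)"] by fastforce
  qed
  finally show "cmod (fst (hyp_action (psl_class A) (0, 1)) - centre A) \<le> csize A" .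
  show "0 < snd (hyp_action (psl_class A) (0, 1))" using h N assms by simp
  have "(cmod (A$2$1))\<^sup>2 \<le> N" by (simp add: N_def)
  then show "snd (hyp_action (psl_class A) (0, 1)) \<le> csize A"
    using h N assms by (simp add: csize_def frac_le)
qed


section \<open>Ping-pong in the plane\<close>

text \<open>The sets are kept apart from the generators because E, \<delta> and R stay fixed while
  the tuple is perturbed.\<close>

locale pingpong_sets =
  fixes E :: "'i::finite letter \<Rightarrow> complex set" and \<delta> R :: real
  assumes compact_E: "compact (E a)"
    and delta_pos: "0 < \<delta>" and R_pos: "0 < R"
    and separated: "a \<noteq> b \<Longrightarrow> z \<in> E a \<Longrightarrow> z' \<in> E b \<Longrightarrow> \<delta> \<le> cmod (z - z')"
    and bounded_E: "z \<in> E a \<Longrightarrow> z' \<in> E b \<Longrightarrow> cmod (z - z') \<le> R"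

text \<open>Each \<open>E a\<close> consists of finite points, so infinity lies outside every set
  and each letter may be applied to it. This is the normalisation that makes \<open>centre\<close>
  and \<open>pole\<close> available for all nonempty reduced words.\<close>

locale pingpong = pingpong_sets E \<delta> R
  for E :: "'i::finite letter \<Rightarrow> complex set" and \<delta> R :: real +
  fixes M :: "'i \<Rightarrow> complex^2^2"
  assumes invertible: "det (M i) \<noteq> 0"
    and pingpong: "\<xi> \<notin> Some ` E (flip a) \<Longrightarrow> moebius_map (letter_mat M a) \<xi> \<in> Some ` E a"
begin

lemma disjoint_E: "a \<noteq> b \<Longrightarrow> z \<in> E a \<Longrightarrow> z \<notin> E b"
  using separated[of a b z z] delta_pos by auto

lemma det_word [simp]: "det (word_mat M w) \<noteq> 0"
  by (rule det_word_mat[OF invertible])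

lemma word_maps_into:
  assumes "reduced w" "w \<noteq> []" "\<xi> \<notin> Some ` E (flip (last w))"
  shows "moebius_map (word_mat M w) \<xi> \<in> Some ` E (hd w)"
  using assms
proof (induction w)
  case (Cons x w)
  show ?case
  proof (cases w)
    case Nil
    then show ?thesis using Cons.prems pingpong[of \<xi> x] by (simp add: matrix_mul_rid)
  next
    case (Cons y v)
    then have "moebius_map (word_mat M w) \<xi> \<in> Some ` E y"
      using Cons.IH Cons.prems by auto
    then obtain z where z: "moebius_map (word_mat M w) \<xi> = Some z" "z \<in> E y" by blast
    have "y \<noteq> flip x" using Cons Cons.prems by simp
    then have "z \<notin> E (flip x)" using disjoint_E z(2) by blast
    then have "moebius_map (word_mat M w) \<xi> \<notin> Some ` E (flip x)" using z(1) by auto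
    then have "moebius_map (letter_mat M x) (moebius_map (word_mat M w) \<xi>) \<in> Some ` E x"
      by (rule pingpong)
    then show ?thesis by (simp add: moebius_map_mult invertible)
  qed
qed simp

lemma word_21 [simp]: "reduced w \<Longrightarrow> w \<noteq> [] \<Longrightarrow> word_mat M w $ 2 $ 1 \<noteq> 0"
  and centre_in: "reduced w \<Longrightarrow> w \<noteq> [] \<Longrightarrow> centre (word_mat M w) \<in> E (hd w)"
proof -
  assume "reduced w" "w \<noteq> []"
  then have "moebius_map (word_mat M w) None \<in> Some ` E (hd w)"
    by (rule word_maps_into) auto
  then show "word_mat M w $ 2 $ 1 \<noteq> 0" "centre (word_mat M w) \<in> E (hd w)"
    by (auto simp: moebius_map_def centre_def split: if_splits)
qed

text \<open>A point outside \<open>E (flip (last w))\<close> is sent to a finite point, and the pole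
  is not.\<close>

lemma pole_in:
  assumes "reduced w" "w \<noteq> []" shows "pole (word_mat M w) \<in> E (flip (last w))"
proof (rule ccontr)
  assume "pole (word_mat M w) \<notin> E (flip (last w))"
  then have "moebius_map (word_mat M w) (Some (pole (word_mat M w))) \<in> Some ` E (hd w)"
    using word_maps_into[OF assms] by blast
  moreover have "moebius_map (word_mat M w) (Some (pole (word_mat M w))) = None"
    using word_21[OF assms] by (simp add: moebius_map_def denominator_pole)
  ultimately show False by auto
qed

lemma pole_distance:
  assumes "reduced w" "w \<noteq> []" "z \<in> E a" "a \<noteq> flip (last w)"
  shows "\<delta> \<le> cmod (z - pole (word_mat M w))" "cmod (z - pole (word_mat M w)) \<le> R"
  using separated[OF assms(4) assms(3) pole_in[OF assms(1,2)]]
    bounded_E[OF assms(3) pole_in[OF assms(1,2)]] by auto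

lemma csize_word_pos: "reduced w \<Longrightarrow> w \<noteq> [] \<Longrightarrow> 0 < csize (word_mat M w)"
  by (simp add: csize_pos)

text \<open>The centre of v lies in \<open>E (hd v)\<close> and the pole of u in
  \<open>E (flip (last u))\<close>. Reducedness of the concatenation says that these are different
  sets, so their distance is between \<delta> and R; the claims follow from this and the formulas
  for a single Moebius map.\<close>

lemma append_estimates:
  assumes "reduced (u @ v)" "u \<noteq> []" "v \<noteq> []"
  shows "csize (word_mat M (u @ v)) \<le> csize (word_mat M u) * csize (word_mat M v) / \<delta>\<^sup>2"
    and "cmod (centre (word_mat M (u @ v)) - centre (word_mat M u)) \<le> csize (word_mat M u) / \<delta>"
    and "csize (word_mat M u) / R \<le> cmod (centre (word_mat M (u @ v)) - centre (word_mat M u))"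
    and "centre (word_mat M (u @ v)) = act (word_mat M u) (centre (word_mat M v))"
proof -
  let ?A = "word_mat M u" and ?B = "word_mat M v"
  have r: "reduced u" "reduced v" "hd v \<noteq> flip (last u)" using assms by (auto simp: reduced_append)
  have d: "\<delta> \<le> cmod (centre ?B - pole ?A)" "cmod (centre ?B - pole ?A) \<le> R"
    using pole_distance[OF r(1) assms(2) centre_in[OF r(2) assms(3)] r(3)] by auto
  have ne: "centre ?B \<noteq> pole ?A" using d delta_pos by auto
  have sq: "\<delta>\<^sup>2 \<le> (cmod (centre ?B - pole ?A))\<^sup>2" using d(1) delta_pos by (intro power_mono) auto
  show "csize (word_mat M (u @ v)) \<le> csize ?A * csize ?B / \<delta>\<^sup>2"
    unfolding word_mat_append csize_mult(1)[OF word_21[OF r(1) assms(2)] word_21[OF r(2) assms(3)]]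
    using sq delta_pos by (intro frac_le) auto
  show c: "centre (word_mat M (u @ v)) = act ?A (centre ?B)"
    unfolding word_mat_append
    using csize_mult(2)[OF word_21[OF r(1) assms(2)] word_21[OF r(2) assms(3)] ne] .
  have e: "cmod (centre (word_mat M (u @ v)) - centre ?A) = csize ?A / cmod (centre ?B - pole ?A)"
    unfolding c by (rule act_centre[OF word_21[OF r(1) assms(2)] ne])
  show "cmod (centre (word_mat M (u @ v)) - centre ?A) \<le> csize ?A / \<delta>"
    unfolding e using d delta_pos by (intro divide_left_mono mult_pos_pos) auto
  show "csize ?A / R \<le> cmod (centre (word_mat M (u @ v)) - centre ?A)"
    unfolding e using d delta_pos R_pos by (intro divide_left_mono mult_pos_pos) auto
qed

text \<open>Repeating the last letter keeps the word reduced and its first letter unchanged. Both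
  centres then lie in the same set, at distance at most R, while the lower estimate gives at least
  size / R.\<close>

lemma csize_le:
  assumes "reduced w" "w \<noteq> []" shows "csize (word_mat M w) \<le> R\<^sup>2"
proof -
  have r: "reduced (w @ [last w])" using assms by (simp add: reduced_append)
  have "csize (word_mat M w) / R \<le> cmod (centre (word_mat M (w @ [last w])) - centre (word_mat M w))"
    using append_estimates(3)[OF r assms(2)] by simp
  also have "\<dots> \<le> R" using centre_in[OF r] centre_in[OF assms] by (intro bounded_E) auto
  finally show ?thesis using R_pos by (simp add: field_simps power2_eq_square)
qed

text \<open>The centres of the initial segments of an infinite word are separated by the sizes of the
  segments, and they stay in a bounded set.\<close>

lemma csize_initial_tendsto:
  assumes w: "\<omega> \<in> infinite_words"
  shows "(\<lambda>n. csize (word_mat M (initial \<omega> n))) \<longlonglongrightarrow> 0"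
proof (rule ccontr)
  define r where "r n = csize (word_mat M (initial \<omega> (Suc n)))" for n
  define x where "x n = centre (word_mat M (initial \<omega> (Suc n)))" for n
  assume "\<not> (\<lambda>n. csize (word_mat M (initial \<omega> n))) \<longlonglongrightarrow> 0"
  then have "\<not> r \<longlonglongrightarrow> 0" unfolding r_def 
    using LIMSEQ_imp_Suc[of "\<lambda>n. csize (word_mat M (initial \<omega> n))" 0] by blast
  then obtain e where e: "e > 0" "\<And>n0. \<exists>n\<ge>n0. e \<le> r n"
    unfolding LIMSEQ_def by (force simp: r_def not_less)
  then have "infinite {n. e \<le> r n}" by (auto simp: infinite_nat_iff_unbounded_le)
  then obtain s :: "nat \<Rightarrow> nat" where s: "strict_mono s" "\<And>n. e \<le> r (s n)"
    using infinite_enumerate by blast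
  have far: "r n / R \<le> cmod (x m - x n)" if "n < m" for m n
    using append_estimates(3)[of "initial \<omega> (Suc n)" "map \<omega> [Suc n..<Suc m]"] that
      reduced_initial[OF w, of "Suc m"]
    by (simp add: x_def r_def initial_split[of "Suc n" "Suc m"])
  have "range (x \<circ> s) \<subseteq> E (\<omega> 0)"
    using centre_in[OF reduced_initial[OF w]] by (auto simp: x_def hd_initial) 
  then obtain l t where t: "strict_mono t" "((x \<circ> s) \<circ> t) \<longlonglongrightarrow> l"
    using compact_E[of "\<omega> 0"] unfolding compact_def by (metis range_subsetD)
  then have "Cauchy ((x \<circ> s) \<circ> t)" by (simp add: LIMSEQ_imp_Cauchy)
  then obtain k where k: "\<And>m n. m \<ge> k \<Longrightarrow> n \<ge> k \<Longrightarrow> dist (x (s (t m))) (x (s (t n))) < e / R"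
    using e(1) R_pos unfolding Cauchy_def by (force dest: spec[of _ "e / R"])
  have "s (t k) < s (t (Suc k))" using s(1) t(1) by (simp add: strict_mono_def)
  then have "r (s (t k)) / R \<le> cmod (x (s (t (Suc k))) - x (s (t k)))" by (rule far)
  moreover have "e / R \<le> r (s (t k)) / R" using s(2) R_pos by (simp add: divide_right_mono)
  ultimately show False using k[of "Suc k" k] by (simp add: dist_norm)
qed

definition limit_point :: "(nat \<Rightarrow> 'i letter) \<Rightarrow> complex" where
  "limit_point \<omega> = lim (\<lambda>n. centre (word_mat M (initial \<omega> n)))"

text \<open>Every later centre stays within size / \<delta> of an earlier one, so sizes tending to
  zero already give a Cauchy sequence, whatever the rate of decay.\<close>

lemma limit_point:
  assumes w: "\<omega> \<in> infinite_words"
  shows "(\<lambda>n. centre (word_mat M (initial \<omega> n))) \<longlonglongrightarrow> limit_point \<omega>"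
proof -
  let ?x = "\<lambda>n. centre (word_mat M (initial \<omega> n))"
  have near: "cmod (?x n - ?x m) \<le> csize (word_mat M (initial \<omega> m)) / \<delta>" if "0 < m" "m \<le> n" for m n
  proof (cases "m = n")
    case False
    then show ?thesis
      using append_estimates(2)[of "initial \<omega> m" "map \<omega> [m..<n]"] that reduced_initial[OF w, of n]
      by (simp add: initial_split[of m n])
  qed (use delta_pos in simp)
  have "Cauchy ?x"
  proof (rule metric_CauchyI)
    fix e :: real assume e: "0 < e"
    have "\<forall>\<^sub>F n in sequentially. csize (word_mat M (initial \<omega> n)) < e * \<delta> / 2"
      using csize_initial_tendsto[OF w] e delta_pos by (intro order_tendstoD) auto
    then have "\<forall>\<^sub>F n in sequentially. csize (word_mat M (initial \<omega> n)) < e * \<delta> / 2 \<and> 0 < n"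
      using eventually_gt_at_top by (rule eventually_conj)
    then obtain k where k: "csize (word_mat M (initial \<omega> k)) < e * \<delta> / 2" "0 < k"
      by (auto simp: eventually_sequentially)
    have "cmod (?x n - ?x k) < e / 2" if "k \<le> n" for n
    proof -
      have "csize (word_mat M (initial \<omega> k)) / \<delta> < e / 2"
        using k delta_pos by (simp add: field_simps)
      then show ?thesis using near[OF k(2) that] by linarith
    qed
    then have "dist (?x k) (?x n) < e / 2" if "k \<le> n" for n
      using that by (metis dist_commute dist_norm)
    then have "dist (?x m) (?x n) < e" if "k \<le> m" "k \<le> n" for m n
      using that by (intro dist_triangle_half_r[of "?x k" "?x m" e "?x n"])
    then show "\<exists>k. \<forall>m\<ge>k. \<forall>n\<ge>k. dist (?x m) (?x n) < e" by blast
  qed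
  then show ?thesis unfolding limit_point_def
    by (simp add: Cauchy_convergent_iff convergent_LIMSEQ_iff)
qed

text \<open>Behind the common prefix the two words continue into different sets, hence at distance
  at least \<delta>, and the prefix shrinks this by no more than the factor size / R^2. The case n =
  0 is separate because the empty word has no meaningful size.\<close>

lemma limit_point_diff:
  assumes w: "\<omega> \<in> infinite_words" "\<omega>' \<in> infinite_words"
    and eq: "initial \<omega> n = initial \<omega>' n" and ne: "\<omega> n \<noteq> \<omega>' n"
  shows "n = 0 \<Longrightarrow> \<delta> \<le> cmod (limit_point \<omega> - limit_point \<omega>')"
    and "0 < n \<Longrightarrow> csize (word_mat M (initial \<omega> n)) * \<delta> / R\<^sup>2 \<le> cmod (limit_point \<omega> - limit_point \<omega>')"
proof -
  have lim: "(\<lambda>m. cmod (centre (word_mat M (initial \<omega> m)) - centre (word_mat M (initial \<omega>' m))))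
      \<longlonglongrightarrow> cmod (limit_point \<omega> - limit_point \<omega>')"
    by (intro tendsto_intros limit_point w)
  show "\<delta> \<le> cmod (limit_point \<omega> - limit_point \<omega>')" if "n = 0"
  proof (rule tendsto_lowerbound[OF lim])
    show "\<forall>\<^sub>F m in sequentially.
        \<delta> \<le> cmod (centre (word_mat M (initial \<omega> m)) - centre (word_mat M (initial \<omega>' m)))"
      using eventually_gt_at_top[of 0]
    proof eventually_elim
      case (elim m)
      then show ?case
        using centre_in[OF reduced_initial[OF w(1)], of m] centre_in[OF reduced_initial[OF w(2)], of m]
          ne that by (intro separated) (auto simp: hd_initial)
    qed
  qed simp
  show "csize (word_mat M (initial \<omega> n)) * \<delta> / R\<^sup>2 \<le> cmod (limit_point \<omega> - limit_point \<omega>')" if n: "0 < n"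
  proof (rule tendsto_lowerbound[OF lim])
    let ?A = "word_mat M (initial \<omega> n)"
    show "\<forall>\<^sub>F m in sequentially. csize ?A * \<delta> / R\<^sup>2
        \<le> cmod (centre (word_mat M (initial \<omega> m)) - centre (word_mat M (initial \<omega>' m)))"
      using eventually_gt_at_top[of n]
    proof eventually_elim
      case (elim m)
      define z where "z = centre (word_mat M (map \<omega> [n..<m]))"
      define z' where "z' = centre (word_mat M (map \<omega>' [n..<m]))"
      have c: "centre (word_mat M (initial \<omega> m)) = act ?A z"
        using append_estimates(4)[of "initial \<omega> n" "map \<omega> [n..<m]"] elim n
          reduced_initial[OF w(1), of m] by (simp add: initial_split[of n m] z_def)
      have c': "centre (word_mat M (initial \<omega>' m)) = act ?A z'"
        using append_estimates(4)[of "initial \<omega>' n" "map \<omega>' [n..<m]"] elim n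
          reduced_initial[OF w(2), of m] by (simp add: initial_split[of n m] z'_def eq)
      have z: "z \<in> E (\<omega> n)" 
        using centre_in[OF reduced_map_upt[OF w(1), of n m]] elim by (simp add: z_def hd_map)
      have z': "z' \<in> E (\<omega>' n)"
        using centre_in[OF reduced_map_upt[OF w(2), of n m]] elim by (simp add: z'_def hd_map)
      have last: "last (initial \<omega> n) = \<omega> (n - 1)" "last (initial \<omega>' n) = \<omega>' (n - 1)"
        using n by (simp_all add: initial_def last_map)
      have l: "\<omega> n \<noteq> flip (last (initial \<omega> n))" "\<omega>' n \<noteq> flip (last (initial \<omega> n))"
      proof -
        have "\<omega> (Suc (n - 1)) \<noteq> flip (\<omega> (n - 1))" "\<omega>' (Suc (n - 1)) \<noteq> flip (\<omega>' (n - 1))"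
          using w unfolding infinite_words_def by blast+
        then show "\<omega> n \<noteq> flip (last (initial \<omega> n))" "\<omega>' n \<noteq> flip (last (initial \<omega> n))"
          using n last(1) last(2)[folded eq] by simp_all
      qed
      have A: "?A $ 2 $ 1 \<noteq> 0" using n reduced_initial[OF w(1)] by simp
      have d: "\<delta> \<le> cmod (z - pole ?A)" "cmod (z - pole ?A) \<le> R"
        "\<delta> \<le> cmod (z' - pole ?A)" "cmod (z' - pole ?A) \<le> R"
        using pole_distance[OF reduced_initial[OF w(1)] _ z l(1)]
          pole_distance[OF reduced_initial[OF w(1)] _ z' l(2)] n by auto
      have "cmod (act ?A z - act ?A z') = csize ?A * cmod (z - z') / (cmod (z - pole ?A) * cmod (z' - pole ?A))"
        using d delta_pos by (intro act_diff A) auto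
      moreover have "csize ?A * \<delta> / R\<^sup>2 \<le> csize ?A * cmod (z - z') / (cmod (z - pole ?A) * cmod (z' - pole ?A))"
        unfolding power2_eq_square
        using separated[OF ne z z'] d delta_pos R_pos
        by (intro frac_le mult_mono mult_pos_pos) auto
      ultimately show ?case by (simp add: c c')
    qed
  qed simp
qed

end


section \<open>Dimension of the limit set through finite families of words\<close>

section \<open>Cut sets of words\<close>

text \<open>Koenig's lemma for a prefix-closed set of reduced words. The branch follows the words w
  with \<open>G w\<close>, those having extensions in T by every length.\<close>

lemma infinite_word_of_tree:
  fixes T :: "'i::finite letter list set"
  assumes closed: "\<And>w n. w \<in> T \<Longrightarrow> take n w \<in> T"
    and red: "\<And>w. w \<in> T \<Longrightarrow> reduced w"
    and unbounded: "\<And>n. \<exists>w\<in>T. length w = n"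
  obtains \<omega> where "\<omega> \<in> infinite_words" "\<And>n. initial \<omega> n \<in> T"
proof -
  define G where "G w \<longleftrightarrow> (\<forall>n. \<exists>v. length v = n \<and> w @ v \<in> T)" for w
  have step: "\<exists>a. G (w @ [a])" if Gw: "G w" for w
  proof (rule ccontr)
    assume "\<nexists>a. G (w @ [a])"
    then obtain n where n: "\<And>a v. length v = n a \<Longrightarrow> w @ [a] @ v \<notin> T"
      unfolding G_def by (metis append.assoc)
    \<comment> \<open>The alphabet is finite, so one extension longer than all the failure lengths
      \<open>n a\<close> refutes them at once; the \<open>Suc\<close> accounts for the first letter
      a.\<close>
    obtain v where v: "length v = Suc (Max (range n))" "w @ v \<in> T"
      using Gw unfolding G_def by blast
    obtain a v' where a: "v = a # v'" using v(1) by (cases v) auto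
    have le: "n a \<le> length v'" using v(1) a by simp
    have "take (length w + Suc (n a)) (w @ v) = w @ [a] @ take (n a) v'"
      by (simp add: a)
    then show False using closed[OF v(2), of "length w + Suc (n a)"] n[of "take (n a) v'" a] le by simp
  qed
  define f where "f = rec_nat [] (\<lambda>_ w. w @ [SOME a. G (w @ [a])])"
  define \<omega> where "\<omega> n = (SOME a. G (f n @ [a]))" for n
  have f: "f 0 = []" "f (Suc n) = f n @ [\<omega> n]" for n by (simp_all add: f_def \<omega>_def)
  have G: "G (f n)" for n
  proof (induction n)
    case 0
    show ?case using unbounded unfolding G_def f by (metis append_Nil)
  next
    case (Suc n)
    show ?case unfolding f(2) \<omega>_def by (rule someI_ex[OF step[OF Suc]])
  qed
  have i: "initial \<omega> n = f n" for n
    by (induction n) (simp_all add: initial_def f)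
  have T: "initial \<omega> n \<in> T" for n
    using G[of n] unfolding i G_def by force
  have "\<omega> (Suc n) \<noteq> flip (\<omega> n)" for n
    using red[OF T[of "Suc (Suc n)"]] by (simp add: i f reduced_append)
  then show ?thesis using that T by (auto simp: infinite_words_def)
qed

text \<open>A finite cross-section of the tree of reduced words which every word has met by length
  N. Its elements may be prefixes of one another; redundancy only enlarges the sums. The empty word
  is excluded since it has no size.\<close>

definition complete_cut :: "'i letter list set \<Rightarrow> nat \<Rightarrow> bool" where
  "complete_cut W N \<longleftrightarrow> finite W \<and> (\<forall>w\<in>W. reduced w \<and> w \<noteq> []) \<and>
     (\<forall>w. reduced w \<and> length w = N \<longrightarrow> (\<exists>n. take n w \<in> W))"

lemma complete_cut_prefix:
  assumes "complete_cut W N" "reduced w" "N \<le> length w"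
  obtains n where "n \<le> N" "take n w \<in> W"
proof -
  obtain n where "take n (take N w) \<in> W"
    using assms reduced_take[OF assms(2), of N] by (auto simp: complete_cut_def)
  then show ?thesis using that[of "min n N"] by (simp add: min.commute)
qed

text \<open>The cut iterated n times, with no cancellation at the joints. Being a set of
  concatenations, it counts a word with several factorisations once.\<close>

primrec cut_chains :: "'i letter list set \<Rightarrow> nat \<Rightarrow> 'i letter list set" where
  "cut_chains W 0 = {[]}"
| "cut_chains W (Suc n) = {u @ v | u v. u \<in> W \<and> v \<in> cut_chains W n \<and> reduced (u @ v)}"

lemma cut_chains_Suc_subset:
  "cut_chains W (Suc n) \<subseteq> (\<lambda>(u, v). u @ v) ` {(u, v) \<in> W \<times> cut_chains W n. reduced (u @ v)}"
  by auto

lemma finite_cut_chains: "finite W \<Longrightarrow> finite (cut_chains W n)"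
proof (induction n)
  case (Suc n)
  have "finite (W \<times> cut_chains W n)" using Suc by simp
  then have "finite {(u, v) \<in> W \<times> cut_chains W n. reduced (u @ v)}"
    by (rule rev_finite_subset) blast
  then show ?case by (rule finite_surj[OF _ cut_chains_Suc_subset])
qed simp

lemma cut_chains_nonempty: "complete_cut W N \<Longrightarrow> w \<in> cut_chains W (Suc n) \<Longrightarrow> w \<noteq> []"
  by (auto simp: complete_cut_def)

text \<open>Each factor uses up at most N letters, hence the length n * N.\<close>

lemma cut_chains_prefix:
  assumes "complete_cut W N"
  shows "reduced w \<Longrightarrow> n * N \<le> length w \<Longrightarrow> \<exists>k. take k w \<in> cut_chains W n"
proof (induction n arbitrary: w)
  case (Suc n)
  have "N \<le> length w" using Suc.prems(2) by simp
  then obtain m where m: "m \<le> N" "take m w \<in> W"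
    using complete_cut_prefix[OF assms Suc.prems(1)] by blast
  have "reduced (drop m w)" "n * N \<le> length (drop m w)" using Suc.prems m reduced_drop by auto
  then obtain k where k: "take k (drop m w) \<in> cut_chains W n" using Suc.IH by blast
  have eq: "take (m + k) w = take m w @ take k (drop m w)" by (rule take_add)
  have "reduced (take m w @ take k (drop m w))"
    using reduced_take[OF Suc.prems(1), of "m + k"] by (simp only: eq)
  then have "take (m + k) w \<in> cut_chains W (Suc n)" unfolding eq cut_chains.simps using m(2) k by blast
  then show ?case by blast
qed simp

context pingpong
begin

text \<open>Each set of the cover is charged to a single word: the longest common initial segment of the
  infinite words whose limit points lie in the set.\<close>

lemma exists_small_cut:
  fixes \<Omega> :: "nat \<Rightarrow> (nat \<Rightarrow> 'i letter) set" and d :: "nat \<Rightarrow> real"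
  assumes s: "0 < s" and cover: "infinite_words \<subseteq> (\<Union>j. \<Omega> j)"
    and sub: "\<And>j. \<Omega> j \<subseteq> infinite_words"
    and d: "\<And>j. 0 \<le> d j" "\<And>j. d j < \<delta>"
    and close: "\<And>j \<omega> \<omega>'. \<omega> \<in> \<Omega> j \<Longrightarrow> \<omega>' \<in> \<Omega> j \<Longrightarrow> cmod (limit_point \<omega> - limit_point \<omega>') \<le> d j"
    and sum: "summable (\<lambda>j. d j powr s)" and e: "0 < e"
  shows "\<exists>W N. complete_cut W N \<and>
    (\<Sum>w\<in>W. csize (word_mat M w) powr s) \<le> (R\<^sup>2 / \<delta>) powr s * (\<Sum>j. d j powr s) + e"
proof -
  \<comment> \<open>The first term pays for the diameter of the j-th set. The second, of total mass
    e, pays for sets containing a single infinite word, where the diameter may vanish but every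
    prefix still has positive size.\<close>
  define b where "b j = (R\<^sup>2 / \<delta>) powr s * d j powr s + e * (1/2) ^ Suc j" for j
  have b: "summable b" "suminf b = (R\<^sup>2 / \<delta>) powr s * (\<Sum>j. d j powr s) + e"
  proof -
    have "(\<lambda>j. (R\<^sup>2 / \<delta>) powr s * d j powr s + e * (1/2) ^ Suc j) sums
        ((R\<^sup>2 / \<delta>) powr s * (\<Sum>j. d j powr s) + e * 1)"
      by (intro sums_add sums_mult summable_sums sum power_half_series)
    then have "b sums ((R\<^sup>2 / \<delta>) powr s * (\<Sum>j. d j powr s) + e)" by (simp add: b_def[abs_def])
    then show "summable b" "suminf b = (R\<^sup>2 / \<delta>) powr s * (\<Sum>j. d j powr s) + e"
      by (auto simp: sums_iff)
  qed
  have b_nonneg: "0 \<le> b j" for j using e by (simp add: b_def)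
  have "\<exists>u. \<Omega> j \<noteq> {} \<longrightarrow> reduced u \<and> u \<noteq> [] \<and> (\<forall>\<omega>\<in>\<Omega> j. initial \<omega> (length u) = u) \<and>
      csize (word_mat M u) powr s \<le> b j" for j
  proof (cases "\<exists>\<omega>\<in>\<Omega> j. \<exists>\<omega>'\<in>\<Omega> j. \<omega> \<noteq> \<omega>'")
    case True
    define P where "P n \<longleftrightarrow> (\<exists>\<omega>\<in>\<Omega> j. \<exists>\<omega>'\<in>\<Omega> j. \<omega> n \<noteq> \<omega>' n)" for n
    define n where "n = (LEAST n. P n)"
    have "\<exists>n. P n" using True by (auto simp: P_def fun_eq_iff)
    then have Pn: "P n" unfolding n_def by (rule LeastI_ex)
    have least: "\<not> P m" if "m < n" for m using that not_less_Least unfolding n_def by blast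
    obtain \<omega> \<omega>' where w: "\<omega> \<in> \<Omega> j" "\<omega>' \<in> \<Omega> j" "\<omega> n \<noteq> \<omega>' n" using Pn P_def by blast
    have agree: "initial x n = initial \<omega> n" if "x \<in> \<Omega> j" for x
      using least that w(1) by (auto simp: initial_def P_def)
    have iw: "\<omega> \<in> infinite_words" "\<omega>' \<in> infinite_words" using w sub by blast+
    note diff = limit_point_diff[OF iw agree[OF w(2), symmetric] w(3)]
    \<comment> \<open>Words differing in their first letter have limit points at distance at least
      \<delta>, which the bound on \<open>d j\<close> excludes.\<close>
    have "0 < n" using diff(1) close[OF w(1,2)] d(2)[of j] by (cases n) auto
    have "csize (word_mat M (initial \<omega> n)) * \<delta> / R\<^sup>2 \<le> d j"
      using diff(2)[OF \<open>0 < n\<close>] close[OF w(1,2)] by linarith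
    then have "csize (word_mat M (initial \<omega> n)) \<le> R\<^sup>2 / \<delta> * d j"
      using delta_pos R_pos by (simp add: field_simps)
    then have "csize (word_mat M (initial \<omega> n)) powr s \<le> (R\<^sup>2 / \<delta> * d j) powr s"
      using s by (intro powr_mono2) auto
    also have "\<dots> = (R\<^sup>2 / \<delta>) powr s * d j powr s"
      by (rule powr_mult)
    also have "\<dots> \<le> b j" using e by (simp add: b_def)
    finally show ?thesis using agree \<open>0 < n\<close> reduced_initial[OF iw(1)]
      by (intro exI[of _ "initial \<omega> n"]) auto
  next
    case single: False
    show ?thesis
    proof (cases "\<Omega> j = {}")
      case False
      then obtain \<omega> where w: "\<Omega> j = {\<omega>}" using single by blast
      have iw: "\<omega> \<in> infinite_words" using w sub by blast
      have "(\<lambda>n. csize (word_mat M (initial \<omega> n)) powr s) \<longlonglongrightarrow> 0 powr s"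
        by (rule tendsto_powr'[OF csize_initial_tendsto[OF iw] tendsto_const]) (use s in simp)
      then have "(\<lambda>n. csize (word_mat M (initial \<omega> n)) powr s) \<longlonglongrightarrow> 0" using s by simp
      moreover have "0 < e * (1/2) ^ Suc j" using e by simp
      ultimately have "\<forall>\<^sub>F n in sequentially. csize (word_mat M (initial \<omega> n)) powr s < e * (1/2) ^ Suc j"
        by (rule order_tendstoD)
      then have "\<forall>\<^sub>F n in sequentially. csize (word_mat M (initial \<omega> n)) powr s < e * (1/2) ^ Suc j \<and> 0 < n"
        using eventually_gt_at_top by (rule eventually_conj)
      then obtain n where n: "csize (word_mat M (initial \<omega> n)) powr s < e * (1/2) ^ Suc j" "0 < n"
        by (auto simp: eventually_sequentially)
      have "e * (1/2) ^ Suc j \<le> b j" by (simp add: b_def)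
      then show ?thesis using n w reduced_initial[OF iw]
        by (intro exI[of _ "initial \<omega> n"]) auto
    qed simp
  qed
  then obtain u where u: "\<And>j. \<Omega> j \<noteq> {} \<Longrightarrow> reduced (u j) \<and> u j \<noteq> [] \<and>
      (\<forall>\<omega>\<in>\<Omega> j. initial \<omega> (length (u j)) = u j) \<and> csize (word_mat M (u j)) powr s \<le> b j"
    by metis
  define J where "J = {j. \<Omega> j \<noteq> {}}"
  \<comment> \<open>T collects the reduced words that avoid all chosen prefixes. If it had words of
    every length, Koenig's lemma would give an infinite word in none of the sets \<Omega> j; this is
    how countably many sets are reduced to a finite cut.\<close>
  define T where "T = {w. reduced w \<and> (\<forall>j\<in>J. \<forall>n. take n w \<noteq> u j)}"
  have "\<exists>N. \<forall>w\<in>T. length w \<noteq> N"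
  proof (rule ccontr)
    assume "\<nexists>N. \<forall>w\<in>T. length w \<noteq> N"
    then have unb: "\<exists>w\<in>T. length w = n" for n by blast
    obtain \<omega> where w: "\<omega> \<in> infinite_words" "\<And>n. initial \<omega> n \<in> T"
      by (rule infinite_word_of_tree[of T]) (use unb in \<open>auto simp: T_def reduced_take\<close>)
    obtain j where j: "\<omega> \<in> \<Omega> j" using w cover by blast
    then have "take (length (u j)) (initial \<omega> (length (u j))) = u j" using u[of j] by auto
    then show False using w(2)[of "length (u j)"] j unfolding T_def J_def by blast
  qed
  then obtain N where N: "\<And>w. w \<in> T \<Longrightarrow> length w \<noteq> N" by blast
  define W where "W = {w \<in> u ` J. length w \<le> N}"
  have "finite W"
    by (rule finite_subset[OF _ finite_lists_length_le[OF finite_class.finite_UNIV, of N]]) (auto simp: W_def)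
  moreover have "\<exists>n. take n w \<in> W" if w: "reduced w" "length w = N" for w
  proof -
    obtain j n where "j \<in> J" "take n w = u j" using N[of w] w by (auto simp: T_def)
    moreover have "length (take n w) \<le> N" using w(2) by simp
    ultimately have "take n w \<in> W" unfolding W_def by simp
    then show ?thesis by blast
  qed
  ultimately have cut: "complete_cut W N" using u by (auto simp: complete_cut_def W_def J_def)
  \<comment> \<open>Several sets may be charged to the same word; picking one index per word makes
    the sum over W a partial sum of b.\<close>
  have "\<forall>w\<in>W. \<exists>j\<in>J. u j = w" by (auto simp: W_def)
  then obtain idx where idx: "\<And>w. w \<in> W \<Longrightarrow> idx w \<in> J \<and> u (idx w) = w" by metis
  have inj: "inj_on idx W" using idx by (metis inj_onI)
  have "(\<Sum>w\<in>W. csize (word_mat M w) powr s) \<le> (\<Sum>w\<in>W. b (idx w))"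
    using idx u by (intro sum_mono) (metis (mono_tags, lifting) J_def mem_Collect_eq)
  also have "\<dots> = sum b (idx ` W)" by (simp add: sum.reindex[OF inj])
  also have "\<dots> \<le> suminf b"
    using \<open>finite W\<close> b(1) b_nonneg by (intro sum_le_suminf) auto
  finally show ?thesis using cut b(2) by auto
qed

text \<open>Division by \<delta>^2 absorbs the error in \<open>append_estimates\<close>, so that
  weights are submultiplicative. The value at the empty word is set by hand: the identity has lower
  left entry 0, so its \<open>csize\<close> is 0 through division by zero.\<close>

definition weight :: "real \<Rightarrow> 'i letter list \<Rightarrow> real" where
  "weight s w = (if w = [] then 1 else (csize (word_mat M w) / \<delta>\<^sup>2) powr s)"

lemma weight_append:
  assumes "0 < s" "reduced (u @ v)"
  shows "weight s (u @ v) \<le> weight s u * weight s v"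
proof (cases "u = [] \<or> v = []")
  case False
  then have "csize (word_mat M (u @ v)) / \<delta>\<^sup>2 \<le>
      (csize (word_mat M u) / \<delta>\<^sup>2) * (csize (word_mat M v) / \<delta>\<^sup>2)"
    using divide_right_mono[OF append_estimates(1)[OF assms(2)], of "\<delta>\<^sup>2"] by simp
  then have "(csize (word_mat M (u @ v)) / \<delta>\<^sup>2) powr s \<le>
      ((csize (word_mat M u) / \<delta>\<^sup>2) * (csize (word_mat M v) / \<delta>\<^sup>2)) powr s"
    using assms by (intro powr_mono2) auto
  also have "\<dots> = (csize (word_mat M u) / \<delta>\<^sup>2) powr s * (csize (word_mat M v) / \<delta>\<^sup>2) powr s"
    by (rule powr_mult)
  finally show ?thesis using False by (simp add: weight_def)
qed (auto simp: weight_def)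

lemma weight_nonneg [simp]: "0 \<le> weight s w"
  by (simp add: weight_def)

text \<open>Chains are images of pairs of a cut word and a shorter chain. Counting pairs instead of
  words, and then dropping the condition that the concatenation is reduced, only increases the sum,
  and a sum over a full product factors.\<close>

lemma sum_weight_cut_chains:
  assumes "0 < s" "finite W"
  shows "(\<Sum>w\<in>cut_chains W n. weight s w) \<le> (\<Sum>w\<in>W. weight s w) ^ n"
proof (induction n)
  case 0
  show ?case by (simp add: weight_def)
next
  case (Suc n)
  let ?P = "{(u, v) \<in> W \<times> cut_chains W n. reduced (u @ v)}"
  have finP: "finite (W \<times> cut_chains W n)" using assms finite_cut_chains by blast
  then have fin: "finite ?P" by (rule finite_subset[rotated]) auto
  have "(\<Sum>w\<in>cut_chains W (Suc n). weight s w) \<le> (\<Sum>w\<in>(\<lambda>(u, v). u @ v) ` ?P. weight s w)"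
    using fin by (intro sum_mono2[OF _ cut_chains_Suc_subset]) auto
  also have "\<dots> \<le> (\<Sum>(u, v)\<in>?P. weight s (u @ v))"
    using sum_image_le[OF fin, of "weight s" "\<lambda>(u, v). u @ v"] by (simp add: case_prod_unfold o_def)
  also have "\<dots> \<le> (\<Sum>(u, v)\<in>?P. weight s u * weight s v)"
    using assms by (intro sum_mono) (auto intro: weight_append)
  also have "\<dots> \<le> (\<Sum>(u, v)\<in>W \<times> cut_chains W n. weight s u * weight s v)"
    using finP by (intro sum_mono2) auto
  also have "\<dots> = (\<Sum>w\<in>W. weight s w) * (\<Sum>w\<in>cut_chains W n. weight s w)"
    by (simp add: sum_product sum.cartesian_product)
  also have "\<dots> \<le> (\<Sum>w\<in>W. weight s w) * (\<Sum>w\<in>W. weight s w) ^ n"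
    using Suc by (intro mult_left_mono sum_nonneg) auto
  finally show ?case by simp
qed

text \<open>R^2 / \<delta>^2 bounds the size of a prolonged word relative to its prefix, 1 covers
  the word that is not prolonged, and 1 / \<delta> bounds the shift of the centre.\<close>

definition spread :: real where
  "spread = R\<^sup>2 / \<delta>\<^sup>2 + 1 / \<delta> + 1"

lemma spread_pos: "0 < spread"
  using delta_pos by (simp add: spread_def add_nonneg_pos)

lemma orbit_near_centre:
  assumes "reduced (v @ u)" "v \<noteq> []"
  defines "p \<equiv> hyp_action (psl_class (word_mat M (v @ u))) (0, 1)"
  shows "cmod (fst p - centre (word_mat M v)) \<le> spread * csize (word_mat M v)"
    and "0 < snd p" and "snd p \<le> spread * csize (word_mat M v)"
proof -
  let ?r = "csize (word_mat M v)" and ?A = "word_mat M (v @ u)"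
  have A: "?A $ 2 $ 1 \<noteq> 0" using assms(1,2) word_21 by blast
  have size: "csize ?A \<le> (R\<^sup>2 / \<delta>\<^sup>2 + 1) * ?r"
    and dist: "cmod (centre ?A - centre (word_mat M v)) \<le> (1 / \<delta>) * ?r"
  proof -
    show "csize ?A \<le> (R\<^sup>2 / \<delta>\<^sup>2 + 1) * ?r"
    proof (cases "u = []")
      case False
      have "csize ?A \<le> ?r * csize (word_mat M u) / \<delta>\<^sup>2"
        by (rule append_estimates(1)[OF assms(1,2) False])
      also have "\<dots> \<le> ?r * R\<^sup>2 / \<delta>\<^sup>2"
        using csize_le[OF _ False] assms(1)
        by (intro divide_right_mono mult_left_mono) (auto simp: reduced_append)
      also have "\<dots> \<le> (R\<^sup>2 / \<delta>\<^sup>2 + 1) * ?r" by (simp add: algebra_simps)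
      finally show ?thesis .
    qed (simp add: algebra_simps)
    show "cmod (centre ?A - centre (word_mat M v)) \<le> (1 / \<delta>) * ?r"
    proof (cases "u = []")
      case False
      then show ?thesis using append_estimates(2)[OF assms(1,2) False] by simp
    qed (use delta_pos in simp)
  qed
  note h = hyp_action_centre[OF det_word A, folded p_def]
  have sp: "(R\<^sup>2 / \<delta>\<^sup>2 + 1) * ?r + (1 / \<delta>) * ?r = spread * ?r"
    by (simp add: spread_def algebra_simps)
  have "cmod (fst p - centre (word_mat M v)) \<le>
      cmod (fst p - centre ?A) + cmod (centre ?A - centre (word_mat M v))"
    using norm_triangle_ineq[of "fst p - centre ?A" "centre ?A - centre (word_mat M v)"] by simp
  then show "cmod (fst p - centre (word_mat M v)) \<le> spread * ?r"
    using h(1) size dist sp by linarith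
  show "0 < snd p" by (rule h(2))
  have "0 \<le> (1 / \<delta>) * ?r" using delta_pos by simp
  then show "snd p \<le> spread * ?r" using h(3) size sp by linarith
qed

lemma orbit_height_pos:
  assumes "det A \<noteq> 0" shows "0 < snd (hyp_action (psl_class A) (0, 1))"
proof -
  have "A$2$1 \<noteq> 0 \<or> A$2$2 \<noteq> 0" using assms by (auto simp: det_2)
  then have "0 < (cmod (A$2$1))\<^sup>2 + (cmod (A$2$2))\<^sup>2" by (simp add: sum_power2_gt_zero_iff)
  then show ?thesis using assms by (simp add: hyp_action_psl_class)
qed

text \<open>All but finitely many words have a prefix among the chains, so their orbit points lie in
  a compact union of cylinders over the balls. The finitely many other orbit points have positive
  height and are no boundary points. Compactness makes the whole set closed in the compactification,
  which also keeps infinity out of the limit set.\<close>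

lemma limit_set_subset_balls:
  assumes cut: "complete_cut W N"
  shows "limit_set (generate PSL2C (range (\<lambda>i. psl_class (M i)))) \<subseteq>
    Some ` (\<Union>v\<in>cut_chains W (Suc n).
      cball (centre (word_mat M v)) (spread * csize (word_mat M v)))"
proof
  let ?C = "cut_chains W (Suc n)" and ?H = "{p :: complex \<times> real. snd p \<ge> 0}"
  let ?o = "\<lambda>w. hyp_action (psl_class (word_mat M w)) (0, 1)"
  let ?Q = "\<lambda>v. {p. fst p \<in> cball (centre (word_mat M v)) (spread * csize (word_mat M v)) \<and>
    snd p \<in> {0..spread * csize (word_mat M v)}}"
  define A where "A = (\<Union>v\<in>?C. ?Q v)"
  define B where "B = ?o ` {w. reduced w \<and> length w < Suc n * N}"
  have finW: "finite W" using cut by (simp add: complete_cut_def)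
  have cQ: "compact (?Q v)" for v
  proof -
    have "?Q v = cball (centre (word_mat M v)) (spread * csize (word_mat M v)) \<times>
        {0..spread * csize (word_mat M v)}" by auto
    then show ?thesis by (simp add: compact_Times)
  qed
  have cA: "compact A" unfolding A_def by (intro compact_UN finite_cut_chains finW cQ)
  have "finite {w :: 'i letter list. reduced w \<and> length w < Suc n * N}"
    by (rule finite_subset[OF _ finite_lists_length_le[OF finite_class.finite_UNIV, of "Suc n * N"]]) auto
  then have finB: "finite B" by (simp add: B_def)
  have K: "compact (A \<union> B)" using cA finite_imp_compact[OF finB] by (rule compact_Un)
  have "B \<subseteq> ?H" using less_imp_le[OF orbit_height_pos[OF det_word]] by (auto simp: B_def)
  moreover have "A \<subseteq> ?H" by (auto simp: A_def)
  ultimately have KH: "A \<union> B \<subseteq> ?H" by blast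
  have closed: "closedin closed_hyperbolic_space (Some ` (A \<union> B))"
    unfolding closed_hyperbolic_space_def closedin_Alexandroff_compactification_image_Some
  proof
    show "compactin (top_of_set ?H) (A \<union> B)"
      using K KH by (simp add: compactin_subtopology)
    show "closedin (top_of_set ?H) (A \<union> B)"
      using K KH by (simp add: closed_subset compact_imp_closed)
  qed
  have orbit: "?o w \<in> A \<union> B" if rw: "reduced w" for w
  proof (cases "length w < Suc n * N")
    case True
    then show ?thesis using rw by (auto simp: B_def)
  next
    case False
    then obtain k where k: "take k w \<in> ?C" using cut_chains_prefix[OF cut rw] by (meson not_less)
    have "take k w \<noteq> []" using cut_chains_nonempty[OF cut k] .
    then have "?o w \<in> ?Q (take k w)"
      using orbit_near_centre[of "take k w" "drop k w"] rw
      by (auto simp: dist_norm norm_minus_commute less_imp_le)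
    then show ?thesis using k unfolding A_def by blast
  qed
  have gen: "generate PSL2C (range (\<lambda>i. psl_class (M i))) =
      (\<lambda>w. psl_class (word_mat M w)) ` {w. reduced w}"
    using generate_eq_reduced_words[of M UNIV] invertible by simp
  fix \<xi> assume "\<xi> \<in> limit_set (generate PSL2C (range (\<lambda>i. psl_class (M i))))"
  then have "boundary_point \<xi> \<in> closed_hyperbolic_space closure_of
      ((\<lambda>g. Some (hyp_action g (0, 1))) ` (\<lambda>w. psl_class (word_mat M w)) ` {w. reduced w})"
    by (simp add: limit_set_def gen)
  moreover have "\<dots> \<subseteq> Some ` (A \<union> B)"
    using orbit by (intro closure_of_minimal closed) auto
  ultimately have "boundary_point \<xi> \<in> Some ` (A \<union> B)" by blast
  then obtain z where z: "\<xi> = Some z" "(z, 0) \<in> A \<union> B"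
    by (cases \<xi>) (auto simp: boundary_point_def)
  have "0 < snd p" if "p \<in> B" for p
    using that orbit_height_pos[OF det_word] by (auto simp: B_def)
  then have "(z, 0) \<notin> B" by force
  then have "(z, 0) \<in> A" using z by blast
  then have "z \<in> (\<Union>v\<in>?C. cball (centre (word_mat M v)) (spread * csize (word_mat M v)))"
    unfolding A_def by (auto simp del: cut_chains.simps)
  then show "\<xi> \<in> Some ` (\<Union>v\<in>?C. cball (centre (word_mat M v)) (spread * csize (word_mat M v)))"
    using z(1) by blast
qed

end


section \<open>Hausdorff dimension and stereographic projection\<close>

text \<open>The restriction on the diameters is automatic: if the sum is below \<eta>^s, so is each
  term, and then every \<open>b v\<close> is at most \<eta>.\<close>

lemma hausdorff_measure_eq_0I:
  fixes A :: "'a::metric_space set"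
  assumes s: "0 < s"
    and cover: "\<And>e. 0 < e \<Longrightarrow> \<exists>(V :: 'b set) U b. finite V \<and> A \<subseteq> (\<Union>v\<in>V. U v) \<and>
      (\<forall>v\<in>V. bounded (U v) \<and> diameter (U v) \<le> b v) \<and> (\<Sum>v\<in>V. b v powr s) < e"
  shows "hausdorff_measure s A = 0"
proof -
  have "hausdorff_premeasure \<eta> s A \<le> ennreal e" if \<eta>: "0 < \<eta>" and e: "0 < e" for \<eta> e
  proof -
    define e' where "e' = min e (\<eta> powr s)"
    have "0 < e'" using \<eta> e by (simp add: e'_def)
    then obtain V :: "'b set" and U b where V: "finite V" "A \<subseteq> (\<Union>v\<in>V. U v)"
      "\<And>v. v \<in> V \<Longrightarrow> bounded (U v) \<and> diameter (U v) \<le> b v" "(\<Sum>v\<in>V. b v powr s) < e'"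
      using cover by metis
    have b0: "0 \<le> diameter (U v)" "0 \<le> b v" if "v \<in> V" for v
      using V(3)[OF that] diameter_ge_0[of "U v"] by auto
    have small: "b v \<le> \<eta>" if "v \<in> V" for v
    proof (rule ccontr)
      assume "\<not> b v \<le> \<eta>"
      then have "\<eta> powr s \<le> b v powr s" using \<eta> s by (intro powr_mono2) auto
      also have "\<dots> \<le> (\<Sum>v\<in>V. b v powr s)" using V(1) that by (intro member_le_sum) auto
      finally show False using V(4) by (simp add: e'_def)
    qed
    obtain h where h: "bij_betw h {0..<card V} V" using ex_bij_betw_nat_finite[OF V(1)] by blast
    define U' where "U' i = (if i < card V then U (h i) else {})" for i
    have hV: "h i \<in> V" if "i < card V" for i using h that by (auto simp: bij_betw_def)
    have cov: "A \<subseteq> (\<Union>i. U' i)"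
    proof
      fix x assume "x \<in> A"
      then obtain v where v: "v \<in> V" "x \<in> U v" using V(2) by blast
      then obtain i where "i < card V" "h i = v" using h unfolding bij_betw_def by force
      then show "x \<in> (\<Union>i. U' i)" using v by (auto simp: U'_def intro!: exI[of _ i])
    qed
    have bd: "bounded (U' i) \<and> diameter (U' i) \<le> \<eta>" for i
      using V(3) hV small \<eta> by (force simp: U'_def)
    have "hausdorff_premeasure \<eta> s A \<le> (\<Sum>i. ennreal (diameter (U' i) powr s))"
      unfolding hausdorff_premeasure_def using cov bd by (intro INF_lower) auto
    also have "\<dots> = (\<Sum>i<card V. ennreal (diameter (U' i) powr s))"
      using s by (intro suminf_finite) (auto simp: U'_def)
    also have "\<dots> = (\<Sum>i\<in>{0..<card V}. ennreal (diameter (U (h i)) powr s))"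
      by (rule sum.cong) (auto simp: U'_def)
    also have "\<dots> = (\<Sum>v\<in>V. ennreal (diameter (U v) powr s))"
      by (rule sum.reindex_bij_betw[OF h])
    also have "\<dots> = ennreal (\<Sum>v\<in>V. diameter (U v) powr s)" by (simp add: sum_ennreal)
    also have "(\<Sum>v\<in>V. diameter (U v) powr s) \<le> (\<Sum>v\<in>V. b v powr s)"
      using V(3) b0 s by (intro sum_mono powr_mono2) auto
    also have "\<dots> \<le> e" using V(4) by (simp add: e'_def)
    finally show ?thesis by (simp add: ennreal_leI)
  qed
  then have "hausdorff_premeasure \<eta> s A = 0" if "0 < \<eta>" for \<eta>
    using that by (metis ennreal_le_epsilon add.left_neutral le_zero_eq zero_le)
  then show ?thesis by (simp add: hausdorff_measure_def)
qed

lemma hausdorff_measure_eq_0D: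
  assumes "hausdorff_measure s A = 0" "0 < \<eta>" "0 < e"
  obtains U :: "nat \<Rightarrow> 'a::metric_space set" where "A \<subseteq> (\<Union>i. U i)"
    "\<And>i. bounded (U i)" "\<And>i. diameter (U i) \<le> \<eta>"
    "summable (\<lambda>i. diameter (U i) powr s)" "(\<Sum>i. diameter (U i) powr s) < e"
proof -
  have "hausdorff_premeasure \<eta> s A = 0"
    using assms(1,2) unfolding hausdorff_measure_def
    by (metis SUP_upper greaterThan_iff le_zero_eq)
  then have "hausdorff_premeasure \<eta> s A < ennreal e" using assms(3) by simp
  then obtain U where U: "A \<subseteq> (\<Union>i. U i)" "\<And>i. bounded (U i)" "\<And>i. diameter (U i) \<le> \<eta>"
    "(\<Sum>i. ennreal (diameter (U i) powr s)) < ennreal e"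
    unfolding hausdorff_premeasure_def INF_less_iff by auto
  have fin: "(\<Sum>i. ennreal (diameter (U i) powr s)) \<noteq> top_class.top" using U(4) by auto
  have summ: "summable (\<lambda>i. diameter (U i) powr s)"
    using fin by (intro summable_suminf_not_top) auto
  have "(\<Sum>i. ennreal (diameter (U i) powr s)) = ennreal (\<Sum>i. diameter (U i) powr s)"
    by (rule suminf_ennreal[OF _ fin]) simp
  then have "ennreal (\<Sum>i. diameter (U i) powr s) < ennreal e" using U(4) by simp
  moreover have "0 \<le> (\<Sum>i. diameter (U i) powr s)" by (rule suminf_nonneg[OF summ]) simp
  ultimately have "(\<Sum>i. diameter (U i) powr s) < e" by (simp add: ennreal_less_iff)
  then show ?thesis using U summ that by blast
qed

lemma chordal_dist:
  "dist (to_unit_sphere (Some z)) (to_unit_sphere (Some z')) =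
    2 * cmod (z - z') / (sqrt (1 + (cmod z)\<^sup>2) * sqrt (1 + (cmod z')\<^sup>2))"
proof -
  define a b p where "a = (cmod z)\<^sup>2" and "b = (cmod z')\<^sup>2" and "p = z \<bullet> z'"
  have ab: "0 \<le> a" "0 \<le> b" by (simp_all add: a_def b_def)
  have nz: "1 + a \<noteq> 0" "1 + b \<noteq> 0" using ab by auto
  have diff: "(cmod (z - z'))\<^sup>2 = a + b - 2 * p"
    unfolding a_def b_def p_def power2_norm_eq_inner by (simp add: inner_diff inner_commute)
  have sc: "2 * x / complex_of_real r = (2 / r) *\<^sub>R x" for x r
    by (simp add: scaleR_conv_of_real)
  have "(dist (to_unit_sphere (Some z)) (to_unit_sphere (Some z')))\<^sup>2 =
      (cmod ((2 / (a + 1)) *\<^sub>R z - (2 / (b + 1)) *\<^sub>R z'))\<^sup>2 + ((a - 1) / (a + 1) - (b - 1) / (b + 1))\<^sup>2"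
    unfolding to_unit_sphere_def option.case dist_Pair_Pair sc a_def b_def
    by (simp add: dist_norm)
  also have "(cmod ((2 / (a + 1)) *\<^sub>R z - (2 / (b + 1)) *\<^sub>R z'))\<^sup>2 =
      (2 / (a + 1))\<^sup>2 * a + (2 / (b + 1))\<^sup>2 * b - 2 * ((2 / (a + 1)) * (2 / (b + 1))) * p"
    unfolding a_def b_def p_def power2_norm_eq_inner
    by (simp add: inner_diff inner_commute power2_eq_square)
  also have "\<dots> + ((a - 1) / (a + 1) - (b - 1) / (b + 1))\<^sup>2 = 4 * (a + b - 2 * p) / ((1 + a) * (1 + b))"
    using nz by (simp add: divide_simps power2_eq_square add.commute) (simp add: algebra_simps)
  also have "\<dots> = (2 * cmod (z - z') / (sqrt (1 + a) * sqrt (1 + b)))\<^sup>2"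
    using ab by (simp add: power_divide power_mult_distrib diff)
  finally show ?thesis unfolding a_def b_def
    by (rule power2_eq_imp_eq) auto
qed

lemma chordal_dist_le: "dist (to_unit_sphere (Some z)) (to_unit_sphere (Some z')) \<le> 2 * cmod (z - z')"
proof -
  have "1 * 1 \<le> sqrt (1 + (cmod z)\<^sup>2) * sqrt (1 + (cmod z')\<^sup>2)"
    by (intro mult_mono) auto
  then show ?thesis unfolding chordal_dist
    using mult_left_mono[of 1 "sqrt (1 + (cmod z)\<^sup>2) * sqrt (1 + (cmod z')\<^sup>2)" "2 * cmod (z - z')"]
    by (simp add: divide_le_eq)
qed

context pingpong
begin

text \<open>Chains of n factors give covers by balls whose diameters, raised to the power s, sum to
  at most a constant times \<theta>^n, and \<theta> < 1.\<close>

lemma limit_set_dimension_le: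
  assumes s: "0 < s" and cut: "complete_cut W N"
    and small: "(\<Sum>w\<in>W. (csize (word_mat M w) / \<delta>\<^sup>2) powr s) < 1"
  shows "limit_set_dimension (generate PSL2C (range (\<lambda>i. psl_class (M i)))) \<le> ennreal s"
proof -
  let ?\<Gamma> = "generate PSL2C (range (\<lambda>i. psl_class (M i)))"
  define \<theta> where "\<theta> = (\<Sum>w\<in>W. weight s w)"
  have finW: "finite W" using cut by (simp add: complete_cut_def)
  have \<theta>: "0 \<le> \<theta>" "\<theta> < 1"
  proof -
    have "\<theta> = (\<Sum>w\<in>W. (csize (word_mat M w) / \<delta>\<^sup>2) powr s)" unfolding \<theta>_def
      using cut by (intro sum.cong) (auto simp: weight_def complete_cut_def)
    then show "\<theta> < 1" using small by simp
    show "0 \<le> \<theta>" unfolding \<theta>_def by (intro sum_nonneg) simp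
  qed
  have "hausdorff_measure s (to_unit_sphere ` limit_set ?\<Gamma>) = 0"
  proof (rule hausdorff_measure_eq_0I[OF s, where 'b = "'i letter list"])
    fix e :: real assume e: "0 < e"
    \<comment> \<open>One factor 2 turns radius into diameter, another is the Lipschitz constant of
      inverse stereographic projection; \<delta>^2 undoes the normalisation of
      \<open>weight\<close>.\<close>
    define c where "c = (4 * spread * \<delta>\<^sup>2) powr s"
    have c: "0 < c" using spread_pos delta_pos by (simp add: c_def)
    have "(\<lambda>n. c * \<theta> ^ Suc n) \<longlonglongrightarrow> c * 0"
      using \<theta> by (intro tendsto_mult_left LIMSEQ_Suc LIMSEQ_power_zero) simp
    then have "\<forall>\<^sub>F n in sequentially. c * \<theta> ^ Suc n < e" using e by (intro order_tendstoD) auto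
    then obtain n where n: "c * \<theta> ^ Suc n < e" by (auto simp: eventually_sequentially)
    let ?C = "cut_chains W (Suc n)"
    define B where "B v = cball (centre (word_mat M v)) (spread * csize (word_mat M v))" for v
    define U where "U v = to_unit_sphere ` Some ` B v" for v
    define b where "b v = 4 * spread * csize (word_mat M v)" for v
    have dist: "dist x y \<le> b v" if xy: "x \<in> U v" "y \<in> U v" for x y v
    proof -
      obtain z z' where z: "z \<in> B v" "z' \<in> B v" "x = to_unit_sphere (Some z)" "y = to_unit_sphere (Some z')"
        using xy by (auto simp: U_def)
      have "cmod (z - z') \<le> 2 * (spread * csize (word_mat M v))"
        using dist_triangle_le[of z "centre (word_mat M v)" z' "2 * (spread * csize (word_mat M v))"] z(1,2)
        by (simp add: B_def dist_norm norm_minus_commute)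
      then show ?thesis using chordal_dist_le[of z z'] z(3,4) by (simp add: b_def)
    qed
    have b0: "0 \<le> b v" for v using spread_pos by (simp add: b_def)
    have "(\<Sum>v\<in>?C. b v powr s) = c * (\<Sum>v\<in>?C. weight s v)"
    proof -
      have "b v powr s = c * weight s v" if "v \<in> ?C" for v
      proof -
        have "b v = (4 * spread * \<delta>\<^sup>2) * (csize (word_mat M v) / \<delta>\<^sup>2)"
          using delta_pos by (simp add: b_def)
        then have "b v powr s = c * (csize (word_mat M v) / \<delta>\<^sup>2) powr s"
          using spread_pos unfolding c_def by (simp only: powr_mult) 
        then show ?thesis using cut_chains_nonempty[OF cut that] by (simp add: weight_def)
      qed
      then show ?thesis by (simp add: sum_distrib_left)
    qed
    also have "\<dots> \<le> c * \<theta> ^ Suc n"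
      unfolding \<theta>_def using c sum_weight_cut_chains[OF s finW, of "Suc n"]
      by (intro mult_left_mono) auto
    finally have "(\<Sum>v\<in>?C. b v powr s) < e" using n by linarith
    moreover have "to_unit_sphere ` limit_set ?\<Gamma> \<subseteq> (\<Union>v\<in>?C. U v)"
      using limit_set_subset_balls[OF cut, of n] unfolding U_def B_def by blast
    moreover have "bounded (U v) \<and> diameter (U v) \<le> b v" for v
    proof
      show "bounded (U v)" using dist unfolding bounded_two_points by blast
      show "diameter (U v) \<le> b v" using dist b0[of v] by (intro diameter_le) (auto simp: dist_norm)
    qed
    ultimately show "\<exists>(V :: 'i letter list set) U b. finite V \<and> to_unit_sphere ` limit_set ?\<Gamma> \<subseteq> (\<Union>v\<in>V. U v) \<and>
        (\<forall>v\<in>V. bounded (U v) \<and> diameter (U v) \<le> b v) \<and> (\<Sum>v\<in>V. b v powr s) < e"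
      using finite_cut_chains[OF finW, of "Suc n"] by (intro exI[of _ ?C] exI[of _ U] exI[of _ b]) auto
  qed
  then show ?thesis unfolding limit_set_dimension_def hausdorff_dimension_def
    using s by (intro Inf_lower) blast
qed

end


section \<open>From Schottky disks on the sphere to stable ping-pong in the plane\<close>

section \<open>Moebius maps are homeomorphisms of the Riemann sphere\<close>

lemma topspace_riemann_sphere [simp]: "topspace riemann_sphere = UNIV"
  by (auto simp: riemann_sphere_def intro: option.exhaust)

lemma option_set_eqI:
  assumes "None \<in> A \<longleftrightarrow> None \<in> B" "\<And>z. Some z \<in> A \<longleftrightarrow> Some z \<in> B"
  shows "A = B"
proof (rule Set.set_eqI)
  fix x show "x \<in> A \<longleftrightarrow> x \<in> B" using assms by (cases x) auto
qed

lemma openin_riemann_sphere: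
  "openin riemann_sphere V \<longleftrightarrow> open {z. Some z \<in> V} \<and> (None \<in> V \<longrightarrow> compact {z. Some z \<notin> V})"
proof -
  have 1: "(\<exists>U. open U \<and> V = Some ` U) \<longleftrightarrow> open {z. Some z \<in> V} \<and> None \<notin> V"
  proof
    assume "open {z. Some z \<in> V} \<and> None \<notin> V"
    moreover have "V = Some ` {z. Some z \<in> V}" if "None \<notin> V"
      using that by (intro option_set_eqI) auto
    ultimately show "\<exists>U. open U \<and> V = Some ` U" by blast
  next
    assume "\<exists>U. open U \<and> V = Some ` U"
    then obtain U where U: "open U" "V = Some ` U" by blast
    then have "{z. Some z \<in> V} = U" by auto
    then show "open {z. Some z \<in> V} \<and> None \<notin> V" using U by auto
  qed
  have 2: "(\<exists>C. compact C \<and> V = insert None (Some ` (UNIV - C))) \<longleftrightarrow> compact {z. Some z \<notin> V} \<and> None \<in> V"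
  proof
    assume "compact {z. Some z \<notin> V} \<and> None \<in> V"
    moreover have "V = insert None (Some ` (UNIV - {z. Some z \<notin> V}))" if "None \<in> V"
      using that by (intro option_set_eqI) auto
    ultimately show "\<exists>C. compact C \<and> V = insert None (Some ` (UNIV - C))" by blast
  next
    assume "\<exists>C. compact C \<and> V = insert None (Some ` (UNIV - C))"
    then obtain C where C: "compact C" "V = insert None (Some ` (UNIV - C))" by blast
    then have "{z. Some z \<notin> V} = C" by auto
    then show "compact {z. Some z \<notin> V} \<and> None \<in> V" using C by auto
  qed
  have 3: "open {z. Some z \<in> V}" if "compact {z. Some z \<notin> V}"
  proof -
    have "{z. Some z \<in> V} = - {z. Some z \<notin> V}" by auto
    then show ?thesis using compact_imp_closed[OF that] by (simp add: open_Compl)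
  qed
  have "openin riemann_sphere V \<longleftrightarrow> (\<exists>U. open U \<and> V = Some ` U) \<or>
      (\<exists>C. compact C \<and> V = insert None (Some ` (UNIV - C)))"
    unfolding riemann_sphere_def openin_Alexandroff_compactification
    using compact_imp_closed by auto
  then show ?thesis using 1 2 3 by blast
qed

lemma closedin_Some_image: "closedin riemann_sphere (Some ` K) \<longleftrightarrow> compact K"
  unfolding riemann_sphere_def closedin_Alexandroff_compactification_image_Some
  using compact_imp_closed by auto

lemma continuous_map_affine:
  assumes "p \<noteq> 0"
  shows "continuous_map riemann_sphere riemann_sphere (moebius_map (mat2 p q 0 1))"
proof -
  have m: "moebius_map (mat2 p q 0 1) None = None" "moebius_map (mat2 p q 0 1) (Some z) = Some (p * z + q)" for z
    by (simp_all add: moebius_map_def)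
  have "openin riemann_sphere {\<xi>. moebius_map (mat2 p q 0 1) \<xi> \<in> V}" if V: "openin riemann_sphere V" for V
    unfolding openin_riemann_sphere mem_Collect_eq m
  proof
    show "open {z. Some (p * z + q) \<in> V}"
    proof -
      have "{z. Some (p * z + q) \<in> V} = (\<lambda>z. p * z + q) -` {z. Some z \<in> V}" by auto
      moreover have "open ((\<lambda>z. p * z + q) -` {z. Some z \<in> V})"
        using V by (intro open_vimage continuous_intros) (simp add: openin_riemann_sphere)
      ultimately show ?thesis by (simp only:)
    qed
    show "None \<in> V \<longrightarrow> compact {z. Some (p * z + q) \<notin> V}"
    proof
      assume "None \<in> V"
      then have "compact {z. Some z \<notin> V}" using V by (simp add: openin_riemann_sphere)
      then have "compact ((\<lambda>z. (z - q) / p) ` {z. Some z \<notin> V})"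
        using assms by (intro compact_continuous_image continuous_intros) auto
      also have "(\<lambda>z. (z - q) / p) ` {z. Some z \<notin> V} = {z. Some (p * z + q) \<notin> V}"
      proof (intro Set.set_eqI iffI)
        fix z assume "z \<in> {z. Some (p * z + q) \<notin> V}"
        then show "z \<in> (\<lambda>z. (z - q) / p) ` {z. Some z \<notin> V}"
          using assms by (intro image_eqI[of _ _ "p * z + q"]) auto
      qed (use assms in auto)
      finally show "compact {z. Some (p * z + q) \<notin> V}" .
    qed
  qed
  then show ?thesis by (simp add: continuous_map_def)
qed

lemma continuous_map_inversion:
  "continuous_map riemann_sphere riemann_sphere (moebius_map (mat2 0 1 1 0))"
proof -
  have m: "moebius_map (mat2 0 1 1 0) None = Some 0"
    "moebius_map (mat2 0 1 1 0) (Some z) = (if z = 0 then None else Some (1 / z))" for z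
    by (simp_all add: moebius_map_def)
  have "openin riemann_sphere {\<xi>. moebius_map (mat2 0 1 1 0) \<xi> \<in> V}" if V: "openin riemann_sphere V" for V
  proof -
    let ?U = "{z. Some z \<in> V}" and ?P = "{z. moebius_map (mat2 0 1 1 0) (Some z) \<in> V}"
    have U: "open ?U" using V by (simp add: openin_riemann_sphere)
    have away: "open {z. z \<noteq> 0 \<and> 1 / z \<in> ?U}"
    proof -
      have "continuous_on (- {0}) (\<lambda>z::complex. 1 / z)" by (intro continuous_intros) auto
      then have "open (- {0} \<inter> (\<lambda>z. 1 / z) -` ?U)"
        by (rule continuous_open_preimage) (use U in auto)
      moreover have "{z. z \<noteq> 0 \<and> 1 / z \<in> ?U} = - {0} \<inter> (\<lambda>z. 1 / z) -` ?U" by auto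
      ultimately show ?thesis by (simp only:)
    qed
    have P: "open ?P"
    proof (cases "None \<in> V")
      case False
      then have "?P = {z. z \<noteq> 0 \<and> 1 / z \<in> ?U}" by (auto simp: m split: if_splits)
      then show ?thesis using away by simp
    next
      case True
      then have "bounded {z. Some z \<notin> V}" using V by (simp add: openin_riemann_sphere compact_imp_bounded)
      then obtain B where B: "0 < B" "\<And>z. Some z \<notin> V \<Longrightarrow> cmod z \<le> B"
        by (auto simp: bounded_pos)
      have "?P = {z. z \<noteq> 0 \<and> 1 / z \<in> ?U} \<union> ball 0 (1 / B)"
      proof (intro Set.set_eqI iffI)
        fix z assume "z \<in> {z. z \<noteq> 0 \<and> 1 / z \<in> ?U} \<union> ball 0 (1 / B)"
        moreover have "Some (1 / z) \<in> V" if "z \<noteq> 0" "cmod z < 1 / B"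
        proof (rule ccontr)
          assume "Some (1 / z) \<notin> V"
          then have "1 / cmod z \<le> B" using B(2) by (metis norm_divide norm_one)
          then show False using that B(1) by (simp add: field_simps)
        qed
        ultimately show "z \<in> ?P" using True by (auto simp: m)
      qed (use B(1) in \<open>auto simp: m split: if_splits\<close>)
      then show ?thesis using open_Un[OF away open_ball[of 0 "1 / B"]] by (simp only:)
    qed
    moreover have "compact {z. Some z \<notin> {\<xi>. moebius_map (mat2 0 1 1 0) \<xi> \<in> V}}" if zero: "Some 0 \<in> V"
    proof -
      obtain r where r: "0 < r" "ball 0 r \<subseteq> ?U" using U zero unfolding open_contains_ball by blast
      have "cmod z \<le> 1 / r" if "z \<notin> ?P" for z
      proof (rule ccontr)
        assume z: "\<not> cmod z \<le> 1 / r"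
        then have "z \<noteq> 0" using r(1) by auto
        moreover have "1 / z \<in> ball 0 r" using z r(1) \<open>z \<noteq> 0\<close> by (simp add: norm_divide field_simps)
        ultimately show False using that r(2) by (auto simp: m)
      qed
      then have "bounded (- ?P)" by (auto simp: bounded_iff)
      moreover have "closed (- ?P)" using P by (simp add: closed_Compl)
      moreover have "{z. Some z \<notin> {\<xi>. moebius_map (mat2 0 1 1 0) \<xi> \<in> V}} = - ?P" by auto
      ultimately show ?thesis by (simp add: compact_eq_bounded_closed)
    qed
    ultimately show ?thesis by (simp add: openin_riemann_sphere m)
  qed
  then show ?thesis by (simp add: continuous_map_def)
qed

text \<open>For nonzero lower left entry c the map is a/c - det A / (c^2 (z + d/c)), a translation
  followed by the inversion and an affine map; otherwise it is affine itself.\<close>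

lemma continuous_map_moebius:
  assumes "det A \<noteq> 0"
  shows "continuous_map riemann_sphere riemann_sphere (moebius_map A)"
proof (cases "A$2$1 = 0")
  case True
  then have d: "A$1$1 \<noteq> 0" "A$2$2 \<noteq> 0" using assms by (auto simp: det_2)
  have "A = scale2 (A$2$2) (mat2 (A$1$1 / A$2$2) (A$1$2 / A$2$2) 0 1)"
    using True d by (simp add: mat2_eq_iff)
  then have "moebius_map A = moebius_map (mat2 (A$1$1 / A$2$2) (A$1$2 / A$2$2) 0 1)"
    using d moebius_map_scale2 by metis
  then show ?thesis using continuous_map_affine d by simp
next
  case False
  let ?B = "mat2 (- det A / (A$2$1)\<^sup>2) (A$1$1 / A$2$1) 0 1" and ?J = "mat2 0 1 1 0"
    and ?C = "mat2 1 (A$2$2 / A$2$1) 0 1"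
  have "A = scale2 (A$2$1) (?B ** (?J ** ?C))"
    using False by (simp add: mat2_eq_iff det_2 field_simps power2_eq_square)
  then have "moebius_map A = moebius_map (?B ** (?J ** ?C))"
    using False moebius_map_scale2 by metis
  also have "\<dots> = moebius_map ?B \<circ> (moebius_map ?J \<circ> moebius_map ?C)"
    using False assms by (simp add: fun_eq_iff moebius_map_mult det_mul)
  finally show ?thesis using False assms
    by (auto intro!: continuous_map_compose[OF continuous_map_compose] continuous_map_affine continuous_map_inversion)
qed

lemma homeomorphic_map_moebius:
  assumes "det A \<noteq> 0"
  shows "homeomorphic_map riemann_sphere riemann_sphere (moebius_map A)"
  unfolding homeomorphic_map_maps homeomorphic_maps_def
  using assms by (intro exI[of _ "moebius_map (adj2 A)"]) (simp add: continuous_map_moebius)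


section \<open>Circles on the sphere as Hermitian forms\<close>

text \<open>The isotropic lines of a Hermitian form on C^2. Homogeneous coordinates treat circles
  and lines alike, a line being the case \<alpha> = 0, and Moebius maps act by linear
  substitution.\<close>

definition form_circle :: "real \<Rightarrow> complex \<Rightarrow> real \<Rightarrow> complex option set" where
  "form_circle \<alpha> \<beta> \<gamma> = {\<xi>. let v = homog \<xi> in
     \<alpha> * (cmod (v$1))\<^sup>2 + 2 * Re (\<beta> * v$1 * cnj (v$2)) + \<gamma> * (cmod (v$2))\<^sup>2 = 0}"

lemma form_circle_mem:
  "None \<in> form_circle \<alpha> \<beta> \<gamma> \<longleftrightarrow> \<alpha> = 0"
  "Some z \<in> form_circle \<alpha> \<beta> \<gamma> \<longleftrightarrow> \<alpha> * (cmod z)\<^sup>2 + 2 * Re (\<beta> * z) + \<gamma> = 0"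
  by (simp_all add: form_circle_def homog_def)

lemma proj_mem_form_circle:
  assumes "v \<noteq> 0"
  shows "proj v \<in> form_circle \<alpha> \<beta> \<gamma> \<longleftrightarrow>
     \<alpha> * (cmod (v$1))\<^sup>2 + 2 * Re (\<beta> * v$1 * cnj (v$2)) + \<gamma> * (cmod (v$2))\<^sup>2 = 0"
proof (cases "v$2 = 0")
  case True
  then have "v$1 \<noteq> 0" using assms by (auto simp: vec2_eq_iff)
  then show ?thesis using True by (simp add: proj_def form_circle_mem)
next
  case False
  let ?n = "(cmod (v$2))\<^sup>2"
  have n: "?n \<noteq> 0" using False by simp
  have 1: "(cmod (v$1 / v$2))\<^sup>2 * ?n = (cmod (v$1))\<^sup>2" using False by (simp add: norm_divide power_divide)
  have "\<beta> * (v$1 / v$2) * complex_of_real ?n = \<beta> * v$1 * cnj (v$2)"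
    unfolding complex_norm_square using False by simp
  then have 2: "Re (\<beta> * (v$1 / v$2)) * ?n = Re (\<beta> * v$1 * cnj (v$2))"
    by (metis Re_complex_of_real Im_complex_of_real times_complex.sel(1) mult_zero_right diff_zero)
  have "\<alpha> * (cmod (v$1))\<^sup>2 + 2 * Re (\<beta> * v$1 * cnj (v$2)) + \<gamma> * ?n =
      (\<alpha> * (cmod (v$1 / v$2))\<^sup>2 + 2 * Re (\<beta> * (v$1 / v$2)) + \<gamma>) * ?n"
    unfolding 1[symmetric] 2[symmetric] by (simp add: algebra_simps)
  then show ?thesis using False n by (simp add: proj_def form_circle_mem)
qed

text \<open>Completing the square: the discriminant is \<alpha>^2 times the squared radius or, for a
  line, the squared length of a normal vector. Its positivity excludes the degenerate zero
  sets.\<close>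

lemma circle_on_sphere_iff:
  "circle_on_sphere C \<longleftrightarrow> (\<exists>\<alpha> \<beta> \<gamma>. (cmod \<beta>)\<^sup>2 - \<alpha> * \<gamma> > 0 \<and> C = form_circle \<alpha> \<beta> \<gamma>)" (is "?L \<longleftrightarrow> ?R")
proof
  assume ?L
  then consider a r where "r > 0" "C = Some ` sphere a r"
    | n b where "n \<noteq> 0" "C = insert None (Some ` {z. n \<bullet> z = b})"
    unfolding circle_on_sphere_def by blast
  then show ?R
  proof cases
    case 1
    have "Some z \<in> C \<longleftrightarrow> Some z \<in> form_circle 1 (- cnj a) ((cmod a)\<^sup>2 - r\<^sup>2)" for z
    proof -
      have "(dist a z)\<^sup>2 = (cmod z)\<^sup>2 + 2 * Re (- cnj a * z) + (cmod a)\<^sup>2"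
        unfolding dist_norm cmod_power2 by (simp add: algebra_simps power2_eq_square)
      moreover have "dist a z = r \<longleftrightarrow> (dist a z)\<^sup>2 = r\<^sup>2" using 1(1) by simp
      ultimately show ?thesis using 1(2) by (auto simp: form_circle_mem)
    qed
    moreover have "None \<notin> C" using 1 by auto
    ultimately have "C = form_circle 1 (- cnj a) ((cmod a)\<^sup>2 - r\<^sup>2)"
      by (intro option_set_eqI) (simp_all add: form_circle_mem(1))
    then show ?R using 1(1) by (intro exI[of _ 1] exI[of _ "- cnj a"] exI[of _ "(cmod a)\<^sup>2 - r\<^sup>2"]) simp
  next
    case 2
    have "Some z \<in> C \<longleftrightarrow> Some z \<in> form_circle 0 (cnj n) (- 2 * b)" for z
      using 2(2) by (auto simp: form_circle_mem inner_complex_def)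
    moreover have "None \<in> C" using 2 by auto
    ultimately have "C = form_circle 0 (cnj n) (- 2 * b)"
      by (intro option_set_eqI) (simp_all add: form_circle_mem(1))
    then show ?R using 2(1) by (intro exI[of _ 0] exI[of _ "cnj n"] exI[of _ "- 2 * b"]) simp
  qed
next
  assume ?R
  then obtain \<alpha> \<beta> \<gamma> where d: "(cmod \<beta>)\<^sup>2 - \<alpha> * \<gamma> > 0" and C: "C = form_circle \<alpha> \<beta> \<gamma>" by blast
  show ?L
  proof (cases "\<alpha> = 0")
    case True
    have "Some z \<in> C \<longleftrightarrow> cnj \<beta> \<bullet> z = - \<gamma> / 2" for z
      using C True by (auto simp: form_circle_mem inner_complex_def)
    moreover have "None \<in> C" using C True by (simp add: form_circle_mem)
    ultimately have "C = insert None (Some ` {z. cnj \<beta> \<bullet> z = - \<gamma> / 2})"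
      by (intro option_set_eqI) auto
    moreover have "cnj \<beta> \<noteq> 0" using d True by auto
    ultimately show ?thesis unfolding circle_on_sphere_def by blast
  next
    case False
    define a where "a = - cnj \<beta> / complex_of_real \<alpha>"
    define r where "r = sqrt ((cmod \<beta>)\<^sup>2 - \<alpha> * \<gamma>) / \<bar>\<alpha>\<bar>"
    have r: "0 < r" using d False by (simp add: r_def)
    have mem: "Some z \<in> C \<longleftrightarrow> dist a z = r" for z
    proof -
      have ba: "\<beta> = - complex_of_real \<alpha> * cnj a" using False by (simp add: a_def)
      have ba2: "(cmod \<beta>)\<^sup>2 = \<alpha>\<^sup>2 * (cmod a)\<^sup>2" unfolding ba by (simp add: norm_mult power_mult_distrib)
      define P where "P = Re (- cnj a * z)"
      have dz: "(dist a z)\<^sup>2 = (cmod z)\<^sup>2 + 2 * P + (cmod a)\<^sup>2"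
        unfolding P_def dist_norm cmod_power2 by (simp add: algebra_simps power2_eq_square)
      have bz: "Re (\<beta> * z) = \<alpha> * P"
        unfolding P_def ba by (simp add: algebra_simps)
      have rr: "\<alpha>\<^sup>2 * r\<^sup>2 = \<alpha>\<^sup>2 * (cmod a)\<^sup>2 - \<alpha> * \<gamma>"
        using d False by (simp add: r_def power_divide ba2)
      have "\<alpha>\<^sup>2 * ((dist a z)\<^sup>2 - r\<^sup>2) = \<alpha>\<^sup>2 * (dist a z)\<^sup>2 - \<alpha>\<^sup>2 * r\<^sup>2"
        by (rule right_diff_distrib)
      also have "\<dots> = \<alpha> * (\<alpha> * (cmod z)\<^sup>2 + 2 * Re (\<beta> * z) + \<gamma>)"
        unfolding rr dz bz by (simp add: algebra_simps power2_eq_square)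
      finally have "\<alpha> * (\<alpha> * (cmod z)\<^sup>2 + 2 * Re (\<beta> * z) + \<gamma>) = \<alpha>\<^sup>2 * ((dist a z)\<^sup>2 - r\<^sup>2)" ..
      then have "Some z \<in> C \<longleftrightarrow> (dist a z)\<^sup>2 = r\<^sup>2"
        using False unfolding C form_circle_mem by (metis divisors_zero eq_iff_diff_eq_0 mult_eq_0_iff power_eq_0_iff)
      then show ?thesis using r by simp
    qed
    have "None \<notin> C" using C False by (simp add: form_circle_mem)
    then have "C = Some ` sphere a r"
      by (intro option_set_eqI) (simp_all add: mem inj_image_mem_iff)
    then show ?thesis unfolding circle_on_sphere_def using r by blast
  qed
qed

lemma moebius_image_eq:
  assumes "det A \<noteq> 0"
  shows "moebius_map A ` C = {\<xi>. moebius_map (adj2 A) \<xi> \<in> C}"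
  using assms by (auto intro!: image_eqI[where x = "moebius_map (adj2 A) _"])

text \<open>The image circle is the zero set of the form pulled back by the adjugate; the
  discriminant is multiplied by |det|^2 and stays positive.\<close>

lemma circle_on_sphere_moebius:
  assumes "det A \<noteq> 0" "circle_on_sphere C"
  shows "circle_on_sphere (moebius_map A ` C)"
proof -
  obtain \<alpha> \<beta> \<gamma> where d: "(cmod \<beta>)\<^sup>2 - \<alpha> * \<gamma> > 0" and C: "C = form_circle \<alpha> \<beta> \<gamma>"
    using assms(2) circle_on_sphere_iff by blast
  define B where "B = adj2 A"
  define a b c e where "a = B$1$1" and "b = B$1$2" and "c = B$2$1" and "e = B$2$2"
  define \<alpha>' where "\<alpha>' = \<alpha> * (cmod a)\<^sup>2 + 2 * Re (\<beta> * a * cnj c) + \<gamma> * (cmod c)\<^sup>2"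
  define \<gamma>' where "\<gamma>' = \<alpha> * (cmod b)\<^sup>2 + 2 * Re (\<beta> * b * cnj e) + \<gamma> * (cmod e)\<^sup>2"
  define \<beta>' where "\<beta>' = complex_of_real \<alpha> * a * cnj b + \<beta> * a * cnj e + cnj \<beta> * c * cnj b
    + complex_of_real \<gamma> * c * cnj e"
  have detB: "det B \<noteq> 0" using assms(1) by (simp add: B_def)
  have re: "complex_of_real (2 * Re z) = z + cnj z" for z by (simp add: complex_add_cnj)
  have form: "\<alpha> * (cmod (a * x + b * y))\<^sup>2 + 2 * Re (\<beta> * (a * x + b * y) * cnj (c * x + e * y))
      + \<gamma> * (cmod (c * x + e * y))\<^sup>2
      = \<alpha>' * (cmod x)\<^sup>2 + 2 * Re (\<beta>' * x * cnj y) + \<gamma>' * (cmod y)\<^sup>2" for x y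
  proof -
    have "complex_of_real (\<alpha> * (cmod (a * x + b * y))\<^sup>2 + 2 * Re (\<beta> * (a * x + b * y) * cnj (c * x + e * y))
      + \<gamma> * (cmod (c * x + e * y))\<^sup>2)
      = complex_of_real (\<alpha>' * (cmod x)\<^sup>2 + 2 * Re (\<beta>' * x * cnj y) + \<gamma>' * (cmod y)\<^sup>2)"
      unfolding \<alpha>'_def \<beta>'_def \<gamma>'_def of_real_add of_real_mult[of _ "(cmod _)\<^sup>2"] re complex_norm_square
      by (simp add: algebra_simps)
    then show ?thesis by (simp only: of_real_eq_iff)
  qed
  have disc: "(cmod \<beta>')\<^sup>2 - \<alpha>' * \<gamma>' = (cmod (det B))\<^sup>2 * ((cmod \<beta>)\<^sup>2 - \<alpha> * \<gamma>)"
  proof -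
    have "complex_of_real ((cmod \<beta>')\<^sup>2 - \<alpha>' * \<gamma>') =
        complex_of_real ((cmod (det B))\<^sup>2 * ((cmod \<beta>)\<^sup>2 - \<alpha> * \<gamma>))"
      unfolding \<alpha>'_def \<beta>'_def \<gamma>'_def of_real_add of_real_diff of_real_mult[of _ "(cmod _)\<^sup>2"]
        of_real_mult[of "(_ + _) + _"] of_real_mult[of "(cmod _)\<^sup>2"] of_real_mult[of \<alpha> \<gamma>]
        re complex_norm_square det_2 a_def[symmetric] b_def[symmetric] c_def[symmetric] e_def[symmetric]
      by (simp add: algebra_simps)
    then show ?thesis by (simp only: of_real_eq_iff)
  qed
  have "moebius_map A ` C = form_circle \<alpha>' \<beta>' \<gamma>'"
  proof (rule Set.set_eqI)
    fix \<xi>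
    have nz: "B *v homog \<xi> \<noteq> 0" using multv2_eq_0[OF detB] by fastforce
    have "\<xi> \<in> moebius_map A ` C \<longleftrightarrow> proj (B *v homog \<xi>) \<in> form_circle \<alpha> \<beta> \<gamma>"
      unfolding moebius_image_eq[OF assms(1)] B_def[symmetric] mem_Collect_eq moebius_map_eq[OF detB] C ..
    also have "\<dots> \<longleftrightarrow> \<xi> \<in> form_circle \<alpha>' \<beta>' \<gamma>'"
      unfolding proj_mem_form_circle[OF nz] multv2_nth a_def[symmetric] b_def[symmetric]
        c_def[symmetric] e_def[symmetric] form
      by (simp add: form_circle_def Let_def)
    finally show "\<xi> \<in> moebius_map A ` C \<longleftrightarrow> \<xi> \<in> form_circle \<alpha>' \<beta>' \<gamma>'" .
  qed
  moreover have "(cmod \<beta>')\<^sup>2 - \<alpha>' * \<gamma>' > 0"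
    unfolding disc using d detB by simp
  ultimately show ?thesis unfolding circle_on_sphere_iff by blast
qed


section \<open>Schottky disks under Moebius maps\<close>

lemma frontier_moebius:
  "det A \<noteq> 0 \<Longrightarrow> riemann_sphere frontier_of (moebius_map A ` D) = moebius_map A ` (riemann_sphere frontier_of D)"
  by (rule homeomorphic_map_frontier_of[OF homeomorphic_map_moebius]) auto

lemma interior_moebius:
  "det A \<noteq> 0 \<Longrightarrow> riemann_sphere interior_of (moebius_map A ` D) = moebius_map A ` (riemann_sphere interior_of D)"
  by (rule homeomorphic_map_interior_of[OF homeomorphic_map_moebius]) auto

lemma subtopology_moebius_homeomorphic:
  assumes "det A \<noteq> 0"
  shows "subtopology riemann_sphere (moebius_map A ` D) homeomorphic_space subtopology riemann_sphere D"
proof -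
  have "homeomorphic_map (subtopology riemann_sphere D) (subtopology riemann_sphere (moebius_map A ` D)) (moebius_map A)"
    by (rule homeomorphic_map_subtopologies[OF homeomorphic_map_moebius[OF assms]]) simp
  then show ?thesis by (metis homeomorphic_map_imp_homeomorphic_space homeomorphic_space_sym)
qed

lemma closed_jordan_disk_moebius:
  assumes "det A \<noteq> 0" "closed_jordan_disk D"
  shows "closed_jordan_disk (moebius_map A ` D)"
  using assms homeomorphic_map_closedness_eq[OF homeomorphic_map_moebius[OF assms(1)], of D]
    homeomorphic_space_trans[OF subtopology_moebius_homeomorphic[OF assms(1)]]
  unfolding closed_jordan_disk_def jordan_curve_def frontier_moebius[OF assms(1)]
  by auto

lemma schottky_disks_moebius:
  assumes "det B \<noteq> 0" "\<And>i. i \<in> I \<Longrightarrow> det (M i) \<noteq> 0"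
    and S: "schottky_disks I (\<lambda>i. psl_class (M i)) D D'"
  shows "schottky_disks I (\<lambda>i. psl_class (B ** M i ** adj2 B)) (\<lambda>i. moebius_map B ` D i) (\<lambda>i. moebius_map B ` D' i)"
proof -
  have inj: "inj (moebius_map B)" using bij_moebius_map[OF assms(1)] by (simp add: bij_def)
  have conj: "moebius_map (B ** M i ** adj2 B) ` moebius_map B ` X = moebius_map B ` moebius_map (M i) ` X"
    if "i \<in> I" for i X
    using assms that by (simp add: image_image moebius_map_mult det_mul)
  have act: "sphere_action (psl_class (B ** M i ** adj2 B)) = moebius_map (B ** M i ** adj2 B)"
    "sphere_action (psl_class (M i)) = moebius_map (M i)" if "i \<in> I" for i
    using assms that by (simp_all add: det_mul)
  show ?thesis
    using S unfolding schottky_disks_def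
  proof (elim conjE, intro conjI ballI)
    fix i assume i: "i \<in> I"
    assume a: "\<forall>i\<in>I. closed_jordan_disk (D i) \<and> closed_jordan_disk (D' i)"
    show "closed_jordan_disk (moebius_map B ` D i)" "closed_jordan_disk (moebius_map B ` D' i)"
      using a i assms closed_jordan_disk_moebius by blast+
    assume b: "\<forall>i\<in>I. sphere_action (psl_class (M i)) ` (riemann_sphere frontier_of D i) =
            riemann_sphere frontier_of D' i \<and>
            sphere_action (psl_class (M i)) ` (riemann_sphere interior_of D i) \<inter>
            riemann_sphere interior_of D' i = {}"
    have b': "moebius_map (M i) ` (riemann_sphere frontier_of D i) = riemann_sphere frontier_of D' i"
        "moebius_map (M i) ` (riemann_sphere interior_of D i) \<inter> riemann_sphere interior_of D' i = {}"
      using bspec[OF b i] unfolding act[OF i] by blast+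
    show "sphere_action (psl_class (B ** M i ** adj2 B)) ` (riemann_sphere frontier_of moebius_map B ` D i) =
         riemann_sphere frontier_of moebius_map B ` D' i"
      unfolding act[OF i] frontier_moebius[OF assms(1)] conj[OF i] b'(1) ..
    show "sphere_action (psl_class (B ** M i ** adj2 B)) ` (riemann_sphere interior_of moebius_map B ` D i) \<inter>
         riemann_sphere interior_of moebius_map B ` D' i = {}"
      unfolding act[OF i] interior_moebius[OF assms(1)] conj[OF i] image_Int[OF inj, symmetric] b'(2)
      by simp
  qed (use inj in \<open>auto simp: disjoint_family_on_def image_Int[symmetric] inj_image_eq_iff\<close>)
qed

text \<open>Following the i-th generator by \<open>H i\<close> moves only its target disk. The
  conditions on frontier and interior travel along the homeomorphism, so disjointness is all that
  has to be checked anew.\<close>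

lemma schottky_disks_perturb:
  assumes "\<And>i. i \<in> I \<Longrightarrow> det (M i) \<noteq> 0" "\<And>i. i \<in> I \<Longrightarrow> det (H i) \<noteq> 0"
    and S: "schottky_disks I (\<lambda>i. psl_class (M i)) D D'"
    and disj: "disjoint_family_on (\<lambda>i. moebius_map (H i) ` D' i) I"
      "\<And>i j. i \<in> I \<Longrightarrow> j \<in> I \<Longrightarrow> D i \<inter> moebius_map (H j) ` D' j = {}"
  shows "schottky_disks I (\<lambda>i. psl_class (H i ** M i)) D (\<lambda>i. moebius_map (H i) ` D' i)"
  unfolding schottky_disks_def
proof (intro conjI ballI)
  fix i assume i: "i \<in> I"
  have act: "sphere_action (psl_class (H i ** M i)) ` X = moebius_map (H i) ` moebius_map (M i) ` X" for X
    using assms(1,2)[OF i] by (simp add: det_mul moebius_map_mult image_image)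
  have b: "moebius_map (M i) ` (riemann_sphere frontier_of D i) = riemann_sphere frontier_of D' i"
    "moebius_map (M i) ` (riemann_sphere interior_of D i) \<inter> riemann_sphere interior_of D' i = {}"
  proof -
    have "sphere_action (psl_class (M i)) ` (riemann_sphere frontier_of D i) = riemann_sphere frontier_of D' i \<and>
      sphere_action (psl_class (M i)) ` (riemann_sphere interior_of D i) \<inter> riemann_sphere interior_of D' i = {}"
      using S i unfolding schottky_disks_def by blast
    then show "moebius_map (M i) ` (riemann_sphere frontier_of D i) = riemann_sphere frontier_of D' i"
      "moebius_map (M i) ` (riemann_sphere interior_of D i) \<inter> riemann_sphere interior_of D' i = {}"
      using assms(1)[OF i] by simp_all
  qed
  show "sphere_action (psl_class (H i ** M i)) ` (riemann_sphere frontier_of D i) =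
      riemann_sphere frontier_of moebius_map (H i) ` D' i"
    unfolding act frontier_moebius[OF assms(2)[OF i]] b ..
  have inj: "inj (moebius_map (H i))" using bij_moebius_map[OF assms(2)[OF i]] by (simp add: bij_def)
  show "sphere_action (psl_class (H i ** M i)) ` (riemann_sphere interior_of D i) \<inter>
      riemann_sphere interior_of moebius_map (H i) ` D' i = {}"
    unfolding act interior_moebius[OF assms(2)[OF i]] image_Int[OF inj, symmetric] b by simp
  show "closed_jordan_disk (D i)" "closed_jordan_disk (moebius_map (H i) ` D' i)"
    using S i assms(2) closed_jordan_disk_moebius unfolding schottky_disks_def by blast+
qed (use S disj in \<open>auto simp: schottky_disks_def\<close>)


section \<open>Schottky disks in the plane play ping-pong\<close>

lemma closed_jordan_disk_planar:
  assumes "closed_jordan_disk (Some ` K)"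
  shows "compact K" "K homeomorphic cball (0::complex) 1"
proof -
  show "compact K" using assms by (simp add: closed_jordan_disk_def closedin_Some_image)
  have "homeomorphic_map euclidean (subtopology riemann_sphere (range Some)) Some"
    using embedding_map_Some[of euclidean] by (simp add: embedding_map_def riemann_sphere_def)
  then have "homeomorphic_map (top_of_set K)
      (subtopology (subtopology riemann_sphere (range Some)) (Some ` K)) Some"
    by (rule homeomorphic_map_subtopologies) auto
  then have "homeomorphic_map (top_of_set K) (subtopology riemann_sphere (Some ` K)) Some"
    by (simp add: subtopology_subtopology inf.absorb2 image_mono)
  then have "top_of_set K homeomorphic_space subtopology riemann_sphere (Some ` K)"
    by (rule homeomorphic_map_imp_homeomorphic_space)
  moreover have "subtopology riemann_sphere (Some ` K) homeomorphic_space top_of_set (cball (0::complex) 1)"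
    using assms by (simp add: closed_jordan_disk_def)
  ultimately have "top_of_set K homeomorphic_space top_of_set (cball (0::complex) 1)"
    by (rule homeomorphic_space_trans)
  then obtain f g where fg: "homeomorphic_maps (top_of_set K) (top_of_set (cball (0::complex) 1)) f g"
    unfolding homeomorphic_space_def by blast
  then have "homeomorphism K (cball 0 1) f g"
    unfolding homeomorphic_maps_def
    by (intro homeomorphismI) (auto simp: continuous_map_subtopology_eu Pi_iff)
  then show "K homeomorphic cball (0::complex) 1" unfolding homeomorphic_def by blast
qed

text \<open>A planar set homeomorphic to a disk does not separate the plane; infinity is in the
  closure of the unbounded complement and can be added without losing connectedness.\<close>

lemma connectedin_complement_disk:
  assumes "closed_jordan_disk (Some ` K)"
  shows "connectedin riemann_sphere (- Some ` K)"
proof -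
  note K = closed_jordan_disk_planar[OF assms]
  have "connected (- K)"
    using K(2) by (rule connected_complement_homeomorphic_convex_compact) auto
  then have "connectedin riemann_sphere (Some ` (- K))"
    unfolding riemann_sphere_def
    by (intro connectedin_continuous_map_image[OF continuous_map_Some]) simp
  then show ?thesis
  proof (rule connectedin_intermediate_closure_of)
    show "Some ` (- K) \<subseteq> - Some ` K" by auto
    have "None \<in> riemann_sphere closure_of (Some ` (- K))"
      unfolding in_closure_of
    proof (intro conjI allI impI)
      fix T assume T: "None \<in> T \<and> openin riemann_sphere T"
      then have "compact ({z. Some z \<notin> T} \<union> K)"
        using K(1) by (intro compact_Un) (auto simp: openin_riemann_sphere)
      then have "{z. Some z \<notin> T} \<union> K \<noteq> UNIV"
        using compact_imp_bounded not_bounded_UNIV by metis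
      then show "\<exists>y. y \<in> Some ` (- K) \<and> y \<in> T" by auto
    qed simp
    moreover have "Some ` (- K) \<subseteq> riemann_sphere closure_of (Some ` (- K))"
      by (rule closure_of_subset) simp
    moreover have "- Some ` K \<subseteq> insert None (Some ` (- K))"
    proof
      fix x assume "x \<in> - Some ` K" then show "x \<in> insert None (Some ` (- K))" by (cases x) auto
    qed
    ultimately show "- Some ` K \<subseteq> riemann_sphere closure_of (Some ` (- K))" by blast
  qed
qed

text \<open>Invariance of domain, applied to a parametrisation of the disk restricted to the open
  unit disk.\<close>

lemma interior_disk_nonempty:
  assumes "closed_jordan_disk (Some ` K)"
  shows "riemann_sphere interior_of (Some ` K) \<noteq> {}"
proof -
  obtain f g where "homeomorphism K (cball (0::complex) 1) f g"
    using closed_jordan_disk_planar(2)[OF assms] unfolding homeomorphic_def by blast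
  then have g: "continuous_on (cball 0 1) g" "inj_on g (cball 0 1)" "g ` cball 0 1 = K"
    by (auto simp: homeomorphism_def intro: inj_on_inverseI)
  have "open (g ` ball 0 1)"
    by (intro invariance_of_domain continuous_on_subset[OF g(1)] inj_on_subset[OF g(2)]
        ball_subset_cball open_ball)
  then have "openin riemann_sphere (Some ` g ` ball 0 1)"
    by (simp add: riemann_sphere_def)
  moreover have "Some ` g ` ball 0 1 \<subseteq> Some ` K" using g(3) ball_subset_cball by blast
  ultimately have "Some ` g ` ball 0 1 \<subseteq> riemann_sphere interior_of (Some ` K)"
    by (rule interior_of_maximal[rotated])
  then show ?thesis by force
qed

text \<open>The definition constrains only frontiers and interiors, whereas ping-pong needs the
  exterior of \<open>D i\<close> to enter \<open>D' i\<close>. The image of the exterior is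
  connected and misses the frontier of \<open>D' i\<close>, so it lies in this disk or avoids it
  altogether. The latter fails: an interior point of \<open>D' i\<close> would then come from
  \<open>D i\<close>, but it comes neither from the interior nor from the frontier.\<close>

lemma schottky_disks_maps_into:
  assumes S: "schottky_disks I (\<lambda>i. psl_class (M i)) D D'" and i: "i \<in> I" and M: "det (M i) \<noteq> 0"
    and fin: "None \<notin> D i" "None \<notin> D' i"
    and x: "\<xi> \<notin> D i"
  shows "moebius_map (M i) \<xi> \<in> D' i"
proof -
  let ?f = "moebius_map (M i)" and ?X = riemann_sphere
  have planar: "X = Some ` {z. Some z \<in> X}" if "None \<notin> X" for X :: "complex option set"
    using that by (intro option_set_eqI) auto
  have S': "closed_jordan_disk (D i)" "closed_jordan_disk (D' i)"
    "?f ` (?X frontier_of D i) = ?X frontier_of D' i"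
    "?f ` (?X interior_of D i) \<inter> ?X interior_of D' i = {}"
  proof -
    have "closed_jordan_disk (D i) \<and> closed_jordan_disk (D' i) \<and>
      sphere_action (psl_class (M i)) ` (?X frontier_of D i) = ?X frontier_of D' i \<and>
      sphere_action (psl_class (M i)) ` (?X interior_of D i) \<inter> ?X interior_of D' i = {}"
      using S i unfolding schottky_disks_def by blast
    then show "closed_jordan_disk (D i)" "closed_jordan_disk (D' i)"
      "?f ` (?X frontier_of D i) = ?X frontier_of D' i"
      "?f ` (?X interior_of D i) \<inter> ?X interior_of D' i = {}" using M by simp_all
  qed
  have bij: "bij ?f" by (rule bij_moebius_map[OF M])
  have cl: "closedin ?X (D i)" "closedin ?X (D' i)" using S'(1,2) by (auto simp: closed_jordan_disk_def)
  have fr: "?X frontier_of D i \<subseteq> D i" using cl(1) by (rule frontier_of_subset_closedin)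
  have dec: "D i = ?X interior_of D i \<union> ?X frontier_of D i"
    using cl(1) by (simp add: closure_of_closedin)
  have "connectedin ?X (- D i)"
    using connectedin_complement_disk[of "{z. Some z \<in> D i}"] S'(1) planar[OF fin(1)] by simp
  then have con: "connectedin ?X (?f ` (- D i))"
    by (rule connectedin_continuous_map_image[OF continuous_map_moebius[OF M]])
  have disj: "?f ` (- D i) \<inter> ?X frontier_of D' i = {}"
    unfolding S'(3)[symmetric] using bij fr by (auto simp: bij_def inj_def)
  then have "?f ` (- D i) \<inter> D' i = {} \<or> ?f ` (- D i) \<subseteq> D' i"
    using connectedin_Int_frontier_of[OF con, of "D' i"] by blast
  moreover have "?f ` (- D i) \<inter> D' i \<noteq> {}"
  proof
    assume e: "?f ` (- D i) \<inter> D' i = {}"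
    obtain y where y: "y \<in> ?X interior_of D' i"
      using interior_disk_nonempty[of "{z. Some z \<in> D' i}"] S'(2) planar[OF fin(2)] by auto
    obtain x where x: "y = ?f x" using surjD[OF bij_is_surj[OF bij]] by blast
    have yD: "y \<in> D' i" using y interior_of_subset[of ?X "D' i"] by blast
    have "x \<in> D i" using e yD x by blast
    then consider "x \<in> ?X interior_of D i" | "x \<in> ?X frontier_of D i" using dec by blast
    then show False
    proof cases
      case 1
      then show False using S'(4) y x by blast
    next
      case 2
      then have "y \<in> ?X frontier_of D' i" using S'(3) x by blast
      then show False using y by (simp add: frontier_of_def)
    qed
  qed
  ultimately show ?thesis using x by blast
qed

text \<open>The displacement of z under a matrix with rows a, b and c, d is ((a - d) z + b - c z^2)
  / (c z + d). Near the identity the denominator exceeds 1/2 in modulus on K, and the numerator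
  tends to 0 uniformly.\<close>

lemma moebius_near_identity:
  assumes "compact K" and H: "(H \<longlongrightarrow> mat 1) F" and e: "0 < e"
  shows "\<forall>\<^sub>F x in F. \<forall>z\<in>K. \<exists>z'. moebius_map (H x) (Some z) = Some z' \<and> cmod (z' - z) < e"
proof -
  obtain B where B: "0 < B" "\<And>z. z \<in> K \<Longrightarrow> cmod z \<le> B"
    using compact_imp_bounded[OF assms(1)] by (auto simp: bounded_pos)
  have ent: "((\<lambda>x. H x $ i $ j) \<longlongrightarrow> (mat 1 :: complex^2^2) $ i $ j) F" for i j
    by (intro tendsto_vec_nth H)
  have "((\<lambda>x. cmod (H x $ 2 $ 1) * B + cmod (H x $ 2 $ 2 - 1)) \<longlongrightarrow>
      cmod ((mat 1 :: complex^2^2) $ 2 $ 1) * B + cmod ((mat 1 :: complex^2^2) $ 2 $ 2 - 1)) F"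
    by (intro tendsto_intros ent)
  then have "((\<lambda>x. cmod (H x $ 2 $ 1) * B + cmod (H x $ 2 $ 2 - 1)) \<longlongrightarrow> 0) F" by simp
  then have ev1: "\<forall>\<^sub>F x in F. cmod (H x $ 2 $ 1) * B + cmod (H x $ 2 $ 2 - 1) < 1 / 2"
    by (rule order_tendstoD) simp
  have "((\<lambda>x. 2 * (cmod (H x $ 1 $ 1 - H x $ 2 $ 2) * B + cmod (H x $ 1 $ 2) + cmod (H x $ 2 $ 1) * B\<^sup>2)) \<longlongrightarrow>
      2 * (cmod ((mat 1 :: complex^2^2) $ 1 $ 1 - (mat 1 :: complex^2^2) $ 2 $ 2) * B
        + cmod ((mat 1 :: complex^2^2) $ 1 $ 2) + cmod ((mat 1 :: complex^2^2) $ 2 $ 1) * B\<^sup>2)) F"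
    by (intro tendsto_intros ent)
  then have "((\<lambda>x. 2 * (cmod (H x $ 1 $ 1 - H x $ 2 $ 2) * B + cmod (H x $ 1 $ 2) + cmod (H x $ 2 $ 1) * B\<^sup>2)) \<longlongrightarrow> 0) F"
    by simp
  then have ev2: "\<forall>\<^sub>F x in F. 2 * (cmod (H x $ 1 $ 1 - H x $ 2 $ 2) * B + cmod (H x $ 1 $ 2)
      + cmod (H x $ 2 $ 1) * B\<^sup>2) < e"
    using e by (rule order_tendstoD)
  show ?thesis using ev1 ev2
  proof eventually_elim
    case (elim x)
    show ?case
    proof
      fix z assume "z \<in> K"
      then have z: "cmod z \<le> B" by (rule B(2))
      define a b c d where "a = H x $ 1 $ 1" and "b = H x $ 1 $ 2" and "c = H x $ 2 $ 1" and "d = H x $ 2 $ 2"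
      define q where "q = c * z + d"
      have "cmod (1 - q) \<le> cmod c * B + cmod (d - 1)"
      proof -
        have "1 - q = - (c * z) - (d - 1)" by (simp add: q_def)
        then have "cmod (1 - q) \<le> cmod (c * z) + cmod (d - 1)" by (metis norm_minus_cancel norm_triangle_ineq4)
        also have "cmod (c * z) \<le> cmod c * B" using z by (simp add: norm_mult mult_left_mono)
        finally show ?thesis by simp
      qed
      then have "cmod (1 - q) < 1 / 2" using elim(1) by (simp add: c_def d_def)
      moreover have "1 \<le> cmod (1 - q) + cmod q" using norm_triangle_ineq[of "1 - q" q] by simp
      ultimately have q: "1 / 2 < cmod q" by linarith
      then have q0: "q \<noteq> 0" by auto
      define z' where "z' = (a * z + b) / q"
      have m: "moebius_map (H x) (Some z) = Some z'"
        using q0 by (simp add: moebius_map_def z'_def q_def a_def b_def c_def d_def)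
      have "z' - z = ((a - d) * z + b - c * z\<^sup>2) / q"
        using q0 by (simp add: z'_def divide_simps) (simp add: q_def algebra_simps power2_eq_square)
      then have "cmod (z' - z) = cmod ((a - d) * z + b - c * z\<^sup>2) / cmod q" by (simp add: norm_divide)
      also have "\<dots> \<le> cmod ((a - d) * z + b - c * z\<^sup>2) / (1 / 2)"
        using q by (intro divide_left_mono mult_pos_pos) auto
      also have "\<dots> = 2 * cmod ((a - d) * z + b - c * z\<^sup>2)" by simp
      also have "cmod ((a - d) * z + b - c * z\<^sup>2) \<le> cmod ((a - d) * z) + cmod b + cmod (c * z\<^sup>2)"
        by (meson add_right_mono norm_triangle_ineq norm_triangle_ineq4 order_trans)
      also have "\<dots> \<le> cmod (a - d) * B + cmod b + cmod c * B\<^sup>2"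
        using z by (intro add_mono) (auto simp: norm_mult norm_power intro!: mult_left_mono power_mono)
      finally have "cmod (z' - z) < e"
        using elim(2) by (simp add: a_def b_def c_def d_def)
      then show "\<exists>z'. moebius_map (H x) (Some z) = Some z' \<and> cmod (z' - z) < e" using m by blast
    qed
  qed
qed

lemma compact_family_separated:
  fixes K :: "'a \<Rightarrow> complex set"
  assumes fin: "finite J" and K: "\<And>a. a \<in> J \<Longrightarrow> compact (K a)"
    and disj: "\<And>a b. a \<in> J \<Longrightarrow> b \<in> J \<Longrightarrow> a \<noteq> b \<Longrightarrow> K a \<inter> K b = {}"
  obtains d where "0 < d" "\<And>a b z z'. a \<in> J \<Longrightarrow> b \<in> J \<Longrightarrow> a \<noteq> b \<Longrightarrow> z \<in> K a \<Longrightarrow> z' \<in> K b \<Longrightarrow> d \<le> cmod (z - z')"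
proof -
  have ex: "\<exists>d. 0 < d \<and> (\<forall>z\<in>K (fst p). \<forall>z'\<in>K (snd p). d \<le> cmod (z - z'))"
    if p: "p \<in> {p \<in> J \<times> J. fst p \<noteq> snd p}" for p
    using separate_compact_closed[of "K (fst p)" "K (snd p)"] K[of "fst p"] compact_imp_closed[OF K[of "snd p"]]
      disj[of "fst p" "snd p"] p by (auto simp: dist_norm)
  define d where "d p = (SOME d. 0 < d \<and> (\<forall>z\<in>K (fst p). \<forall>z'\<in>K (snd p). d \<le> cmod (z - z')))" for p
  have d: "0 < d p \<and> (\<forall>z\<in>K (fst p). \<forall>z'\<in>K (snd p). d p \<le> cmod (z - z'))"
    if "p \<in> {p \<in> J \<times> J. fst p \<noteq> snd p}" for p
    unfolding d_def by (rule someI_ex[OF ex[OF that]])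
  let ?P = "{p \<in> J \<times> J. fst p \<noteq> snd p}"
  have finP: "finite ?P" using fin by simp
  show ?thesis
  \<comment> \<open>The element 1 keeps the minimum meaningful when there are no two distinct
    indices.\<close>
  proof (rule that[of "Min (insert 1 (d ` ?P))"])
    show "0 < Min (insert 1 (d ` ?P))" using finP d by (simp add: Min_gr_iff)
    fix a b z z' assume "a \<in> J" "b \<in> J" "a \<noteq> b" "z \<in> K a" "z' \<in> K b"
    then have "d (a, b) \<le> cmod (z - z')" "(a, b) \<in> ?P" using d[of "(a, b)"] by auto
    moreover have "Min (insert 1 (d ` ?P)) \<le> d (a, b)"
      using finP \<open>(a, b) \<in> ?P\<close> by (intro Min_le) auto
    ultimately show "Min (insert 1 (d ` ?P)) \<le> cmod (z - z')" by linarith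
  qed
qed

text \<open>The new generator composed with the inverse of the old one. It is near the identity when
  N is near A, and it carries the old target disk to one for N.\<close>

definition deviation :: "complex^2^2 \<Rightarrow> complex^2^2 \<Rightarrow> complex^2^2" where
  "deviation N A = scale2 (1 / det A) (N ** adj2 A)"

lemma deviation_mult: "det A \<noteq> 0 \<Longrightarrow> deviation N A ** A = N"
  by (simp add: deviation_def matrix_mul_assoc[symmetric] mat2_eq_iff)

lemma det_deviation: "det A \<noteq> 0 \<Longrightarrow> det N \<noteq> 0 \<Longrightarrow> det (deviation N A) \<noteq> 0"
  by (simp add: deviation_def det_mul)

lemma tendsto_deviation:
  assumes "(N \<longlongrightarrow> A) F" "det A \<noteq> 0"
  shows "((\<lambda>x. deviation (N x) A) \<longlongrightarrow> mat 1) F"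
proof -
  have "((\<lambda>x. N x ** (scale2 (1 / det A) (adj2 A))) \<longlongrightarrow> A ** (scale2 (1 / det A) (adj2 A))) F"
    by (intro tendsto_intros assms)
  then show ?thesis using assms(2) by (simp add: deviation_def)
qed

text \<open>Indexed by the letter that maps into the disk: generator i enters \<open>D' i\<close>,
  its inverse enters \<open>D i\<close>.\<close>

definition planar_disk :: "('i \<Rightarrow> complex option set) \<Rightarrow> ('i \<Rightarrow> complex option set) \<Rightarrow>
    'i letter \<Rightarrow> complex set" where
  "planar_disk D D' a = {z. Some z \<in> (if snd a then D' (fst a) else D (fst a))}"

context
  fixes I :: "'i set" and M :: "'i \<Rightarrow> complex^2^2" and D D' :: "'i \<Rightarrow> complex option set"
    and N :: "'x \<Rightarrow> 'i \<Rightarrow> complex^2^2" and F :: "'x filter"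
  assumes finI: "finite I" and M: "\<And>i. i \<in> I \<Longrightarrow> det (M i) \<noteq> 0"
    and S: "schottky_disks I (\<lambda>i. psl_class (M i)) D D'"
    and planar: "\<And>i. i \<in> I \<Longrightarrow> None \<notin> D i" "\<And>i. i \<in> I \<Longrightarrow> None \<notin> D' i"
    and N: "\<And>i. i \<in> I \<Longrightarrow> ((\<lambda>x. N x i) \<longlongrightarrow> M i) F"
begin

lemma planar_disk_eq:
  "i \<in> I \<Longrightarrow> D i = Some ` planar_disk D D' (i, False)" "i \<in> I \<Longrightarrow> D' i = Some ` planar_disk D D' (i, True)"
  using planar by (auto simp: planar_disk_def intro!: option_set_eqI)

lemma compact_planar_disk:
  assumes "fst a \<in> I" shows "compact (planar_disk D D' a)"
proof -
  have "closed_jordan_disk (D (fst a))" "closed_jordan_disk (D' (fst a))"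
    using S assms unfolding schottky_disks_def by blast+
  then show ?thesis
    using planar_disk_eq[OF assms] closed_jordan_disk_planar(1) by (cases a; cases "snd a") auto
qed

lemma planar_disk_disjoint:
  assumes "fst a \<in> I" "fst b \<in> I" "a \<noteq> b" shows "planar_disk D D' a \<inter> planar_disk D D' b = {}"
  using S assms unfolding schottky_disks_def disjoint_family_on_def planar_disk_def
  by (cases a; cases b; cases "snd a"; cases "snd b") (auto; blast)+

lemma planar_disk_separation:
  obtains d where "0 < d" "\<And>a b z z'. fst a \<in> I \<Longrightarrow> fst b \<in> I \<Longrightarrow> a \<noteq> b \<Longrightarrow>
    z \<in> planar_disk D D' a \<Longrightarrow> z' \<in> planar_disk D D' b \<Longrightarrow> d \<le> cmod (z - z')"
proof -
  have "finite (I \<times> (UNIV :: bool set))" using finI by simp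
  then show ?thesis
  proof (rule compact_family_separated[of _ "planar_disk D D'"])
    fix d assume "0 < d" "\<And>a b z z'. a \<in> I \<times> UNIV \<Longrightarrow> b \<in> I \<times> UNIV \<Longrightarrow> a \<noteq> b \<Longrightarrow>
      z \<in> planar_disk D D' a \<Longrightarrow> z' \<in> planar_disk D D' b \<Longrightarrow> d \<le> cmod (z - z')"
    then show thesis by (intro that[of d]) (auto simp: mem_Times_iff)
  qed (use compact_planar_disk planar_disk_disjoint in \<open>auto simp: mem_Times_iff\<close>)
qed

lemma eventually_close:
  assumes "0 < e"
  shows "\<forall>\<^sub>F x in F. \<forall>i\<in>I. det (N x i) \<noteq> 0 \<and> (\<forall>z\<in>planar_disk D D' (i, True). \<exists>z'.
    moebius_map (deviation (N x i) (M i)) (Some z) = Some z' \<and> cmod (z' - z) < e)"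
proof (rule eventually_ball_finite[OF finI], intro ballI eventually_conj)
  fix i assume i: "i \<in> I"
  have "((\<lambda>x. det (N x i)) \<longlongrightarrow> det (M i)) F" by (intro tendsto_intros N i)
  then show "\<forall>\<^sub>F x in F. det (N x i) \<noteq> 0" using M[OF i] by (rule tendsto_imp_eventually_ne)
  show "\<forall>\<^sub>F x in F. \<forall>z\<in>planar_disk D D' (i, True). \<exists>z'.
    moebius_map (deviation (N x i) (M i)) (Some z) = Some z' \<and> cmod (z' - z) < e"
    using i by (intro moebius_near_identity compact_planar_disk tendsto_deviation N M assms) auto
qed

lemma schottky_disks_stable:
  "\<forall>\<^sub>F x in F. (\<forall>i\<in>I. det (N x i) \<noteq> 0) \<and> schottky_disks I (\<lambda>i. psl_class (N x i)) D
     (\<lambda>i. moebius_map (deviation (N x i) (M i)) ` D' i)"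
proof -
  obtain d where d: "0 < d" "\<And>a b z z'. fst a \<in> I \<Longrightarrow> fst b \<in> I \<Longrightarrow> a \<noteq> b \<Longrightarrow>
    z \<in> planar_disk D D' a \<Longrightarrow> z' \<in> planar_disk D D' b \<Longrightarrow> d \<le> cmod (z - z')"
    using planar_disk_separation by blast
  \<comment> \<open>Two target disks may approach each other, so each is allowed less than half of
    the distance d.\<close>
  have "0 < d / 2" using d by simp
  from eventually_close[OF this] show ?thesis
  proof eventually_elim
    case (elim x)
    let ?H = "\<lambda>i. deviation (N x i) (M i)"
    have near: "\<exists>z z'. \<xi> = Some z \<and> z \<in> planar_disk D D' (i, True) \<and> moebius_map (?H i) \<xi> = Some z' \<and> cmod (z' - z) < d / 2"
      if ix: "i \<in> I" "\<xi> \<in> D' i" for i \<xi>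
    proof -
      obtain z where z: "\<xi> = Some z" "z \<in> planar_disk D D' (i, True)"
        using planar_disk_eq(2)[OF ix(1)] ix(2) by blast
      then show ?thesis using bspec[OF elim ix(1)] by blast
    qed
    have "schottky_disks I (\<lambda>i. psl_class (?H i ** M i)) D (\<lambda>i. moebius_map (?H i) ` D' i)"
    proof (rule schottky_disks_perturb[OF M _ S])
      show "det (?H i) \<noteq> 0" if "i \<in> I" for i using elim M that by (simp add: det_deviation)
      show "disjoint_family_on (\<lambda>i. moebius_map (?H i) ` D' i) I"
        unfolding disjoint_family_on_def
      proof (intro ballI impI)
        fix i j assume ij: "i \<in> I" "j \<in> I" "i \<noteq> j"
        show "moebius_map (?H i) ` D' i \<inter> moebius_map (?H j) ` D' j = {}"
        proof (rule ccontr)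
          assume "moebius_map (?H i) ` D' i \<inter> moebius_map (?H j) ` D' j \<noteq> {}"
          then obtain \<xi> \<xi>' where x: "\<xi> \<in> D' i" "\<xi>' \<in> D' j" "moebius_map (?H i) \<xi> = moebius_map (?H j) \<xi>'"
            by auto
          obtain z z1 where z: "\<xi> = Some z" "z \<in> planar_disk D D' (i, True)" "moebius_map (?H i) \<xi> = Some z1" "cmod (z1 - z) < d / 2"
            using near[OF ij(1) x(1)] by blast
          obtain z' z1' where z': "\<xi>' = Some z'" "z' \<in> planar_disk D D' (j, True)" "moebius_map (?H j) \<xi>' = Some z1'" "cmod (z1' - z') < d / 2"
            using near[OF ij(2) x(2)] by blast
          have "z1 = z1'" using x(3) z(3) z'(3) by simp
          then have "cmod (z - z') < d"
            using z(4) z'(4) norm_triangle_ineq4[of "z1 - z'" "z1 - z"] by simp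
          moreover have "d \<le> cmod (z - z')" using d(2)[of "(i, True)" "(j, True)"] ij z(2) z'(2) by simp
          ultimately show False by simp
        qed
      qed
      show "D i \<inter> moebius_map (?H j) ` D' j = {}" if ij: "i \<in> I" "j \<in> I" for i j
      proof (rule ccontr)
        assume "D i \<inter> moebius_map (?H j) ` D' j \<noteq> {}"
        then obtain \<xi>' where x: "\<xi>' \<in> D' j" "moebius_map (?H j) \<xi>' \<in> D i" by auto
        obtain z' z1' where z': "\<xi>' = Some z'" "z' \<in> planar_disk D D' (j, True)" "moebius_map (?H j) \<xi>' = Some z1'" "cmod (z1' - z') < d / 2"
          using near[OF ij(2) x(1)] by blast
        have "z1' \<in> planar_disk D D' (i, False)" using x(2) z'(3) by (simp add: planar_disk_def)
        then have "d \<le> cmod (z1' - z')" using d(2)[of "(i, False)" "(j, True)"] ij z'(2) by simp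
        then show False using z'(4) d(1) by simp
      qed
    qed
    moreover have "schottky_disks I (\<lambda>i. psl_class (?H i ** M i)) D (\<lambda>i. moebius_map (?H i) ` D' i) =
        schottky_disks I (\<lambda>i. psl_class (N x i)) D (\<lambda>i. moebius_map (?H i) ` D' i)"
      unfolding schottky_disks_def by (intro conj_cong ball_cong refl) (simp_all add: deviation_mult M)
    ultimately show ?case using elim by simp
  qed
qed

end

text \<open>The disks are thickened to their closed d/4-neighbourhoods, which are still d/2 apart. A
  generator whose target disk moves by less than d/4 maps the exterior of the thick source disk into
  the thick target disk, so the same sets serve M and every nearby tuple.\<close>

lemma pingpong_stable:
  fixes M :: "'i::finite \<Rightarrow> complex^2^2" and N :: "'x \<Rightarrow> 'i \<Rightarrow> complex^2^2"
  assumes M: "\<And>i. det (M i) \<noteq> 0"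
    and S: "schottky_disks UNIV (\<lambda>i. psl_class (M i)) D D'"
    and planar: "\<And>i. None \<notin> D i" "\<And>i. None \<notin> D' i"
    and N: "\<And>i. ((\<lambda>x. N x i) \<longlongrightarrow> M i) F"
  shows "\<exists>E \<delta> R. pingpong E \<delta> R M \<and> (\<forall>\<^sub>F x in F. pingpong E \<delta> R (N x))"
proof -
  let ?K = "planar_disk D D'"
  note pd = finite M S planar N
  obtain d where d: "0 < d" "\<And>a b z z'. a \<noteq> b \<Longrightarrow> z \<in> ?K a \<Longrightarrow> z' \<in> ?K b \<Longrightarrow> d \<le> cmod (z - z')"
    using planar_disk_separation[of UNIV M D D'] pd by (metis UNIV_I)
  have cK: "compact (?K a)" for a using compact_planar_disk[of UNIV M D D'] pd by blast
  define E where "E a = (\<Union>k\<in>?K a. cball k (d / 4))" for a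
  have E_iff: "z \<in> E a \<longleftrightarrow> (\<exists>k\<in>?K a. cmod (z - k) \<le> d / 4)" for z a
    by (auto simp: E_def dist_norm norm_minus_commute)
  have KE: "?K a \<subseteq> E a" for a
  proof
    fix z assume "z \<in> ?K a"
    then show "z \<in> E a" unfolding E_iff using d(1) by (intro bexI[of _ z]) auto
  qed
  have cE: "compact (E a)" for a
  proof -
    have "E a = {k + x | k x. k \<in> ?K a \<and> x \<in> cball 0 (d / 4)}"
    proof (intro Set.set_eqI iffI)
      fix z assume "z \<in> E a"
      then obtain k where "k \<in> ?K a" "cmod (z - k) \<le> d / 4" by (auto simp: E_iff)
      then have "k \<in> ?K a \<and> z - k \<in> cball 0 (d / 4)" "z = k + (z - k)" by auto
      then show "z \<in> {k + x | k x. k \<in> ?K a \<and> x \<in> cball 0 (d / 4)}" by blast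
    next
      fix z assume "z \<in> {k + x | k x. k \<in> ?K a \<and> x \<in> cball 0 (d / 4)}"
      then obtain k x where "z = k + x" "k \<in> ?K a" "cmod x \<le> d / 4" by auto
      then show "z \<in> E a" unfolding E_iff by (intro bexI[of _ k]) auto
    qed
    then show ?thesis using compact_sums[OF cK[of a] compact_cball[of 0 "d / 4"]] by (simp only:)
  qed
  have sep: "d / 2 \<le> cmod (z - z')" if "a \<noteq> b" "z \<in> E a" "z' \<in> E b" for a b z z'
  proof -
    obtain k k' where k: "k \<in> ?K a" "cmod (z - k) \<le> d / 4" "k' \<in> ?K b" "cmod (z' - k') \<le> d / 4"
      using \<open>z \<in> E a\<close> \<open>z' \<in> E b\<close> by (auto simp: E_iff)
    have eq: "k - k' = ((z - z') - (z - k)) + (z' - k')" by simp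
    have "cmod (k - k') \<le> cmod ((z - z') - (z - k)) + cmod (z' - k')"
      unfolding eq by (rule norm_triangle_ineq)
    then have "cmod (k - k') \<le> cmod (z - z') + cmod (z - k) + cmod (z' - k')"
      using norm_triangle_ineq4[of "z - z'" "z - k"] by linarith
    then show ?thesis using d(2)[OF \<open>a \<noteq> b\<close> k(1,3)] k(2,4) by linarith
  qed
  have "bounded (\<Union>a. E a)" using compact_imp_bounded[OF cE] by (intro bounded_UN) auto
  then obtain B where B: "0 < B" "\<And>a z. z \<in> E a \<Longrightarrow> cmod z \<le> B" by (auto simp: bounded_pos)
  have bd: "cmod (z - z') \<le> 2 * B" if "z \<in> E a" "z' \<in> E b" for z z' a b
    using B(2)[OF \<open>z \<in> E a\<close>] B(2)[OF \<open>z' \<in> E b\<close>] norm_triangle_ineq4[of z z'] by linarith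
  have sets: "pingpong_sets E (d / 2) (2 * B)"
    using cE d(1) B(1) sep bd by unfold_locales auto
  have pp: "pingpong E (d / 2) (2 * B) L"
    if L: "\<And>i. det (L i) \<noteq> 0" "\<And>i z. z \<in> ?K (i, True) \<Longrightarrow> \<exists>z'. moebius_map (deviation (L i) (M i)) (Some z) = Some z' \<and> cmod (z' - z) < d / 4"
    for L :: "'i \<Rightarrow> complex^2^2"
  proof -
    have fwd: "moebius_map (L i) \<xi> \<in> Some ` E (i, True)" if x: "\<xi> \<notin> D i" for i \<xi>
    proof -
      have "moebius_map (M i) \<xi> \<in> D' i"
        using schottky_disks_maps_into[OF S _ M planar x] by simp
      then obtain z where z: "moebius_map (M i) \<xi> = Some z" "z \<in> ?K (i, True)"
        using planar(2)[of i] by (cases "moebius_map (M i) \<xi>") (auto simp: planar_disk_def)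
      obtain z' where z': "moebius_map (deviation (L i) (M i)) (Some z) = Some z'" "cmod (z' - z) < d / 4"
        using L(2)[OF z(2)] by blast
      have "moebius_map (L i) \<xi> = moebius_map (deviation (L i) (M i) ** M i) \<xi>"
        by (simp add: deviation_mult M)
      also have "\<dots> = Some z'" using z z' by (simp add: moebius_map_mult M L det_deviation)
      finally have "moebius_map (L i) \<xi> = Some z'" .
      moreover have "z' \<in> E (i, True)" unfolding E_iff using z(2) z'(2) by (intro bexI[of _ z]) auto
      ultimately show ?thesis by simp
    qed
    have D: "D i \<subseteq> Some ` E (i, False)" for i
    proof
      fix x assume "x \<in> D i"
      then show "x \<in> Some ` E (i, False)"
        using planar(1)[of i] subsetD[OF KE[of "(i, False)"]] by (cases x) (auto simp: planar_disk_def)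
    qed
    have "moebius_map (letter_mat L a) \<xi> \<in> Some ` E a" if x: "\<xi> \<notin> Some ` E (flip a)" for a \<xi>
    proof (cases a)
      case (Pair i b)
      show ?thesis
      proof (cases b)
        case True
        then show ?thesis using Pair x fwd[of \<xi> i] D[of i] by (auto simp: letter_mat_def flip_def)
      next
        case False
        \<comment> \<open>The inverse letters come for free: a preimage outside \<open>D i\<close>
          would be sent by the generator into \<open>E (i, True)\<close>, where \<xi> is
          not.\<close>
        have "moebius_map (adj2 (L i)) \<xi> \<in> D i"
        proof (rule ccontr)
          assume "moebius_map (adj2 (L i)) \<xi> \<notin> D i"
          then have "\<xi> \<in> Some ` E (i, True)" using fwd[of "moebius_map (adj2 (L i)) \<xi>" i] L(1) by simp
          then show False using x Pair False by (simp add: flip_def)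
        qed
        then show ?thesis using D[of i] Pair False by (auto simp: letter_mat_def)
      qed
    qed
    then show ?thesis using sets L(1) by (simp add: pingpong_def pingpong_axioms_def)
  qed
  have "pingpong E (d / 2) (2 * B) M"
  proof (rule pp[OF M])
    fix i z
    have "deviation (M i) (M i) = mat 1" using M[of i] by (simp add: deviation_def)
    then show "\<exists>z'. moebius_map (deviation (M i) (M i)) (Some z) = Some z' \<and> cmod (z' - z) < d / 4"
      using d(1) by simp
  qed
  moreover have "\<forall>\<^sub>F x in F. pingpong E (d / 2) (2 * B) (N x)"
  proof -
    have "0 < d / 4" using d(1) by simp
    from eventually_close[OF pd this] show ?thesis
    proof eventually_elim
      case (elim x)
      then show ?case by (intro pp) auto
    qed
  qed
  ultimately show ?thesis by blast
qed


section \<open>Moving infinity off the disks, and openness of small dimension\<close>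

section \<open>Rotations moving a point to infinity\<close>

text \<open>A multiple of a unitary matrix taking p to infinity; it rotates the Riemann sphere, so
  it preserves chordal distances, and it fixes the base point (0, 1).\<close>

definition rotation :: "complex \<Rightarrow> complex^2^2" where
  "rotation p = mat2 (cnj p) 1 (- 1) p"

lemma det_rotation: "det (rotation p) = complex_of_real ((cmod p)\<^sup>2 + 1)"
  using complex_norm_square[of p] by (simp add: rotation_def mult.commute)

lemma det_rotation_nonzero [simp]: "det (rotation p) \<noteq> 0"
  unfolding det_rotation of_real_eq_0_iff by (smt (verit) zero_le_power2)

text \<open>The disks do not cover the sphere: near a frontier point of one of them there are points
  outside it, and the other disks, being closed and disjoint from it, stay away. The uncovered set
  is open and so contains a finite point p, the one to be rotated to infinity.\<close>

lemma exists_rotation: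
  assumes S: "schottky_disks I \<gamma> D D'" and fin: "finite I" "I \<noteq> {}"
  shows "\<exists>p. \<forall>i\<in>I. None \<notin> moebius_map (rotation p) ` D i \<and> None \<notin> moebius_map (rotation p) ` D' i"
proof -
  let ?X = riemann_sphere
  obtain i where i: "i \<in> I" using fin by blast
  have cl: "closedin ?X (D j)" "closedin ?X (D' j)" if "j \<in> I" for j
    using S that by (auto simp: schottky_disks_def closed_jordan_disk_def)
  have "jordan_curve (?X frontier_of D i)"
    using S i by (auto simp: schottky_disks_def closed_jordan_disk_def)
  then have hom: "subtopology ?X (?X frontier_of D i) homeomorphic_space top_of_set (sphere (0::complex) 1)"
    by (simp add: jordan_curve_def)
  have "?X frontier_of D i \<noteq> {}"
  proof
    assume "?X frontier_of D i = {}"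
    then have "top_of_set (sphere (0::complex) 1) = trivial_topology"
      using homeomorphic_empty_space[OF hom] by simp
    then have "topspace (top_of_set (sphere (0::complex) 1)) = {}" by (simp only: topspace_discrete_topology)
    then have "sphere (0::complex) 1 = {}" by simp
    moreover have "(1::complex) \<in> sphere 0 1" by simp
    ultimately show False by blast
  qed
  then obtain x where x: "x \<in> ?X frontier_of D i" by blast
  have xD: "x \<in> D i" using x frontier_of_subset_closedin[OF cl(1)[OF i]] by blast
  define C where "C = (\<Union>j\<in>I. D' j) \<union> (\<Union>j\<in>I - {i}. D j)"
  have "closedin ?X (\<Union>j\<in>I. D' j)" by (rule closedin_Union) (use fin cl in auto)
  moreover have "closedin ?X (\<Union>j\<in>I - {i}. D j)" by (rule closedin_Union) (use fin cl in auto)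
  ultimately have clC: "closedin ?X C" unfolding C_def by (rule closedin_Un)
  have "D i \<inter> D' j = {}" if "j \<in> I" for j
    using S i that unfolding schottky_disks_def by blast
  moreover have "D i \<inter> D j = {}" if "j \<in> I - {i}" for j
  proof -
    have "disjoint_family_on D I" using S unfolding schottky_disks_def by blast
    then show ?thesis using i that by (auto dest: disjoint_family_onD)
  qed
  ultimately have "x \<notin> C" using xD unfolding C_def by blast
  moreover have op: "openin ?X (- C)" using clC by (simp add: closedin_def Compl_eq_Diff_UNIV)
  ultimately have ne: "- C - D i \<noteq> {}"
    using frontier_of_openin_straddle_Int(2)[OF op, of "D i"] x by blast
  have "openin ?X (- C - D i)" using op cl(1)[OF i] by (rule openin_diff)
  then have "\<exists>p. Some p \<in> - C - D i"
  proof (cases "None \<in> - C - D i")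
    case True
    then have "compact {z. Some z \<notin> - C - D i}"
      using \<open>openin ?X (- C - D i)\<close> by (simp add: openin_riemann_sphere)
    then have "{z. Some z \<notin> - C - D i} \<noteq> UNIV"
      using compact_imp_bounded not_bounded_UNIV by metis
    then show ?thesis by blast
  next
    case False
    then show ?thesis using ne by (metis all_not_in_conv not_None_eq)
  qed
  then obtain p where p: "Some p \<in> - C - D i" by blast
  have "Some p \<notin> D j" "Some p \<notin> D' j" if "j \<in> I" for j using p that by (auto simp: C_def)
  moreover have "\<xi> = Some p" if "None = moebius_map (rotation p) \<xi>" for \<xi>
  proof -
    have "\<xi> = moebius_map (adj2 (rotation p)) (moebius_map (rotation p) \<xi>)" by simp
    also have "\<dots> = Some p" unfolding that[symmetric] by (simp add: moebius_map_def rotation_def)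
    finally show ?thesis .
  qed
  ultimately show ?thesis by (intro exI[of _ p]) blast
qed


section \<open>Limit points lie in the limit set\<close>

text \<open>The right factor fixes the base point, so the result is the Poincare extension of the
  inverse rotation at (z, t). It is verified algebraically from the rows of A, whose inner product
  and norms encode z and t.\<close>

lemma hyp_action_unrotate:
  assumes "det A \<noteq> 0" and h: "hyp_action (psl_class A) (0, 1) = (z, t)"
  shows "hyp_action (psl_class (adj2 (rotation p) ** A ** rotation p)) (0, 1) =
    (((p * z - 1) * cnj (z + cnj p) + p * complex_of_real (t\<^sup>2)) /
        complex_of_real ((cmod (z + cnj p))\<^sup>2 + t\<^sup>2),
     ((cmod p)\<^sup>2 + 1) * t / ((cmod (z + cnj p))\<^sup>2 + t\<^sup>2))"
proof -
  define a b c d where "a = A$1$1" and "b = A$1$2" and "c = A$2$1" and "d = A$2$2"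
  define N where "N = (cmod c)\<^sup>2 + (cmod d)\<^sup>2"
  define \<kappa> where "\<kappa> = (cmod p)\<^sup>2 + 1"
  define Z where "Z = (cmod (z + cnj p))\<^sup>2 + t\<^sup>2"
  have \<kappa>: "\<kappa> > 0" by (simp add: \<kappa>_def add_nonneg_pos)
  have cd: "c \<noteq> 0 \<or> d \<noteq> 0" using assms(1) by (auto simp: det_2 c_def d_def)
  have N: "N > 0" using cd by (simp add: N_def sum_power2_gt_zero_iff)
  have zt: "z = (a * cnj c + b * cnj d) / complex_of_real N" "t = cmod (det A) / N"
    using h hyp_action_psl_class[OF assms(1)] by (simp_all add: N_def a_def b_def c_def d_def)
  have Q: "a * cnj c + b * cnj d = z * complex_of_real N" using N by (simp add: zt(1))
  then have Q': "cnj a * c + cnj b * d = cnj z * complex_of_real N"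
    by (metis complex_cnj_add complex_cnj_cnj complex_cnj_complex_of_real complex_cnj_mult)
  have Nc: "c * cnj c + d * cnj d = complex_of_real N" by (simp add: N_def complex_norm_square[symmetric])
  have t2: "complex_of_real (t\<^sup>2) * (complex_of_real N)\<^sup>2 = det A * cnj (det A)"
  proof -
    have "t\<^sup>2 * N\<^sup>2 = (cmod (det A))\<^sup>2" using N by (simp add: zt(2) power_divide)
    then show ?thesis by (metis complex_norm_square of_real_mult of_real_power)
  qed
  have P: "a * cnj a + b * cnj b = complex_of_real N * (z * cnj z + complex_of_real (t\<^sup>2))"
  proof -
    \<comment> \<open>Lagrange's identity for the two rows of A; it expresses the norm of the first
      row through z, t and N.\<close>
    have "(a * cnj a + b * cnj b) * (c * cnj c + d * cnj d) =
        (a * cnj c + b * cnj d) * (cnj a * c + cnj b * d) + det A * cnj (det A)"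
      by (simp add: det_2 a_def b_def c_def d_def algebra_simps)
    then have "(a * cnj a + b * cnj b) * complex_of_real N =
        z * complex_of_real N * (cnj z * complex_of_real N) + complex_of_real (t\<^sup>2) * (complex_of_real N)\<^sup>2"
      by (simp only: Nc Q Q' t2)
    then have "(a * cnj a + b * cnj b) * complex_of_real N =
        (complex_of_real N * (z * cnj z + complex_of_real (t\<^sup>2))) * complex_of_real N"
      by (simp add: algebra_simps power2_eq_square)
    then show ?thesis using N by simp
  qed
  let ?B = "adj2 (rotation p) ** A ** rotation p"
  have B: "?B$1$1 = (p * a - c) * cnj p - (p * b - d)" "?B$1$2 = (p * a - c) + (p * b - d) * p"
    "?B$2$1 = (a + cnj p * c) * cnj p - (b + cnj p * d)" "?B$2$2 = (a + cnj p * c) + (b + cnj p * d) * p"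
    by (simp_all add: rotation_def a_def b_def c_def d_def algebra_simps)
  have K: "complex_of_real \<kappa> = p * cnj p + 1" using complex_norm_square[of p] by (simp add: \<kappa>_def)
  have ZZ: "complex_of_real Z = (z + cnj p) * cnj (z + cnj p) + complex_of_real (t\<^sup>2)"
    using complex_norm_square[of "z + cnj p"] by (simp add: Z_def)
  have detB: "det ?B = complex_of_real \<kappa> * complex_of_real \<kappa> * det A"
    unfolding det_mul det_adj2 det_rotation \<kappa>_def by (simp add: mult_ac)
  have NB: "(cmod (?B$2$1))\<^sup>2 + (cmod (?B$2$2))\<^sup>2 = \<kappa> * N * Z"
  proof -
    have "complex_of_real ((cmod (?B$2$1))\<^sup>2 + (cmod (?B$2$2))\<^sup>2) =
        complex_of_real \<kappa> * ((a * cnj a + b * cnj b) + p * (a * cnj c + b * cnj d)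
          + cnj p * (cnj a * c + cnj b * d) + p * cnj p * (c * cnj c + d * cnj d))"
      unfolding of_real_add complex_norm_square B K by (simp add: algebra_simps)
    also have "\<dots> = complex_of_real (\<kappa> * N * Z)"
      unfolding P Q Q' Nc of_real_mult ZZ by (simp add: algebra_simps)
    finally show ?thesis by (simp only: of_real_eq_iff)
  qed
  have num: "?B$1$1 * cnj (?B$2$1) + ?B$1$2 * cnj (?B$2$2) =
      complex_of_real (\<kappa> * N) * ((p * z - 1) * cnj (z + cnj p) + p * complex_of_real (t\<^sup>2))"
  proof -
    have "?B$1$1 * cnj (?B$2$1) + ?B$1$2 * cnj (?B$2$2) =
        complex_of_real \<kappa> * (p * (a * cnj a + b * cnj b) + p * p * (a * cnj c + b * cnj d)
          - (cnj a * c + cnj b * d) - p * (c * cnj c + d * cnj d))"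
      unfolding B K by (simp add: algebra_simps)
    also have "\<dots> = complex_of_real (\<kappa> * N) * ((p * z - 1) * cnj (z + cnj p) + p * complex_of_real (t\<^sup>2))"
      unfolding P Q Q' Nc of_real_mult by (simp add: algebra_simps)
    finally show ?thesis .
  qed
  have dB: "det ?B \<noteq> 0" using \<kappa> assms(1) by (simp add: detB)
  have "cmod (det ?B) / (\<kappa> * N * Z) = \<kappa> * t / Z"
    using \<kappa> N by (simp add: detB norm_mult zt(2))
  moreover have "complex_of_real (\<kappa> * N) * X / complex_of_real (\<kappa> * N * Z) = X / complex_of_real Z" for X
    using \<kappa> N by simp
  ultimately show ?thesis
    unfolding hyp_action_psl_class[OF dB] NB num by (simp only: \<kappa>_def Z_def)
qed

lemma limit_set_sequenceI:
  assumes g: "\<And>n. g n \<in> \<Gamma>" and pos: "\<And>n. 0 \<le> snd (hyp_action (g n) (0, 1))"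
    and lim: "(\<lambda>n. hyp_action (g n) (0, 1)) \<longlonglongrightarrow> (x, 0)"
  shows "Some x \<in> limit_set \<Gamma>"
proof -
  let ?H = "{p :: complex \<times> real. snd p \<ge> 0}" and ?h = "\<lambda>n. hyp_action (g n) (0, 1)"
  have "Some (x, 0) \<in> closed_hyperbolic_space closure_of ((\<lambda>g. Some (hyp_action g (0, 1))) ` \<Gamma>)"
    unfolding in_closure_of
  proof (intro conjI allI impI)
    show "Some (x, 0) \<in> topspace closed_hyperbolic_space"
      by (simp add: closed_hyperbolic_space_def)
    fix T assume T: "Some (x, 0) \<in> T \<and> openin closed_hyperbolic_space T"
    have "openin (top_of_set ?H) {q \<in> topspace (top_of_set ?H). Some q \<in> T}"
      using T unfolding closed_hyperbolic_space_def
      by (intro openin_continuous_map_preimage[OF continuous_map_Some]) blast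
    then obtain V where oV: "open V \<and> {q \<in> topspace (top_of_set ?H). Some q \<in> T} = ?H \<inter> V"
      unfolding openin_open by (rule exE)
    then have V: "open V" by (rule conjunct1)
    have TV: "Some q \<in> T \<longleftrightarrow> q \<in> V" if "0 \<le> snd q" for q
    proof -
      have "q \<in> {q \<in> topspace (top_of_set ?H). Some q \<in> T} \<longleftrightarrow> q \<in> ?H \<inter> V"
        using oV by (rule arg_cong[OF conjunct2])
      then show ?thesis using that by simp
    qed
    have "(x, 0) \<in> V" using TV[of "(x, 0)"] T by simp
    then have "\<forall>\<^sub>F n in sequentially. ?h n \<in> V" by (rule topological_tendstoD[OF lim V])
    then obtain n where "?h n \<in> V" by (auto simp: eventually_sequentially)
    then have "Some (?h n) \<in> T" using TV[OF pos[of n]] by blast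
    then show "\<exists>y. y \<in> (\<lambda>g. Some (hyp_action g (0, 1))) ` \<Gamma> \<and> y \<in> T" using g by blast
  qed
  then show ?thesis by (simp add: limit_set_def boundary_point_def)
qed

context pingpong
begin

lemma limit_point_in: 
  assumes "\<omega> \<in> infinite_words" shows "limit_point \<omega> \<in> E (\<omega> 0)"
proof -
  have "closed (E (\<omega> 0))" by (rule compact_imp_closed[OF compact_E])
  moreover have "\<forall>\<^sub>F n in sequentially. centre (word_mat M (initial \<omega> n)) \<in> E (\<omega> 0)"
    using eventually_gt_at_top[of 0]
  proof eventually_elim
    case (elim n)
    then show ?case using centre_in[OF reduced_initial[OF assms], of n] by (simp add: hd_initial)
  qed
  ultimately show ?thesis using limit_point[OF assms] by (metis Lim_in_closed_set trivial_limit_sequentially)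
qed

text \<open>Orbit points of the unrotated group converge to the inverse rotation of the limit point.
  The excluded value - cnj p is the image of infinity under the rotation, so there the unrotated
  limit would be infinity.\<close>

lemma unrotated_limit_point:
  assumes L: "\<And>i. det (L i) \<noteq> 0" and M: "M = (\<lambda>i. rotation p ** L i ** adj2 (rotation p))"
    and w: "\<omega> \<in> infinite_words"
    and ne: "limit_point \<omega> + cnj p \<noteq> 0"
  shows "Some ((p * limit_point \<omega> - 1) / (limit_point \<omega> + cnj p)) \<in>
    limit_set (generate PSL2C (range (\<lambda>i. psl_class (L i))))"
proof -
  let ?\<rho> = "rotation p" and ?\<pi> = "limit_point \<omega>"
  define A where "A n = word_mat M (initial \<omega> (Suc n))" for n
  define h where "h n = hyp_action (psl_class (A n)) (0, 1)" for n
  define g where "g n = psl_class (word_mat L (initial \<omega> (Suc n)))" for n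
  have detA: "det (A n) \<noteq> 0" for n by (simp add: A_def)
  have A21: "A n $ 2 $ 1 \<noteq> 0" for n unfolding A_def using reduced_initial[OF w] by (intro word_21) auto
  have g: "g n = psl_class (adj2 ?\<rho> ** A n ** ?\<rho>)" for n
  proof -
    obtain c where c: "c \<noteq> 0" "A n = scale2 c (?\<rho> ** word_mat L (initial \<omega> (Suc n)) ** adj2 ?\<rho>)"
      using word_mat_conj[OF det_rotation_nonzero, of p L "initial \<omega> (Suc n)"] unfolding A_def M by blast
    have "adj2 ?\<rho> ** A n ** ?\<rho> = scale2 c ((adj2 ?\<rho> ** ?\<rho>) ** word_mat L (initial \<omega> (Suc n)) ** (adj2 ?\<rho> ** ?\<rho>))"
      unfolding c(2) scale2_mult by (simp only: matrix_mul_assoc)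
    also have "\<dots> = scale2 (c * det ?\<rho> * det ?\<rho>) (word_mat L (initial \<omega> (Suc n)))"
      by (simp add: matrix_mul_lid matrix_mul_rid mult.assoc)
    finally show ?thesis using c(1) by (simp add: g_def)
  qed
  have "(\<lambda>n. csize (A n)) \<longlonglongrightarrow> 0"
    unfolding A_def using csize_initial_tendsto[OF w] by (rule LIMSEQ_Suc)
  moreover have "(\<lambda>n. centre (A n)) \<longlonglongrightarrow> ?\<pi>"
    unfolding A_def using limit_point[OF w] by (rule LIMSEQ_Suc)
  moreover note near = hyp_action_centre[OF detA A21, folded h_def]
  ultimately have fst_lim: "(\<lambda>n. fst (h n)) \<longlonglongrightarrow> ?\<pi>" and snd_lim: "(\<lambda>n. snd (h n)) \<longlonglongrightarrow> 0"
  proof -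
    assume c0: "(\<lambda>n. csize (A n)) \<longlonglongrightarrow> 0" and cc: "(\<lambda>n. centre (A n)) \<longlonglongrightarrow> ?\<pi>"
    have "(\<lambda>n. fst (h n) - centre (A n)) \<longlonglongrightarrow> 0"
      by (rule Lim_null_comparison[OF _ c0]) (simp add: near)
    from tendsto_add[OF this cc] show "(\<lambda>n. fst (h n)) \<longlonglongrightarrow> ?\<pi>" by simp
    show "(\<lambda>n. snd (h n)) \<longlonglongrightarrow> 0"
      by (rule Lim_null_comparison[OF _ c0]) (simp add: near less_imp_le)
  qed
  define Z where "Z n = (cmod (fst (h n) + cnj p))\<^sup>2 + (snd (h n))\<^sup>2" for n
  have Z: "Z \<longlonglongrightarrow> (cmod (?\<pi> + cnj p))\<^sup>2 + 0\<^sup>2"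
    unfolding Z_def by (intro tendsto_intros fst_lim snd_lim)
  have Z0: "(cmod (?\<pi> + cnj p))\<^sup>2 + 0\<^sup>2 \<noteq> 0" using ne by simp
  have hg: "hyp_action (g n) (0, 1) =
      (((p * fst (h n) - 1) * cnj (fst (h n) + cnj p) + p * complex_of_real ((snd (h n))\<^sup>2)) / complex_of_real (Z n),
       ((cmod p)\<^sup>2 + 1) * snd (h n) / Z n)" for n
    unfolding g Z_def by (rule hyp_action_unrotate[OF detA]) (simp add: h_def)
  have "(\<lambda>n. hyp_action (g n) (0, 1)) \<longlonglongrightarrow>
      (((p * ?\<pi> - 1) * cnj (?\<pi> + cnj p) + p * complex_of_real (0\<^sup>2)) / complex_of_real ((cmod (?\<pi> + cnj p))\<^sup>2 + 0\<^sup>2),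
       ((cmod p)\<^sup>2 + 1) * 0 / ((cmod (?\<pi> + cnj p))\<^sup>2 + 0\<^sup>2))"
    unfolding hg using Z0 by (intro tendsto_intros fst_lim snd_lim Z) (simp_all only: of_real_eq_0_iff not_False_eq_True)
  moreover have "((p * ?\<pi> - 1) * cnj (?\<pi> + cnj p) + p * complex_of_real (0\<^sup>2)) / complex_of_real ((cmod (?\<pi> + cnj p))\<^sup>2 + 0\<^sup>2)
      = (p * ?\<pi> - 1) / (?\<pi> + cnj p)"
  proof -
    have "complex_of_real ((cmod (?\<pi> + cnj p))\<^sup>2 + 0\<^sup>2) = (?\<pi> + cnj p) * cnj (?\<pi> + cnj p)"
      using complex_norm_square[of "?\<pi> + cnj p"] by simp
    then show ?thesis using ne complex_cnj_zero_iff[of "?\<pi> + cnj p"] by (simp del: complex_cnj_add complex_cnj_zero_iff)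
  qed
  ultimately have lim: "(\<lambda>n. hyp_action (g n) (0, 1)) \<longlonglongrightarrow> ((p * ?\<pi> - 1) / (?\<pi> + cnj p), 0)"
    by simp
  show ?thesis
  proof (rule limit_set_sequenceI[OF _ _ lim])
    show "g n \<in> generate PSL2C (range (\<lambda>i. psl_class (L i)))" for n
      using generate_eq_words[of L UNIV, OF L] by (auto simp: g_def)
    show "0 \<le> snd (hyp_action (g n) (0, 1))" for n
      unfolding g_def using orbit_height_pos[OF det_word_mat[OF L]] by (rule less_imp_le)
  qed
qed

end

text \<open>The inverse rotation is a chordal isometry, because |p z - 1|^2 + |z + cnj p|^2 = (|p|^2
  + 1) (1 + |z|^2).\<close>

lemma chordal_dist_unrotate:
  assumes "z + cnj p \<noteq> 0" "z' + cnj p \<noteq> 0"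
  shows "dist (to_unit_sphere (Some ((p * z - 1) / (z + cnj p)))) (to_unit_sphere (Some ((p * z' - 1) / (z' + cnj p)))) =
    dist (to_unit_sphere (Some z)) (to_unit_sphere (Some z'))"
proof -
  define \<kappa> where "\<kappa> = (cmod p)\<^sup>2 + 1"
  have \<kappa>: "\<kappa> > 0" by (simp add: \<kappa>_def add_nonneg_pos)
  have K: "complex_of_real \<kappa> = p * cnj p + 1" using complex_norm_square[of p] by (simp add: \<kappa>_def)
  have sq: "sqrt (1 + (cmod ((p * x - 1) / (x + cnj p)))\<^sup>2) = sqrt \<kappa> * sqrt (1 + (cmod x)\<^sup>2) / cmod (x + cnj p)"
    if "x + cnj p \<noteq> 0" for x
  proof -
    have "complex_of_real ((cmod (p * x - 1))\<^sup>2 + (cmod (x + cnj p))\<^sup>2) = complex_of_real (\<kappa> * (1 + (cmod x)\<^sup>2))"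
      unfolding of_real_add of_real_mult complex_norm_square K by (simp add: algebra_simps)
    then have e: "(cmod (p * x - 1))\<^sup>2 + (cmod (x + cnj p))\<^sup>2 = \<kappa> * (1 + (cmod x)\<^sup>2)"
      by (simp only: of_real_eq_iff)
    have "1 + (cmod ((p * x - 1) / (x + cnj p)))\<^sup>2 = \<kappa> * (1 + (cmod x)\<^sup>2) / (cmod (x + cnj p))\<^sup>2"
      unfolding e[symmetric] using that by (simp add: norm_divide power_divide field_simps)
    then show ?thesis by (simp add: real_sqrt_divide real_sqrt_mult)
  qed
  have "(p * z - 1) / (z + cnj p) - (p * z' - 1) / (z' + cnj p) =
      complex_of_real \<kappa> * (z - z') / ((z + cnj p) * (z' + cnj p))"
    using assms by (simp add: K diff_frac_eq) (simp add: algebra_simps)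
  then have d: "cmod ((p * z - 1) / (z + cnj p) - (p * z' - 1) / (z' + cnj p)) =
      \<kappa> * cmod (z - z') / (cmod (z + cnj p) * cmod (z' + cnj p))"
    using \<kappa> by (simp add: norm_divide norm_mult)
  have key: "2 * (\<kappa> * X / (u * v)) / ((sqrt \<kappa> * s / u) * (sqrt \<kappa> * s' / v)) = 2 * X / (s * s')"
    if "u \<noteq> 0" "v \<noteq> 0" for X u v s s' :: real
  proof -
    have prod: "(sqrt \<kappa> * s / u) * (sqrt \<kappa> * s' / v) = \<kappa> * (s * s') / (u * v)"
      using \<kappa> by (simp add: algebra_simps)
    show ?thesis unfolding prod using that \<kappa> by simp
  qed
  show ?thesis unfolding chordal_dist d sq[OF assms(1)] sq[OF assms(2)]
    by (rule key) (use assms in auto)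
qed

lemma chordal_dist_lower:
  assumes "cmod z \<le> B" "cmod z' \<le> B"
  shows "cmod (z - z') \<le> (1 + B\<^sup>2) / 2 * dist (to_unit_sphere (Some z)) (to_unit_sphere (Some z'))"
proof -
  have B: "0 \<le> B" using assms(1) norm_ge_zero order_trans by blast
  let ?s = "\<lambda>z. sqrt (1 + (cmod z)\<^sup>2)"
  have s: "0 < ?s x" for x by (simp add: add_pos_nonneg)
  have "?s z * ?s z' \<le> sqrt (1 + B\<^sup>2) * sqrt (1 + B\<^sup>2)"
    using assms B by (intro mult_mono) (auto intro: power_mono)
  then have "?s z * ?s z' \<le> 1 + B\<^sup>2" by (simp add: add_nonneg_nonneg)
  then have "cmod (z - z') * (?s z * ?s z') \<le> cmod (z - z') * (1 + B\<^sup>2)"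
    by (intro mult_left_mono) auto
  then have "cmod (z - z') \<le> (1 + B\<^sup>2) * cmod (z - z') / (?s z * ?s z')"
    using s[of z] s[of z'] by (simp add: pos_le_divide_eq mult_ac)
  then show ?thesis unfolding chordal_dist by simp
qed


section \<open>Small dimension yields a small cut set\<close>

context pingpong
begin

text \<open>A chordal cover of the original limit set is compared, through the isometric inverse
  rotation, with the limit points of the normalised tuple. These lie in a bounded set, where
  Euclidean distance is at most c times the chordal one.\<close>

lemma small_cut_of_dimension:
  assumes L: "\<And>i. det (L i) \<noteq> 0" and M: "M = (\<lambda>i. rotation p ** L i ** adj2 (rotation p))"
    and dim: "limit_set_dimension (generate PSL2C (range (\<lambda>i. psl_class (L i)))) < ennreal lam"
  shows "\<exists>s W N. 0 < s \<and> s < lam \<and> complete_cut W N \<and>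
    (\<Sum>w\<in>W. (csize (word_mat M w) / \<delta>\<^sup>2) powr s) < 1"
proof -
  let ?\<Lambda> = "to_unit_sphere ` limit_set (generate PSL2C (range (\<lambda>i. psl_class (L i))))"
  obtain s where s: "0 < s" "ennreal s < ennreal lam" "hausdorff_measure s ?\<Lambda> = 0"
    using dim unfolding limit_set_dimension_def hausdorff_dimension_def Inf_less_iff by blast
  have "s < lam" using s(1,2) by (simp add: ennreal_less_iff)
  have "bounded (\<Union>a. E a)" using compact_imp_bounded[OF compact_E] by (intro bounded_UN) auto
  then obtain B where B: "0 < B" "\<And>a z. z \<in> E a \<Longrightarrow> cmod z \<le> B" by (auto simp: bounded_pos)
  define c where "c = (1 + B\<^sup>2) / 2"
  have c: "0 < c" by (simp add: c_def add_pos_nonneg)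
  \<comment> \<open>T is the bound to be met by the sum of the sizes. A cover of sum below T / (2 q)
    contributes less than T / 2 once multiplied by q, and the slack of
    \<open>exists_small_cut\<close> is the other T / 2.\<close>
  define T where "T = \<delta>\<^sup>2 powr s"
  have T: "0 < T" using delta_pos by (simp add: T_def)
  define q where "q = (R\<^sup>2 / \<delta>) powr s * c powr s"
  have q: "0 < q" using c R_pos delta_pos by (simp add: q_def)
  \<comment> \<open>Chosen so that c \<eta> = \<delta> / 2: words sharing a covering set must then
    share their first letter.\<close>
  define \<eta> where "\<eta> = \<delta> / (2 * c)"
  have \<eta>: "0 < \<eta>" using c delta_pos by (simp add: \<eta>_def)
  have "0 < T / (2 * q)" using T q by simp
  from hausdorff_measure_eq_0D[OF s(3) \<eta> this] obtain U :: "nat \<Rightarrow> (complex \<times> real) set" where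
    U: "?\<Lambda> \<subseteq> (\<Union>i. U i)" "\<And>i. bounded (U i)" "\<And>i. diameter (U i) \<le> \<eta>"
      "summable (\<lambda>i. diameter (U i) powr s)" "(\<Sum>i. diameter (U i) powr s) < T / (2 * q)" by blast
  define x where "x \<omega> = (p * limit_point \<omega> - 1) / (limit_point \<omega> + cnj p)" for \<omega>
  \<comment> \<open>Index 0 takes the words whose unrotated limit point would be infinity. They all
    have the limit point - cnj p, so they are covered at cost 0.\<close>
  define \<Omega> where "\<Omega> j = (case j of 0 \<Rightarrow> {\<omega> \<in> infinite_words. limit_point \<omega> + cnj p = 0}
    | Suc i \<Rightarrow> {\<omega> \<in> infinite_words. limit_point \<omega> + cnj p \<noteq> 0 \<and> to_unit_sphere (Some (x \<omega>)) \<in> U i})" for j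
  define d where "d j = (case j of 0 \<Rightarrow> 0 | Suc i \<Rightarrow> c * diameter (U i))" for j
  have dS: "d 0 = 0" "d (Suc i) = c * diameter (U i)" for i by (simp_all add: d_def)
  have dsum: "(\<lambda>j. d (Suc j) powr s) = (\<lambda>j. c powr s * diameter (U j) powr s)"
    unfolding dS powr_mult ..
  have summ: "summable (\<lambda>j. d j powr s)"
    using U(4) summable_Suc_iff[of "\<lambda>j. d j powr s"] unfolding dsum by (simp add: summable_mult)
  have sum_eq: "(\<Sum>j. d j powr s) = c powr s * (\<Sum>i. diameter (U i) powr s)"
  proof -
    have "(\<Sum>j. d (Suc j) powr s) = (\<Sum>j. d j powr s) - d 0 powr s"
      by (rule suminf_split_head[OF summ])
    then have "(\<Sum>j. d j powr s) = (\<Sum>j. d (Suc j) powr s)" using s(1) by (simp add: dS)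
    also have "\<dots> = c powr s * (\<Sum>i. diameter (U i) powr s)"
      unfolding dsum by (rule suminf_mult[OF U(4)])
    finally show ?thesis .
  qed
  have "\<exists>W N. complete_cut W N \<and>
      (\<Sum>w\<in>W. csize (word_mat M w) powr s) \<le> (R\<^sup>2 / \<delta>) powr s * (\<Sum>j. d j powr s) + T / 2"
  proof (rule exists_small_cut[OF s(1)])
    show "infinite_words \<subseteq> (\<Union>j. \<Omega> j)"
    proof
      fix \<omega> :: "nat \<Rightarrow> 'i letter" assume w: "\<omega> \<in> infinite_words"
      show "\<omega> \<in> (\<Union>j. \<Omega> j)"
      proof (cases "limit_point \<omega> + cnj p = 0")
        case True
        then have "\<omega> \<in> \<Omega> 0" using w by (simp add: \<Omega>_def)
        then show ?thesis by blast
      next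
        case False
        then have "to_unit_sphere (Some (x \<omega>)) \<in> ?\<Lambda>"
          unfolding x_def using unrotated_limit_point[OF L M w] by blast
        then obtain i where "to_unit_sphere (Some (x \<omega>)) \<in> U i" using U(1) by blast
        then have "\<omega> \<in> \<Omega> (Suc i)" using w False by (simp add: \<Omega>_def)
        then show ?thesis by blast
      qed
    qed
    show "\<Omega> j \<subseteq> infinite_words" for j by (auto simp: \<Omega>_def split: nat.splits)
    show "0 \<le> d j" for j using c diameter_ge_0[OF U(2)] by (auto simp: d_def split: nat.splits)
    show "d j < \<delta>" for j
    proof (cases j)
      case (Suc i)
      have "c * diameter (U i) \<le> c * \<eta>" using U(3) c by (intro mult_left_mono) auto
      also have "\<dots> < \<delta>" using c delta_pos by (simp add: \<eta>_def)
      finally show ?thesis using Suc by (simp add: dS)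
    qed (use delta_pos in \<open>simp add: dS\<close>)
    show "cmod (limit_point \<omega> - limit_point \<omega>') \<le> d j" if w: "\<omega> \<in> \<Omega> j" "\<omega>' \<in> \<Omega> j" for j \<omega> \<omega>'
    proof (cases j)
      case 0
      then have "limit_point \<omega> = limit_point \<omega>'" using w by (simp add: \<Omega>_def add_eq_0_iff2)
      then show ?thesis using 0 by (simp add: dS)
    next
      case (Suc i)
      then have w': "\<omega> \<in> infinite_words" "\<omega>' \<in> infinite_words"
        "limit_point \<omega> + cnj p \<noteq> 0" "limit_point \<omega>' + cnj p \<noteq> 0"
        "to_unit_sphere (Some (x \<omega>)) \<in> U i" "to_unit_sphere (Some (x \<omega>')) \<in> U i"
        using w by (auto simp: \<Omega>_def)
      have "cmod (limit_point \<omega> - limit_point \<omega>') \<le>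
          c * dist (to_unit_sphere (Some (limit_point \<omega>))) (to_unit_sphere (Some (limit_point \<omega>')))"
        unfolding c_def by (intro chordal_dist_lower B(2)[OF limit_point_in] w')
      also have "\<dots> = c * dist (to_unit_sphere (Some (x \<omega>))) (to_unit_sphere (Some (x \<omega>')))"
        unfolding x_def chordal_dist_unrotate[OF w'(3,4)] ..
      also have "\<dots> \<le> c * diameter (U i)"
        using diameter_bounded_bound[OF U(2) w'(5,6)] c by (intro mult_left_mono) auto
      finally show ?thesis using Suc by (simp add: dS)
    qed
    show "summable (\<lambda>j. d j powr s)" by (rule summ)
    show "0 < T / 2" using T by simp
  qed
  then obtain W N where W: "complete_cut W N"
    "(\<Sum>w\<in>W. csize (word_mat M w) powr s) \<le> (R\<^sup>2 / \<delta>) powr s * (\<Sum>j. d j powr s) + T / 2" by blast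
  have "(R\<^sup>2 / \<delta>) powr s * (\<Sum>j. d j powr s) = q * (\<Sum>i. diameter (U i) powr s)"
    by (simp add: sum_eq q_def mult.assoc)
  also have "\<dots> < q * (T / (2 * q))" using U(5) q by (intro mult_strict_left_mono)
  also have "\<dots> = T / 2" using q by simp
  finally have lt: "(\<Sum>w\<in>W. csize (word_mat M w) powr s) < T" using W(2) by linarith
  have "(\<Sum>w\<in>W. (csize (word_mat M w) / \<delta>\<^sup>2) powr s) = (\<Sum>w\<in>W. csize (word_mat M w) powr s) / T"
    unfolding sum_divide_distrib T_def by (intro sum.cong refl powr_divide)
  also have "\<dots> < 1" using lt T by simp
  finally show ?thesis using s(1) \<open>s < lam\<close> W(1) by blast
qed

end

text \<open>The certificate is a sum over finitely many words, continuous in the tuple because the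
  lower left entries of nonempty reduced words do not vanish. As \<delta> is common to all nearby
  tuples, the same cut bounds their dimension by the same s < lam.\<close>

lemma dimension_stable:
  fixes M :: "'i::finite \<Rightarrow> complex^2^2" and N :: "'x \<Rightarrow> 'i \<Rightarrow> complex^2^2"
  assumes pp: "pingpong E \<delta> R M" "\<forall>\<^sub>F x in F. pingpong E \<delta> R (N x)"
    and N: "\<And>i. ((\<lambda>x. N x i) \<longlongrightarrow> M i) F"
    and L: "\<And>i. det (L i) \<noteq> 0" and M: "M = (\<lambda>i. rotation p ** L i ** adj2 (rotation p))"
    and dim: "limit_set_dimension (generate PSL2C (range (\<lambda>i. psl_class (L i)))) < ennreal lam"
  shows "\<forall>\<^sub>F x in F. limit_set_dimension (generate PSL2C (range (\<lambda>i. psl_class (N x i)))) < ennreal lam"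
proof -
  interpret P: pingpong E \<delta> R M by (rule pp(1))
  obtain s W n where s: "0 < s" "s < lam" and W: "complete_cut W n"
    "(\<Sum>w\<in>W. (csize (word_mat M w) / \<delta>\<^sup>2) powr s) < 1"
    using P.small_cut_of_dimension[OF L M dim] by blast
  have red: "reduced w" "w \<noteq> []" if "w \<in> W" for w using W(1) that by (auto simp: complete_cut_def)
  have "((\<lambda>x. \<Sum>w\<in>W. (csize (word_mat (N x) w) / \<delta>\<^sup>2) powr s) \<longlongrightarrow>
      (\<Sum>w\<in>W. (csize (word_mat M w) / \<delta>\<^sup>2) powr s)) F"
  proof (intro tendsto_sum tendsto_powr tendsto_divide tendsto_const)
    fix w assume w: "w \<in> W"
    have t: "((\<lambda>x. word_mat (N x) w) \<longlongrightarrow> word_mat M w) F" by (rule tendsto_word_mat[OF N])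
    show "((\<lambda>x. csize (word_mat (N x) w)) \<longlongrightarrow> csize (word_mat M w)) F"
      unfolding csize_def using P.word_21[OF red[OF w]] by (intro tendsto_intros t) simp
    show "csize (word_mat M w) / \<delta>\<^sup>2 \<noteq> 0"
      using P.csize_word_pos[OF red[OF w]] P.delta_pos by simp
  qed (use P.delta_pos in simp)
  then have "\<forall>\<^sub>F x in F. (\<Sum>w\<in>W. (csize (word_mat (N x) w) / \<delta>\<^sup>2) powr s) < 1"
    using W(2) by (rule order_tendstoD)
  with pp(2) show ?thesis
  proof eventually_elim
    case (elim x)
    then interpret Q: pingpong E \<delta> R "N x" by simp
    have "limit_set_dimension (generate PSL2C (range (\<lambda>i. psl_class (N x i)))) \<le> ennreal s"
      by (rule Q.limit_set_dimension_le[OF s(1) W(1) elim(2)])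
    also have "\<dots> < ennreal lam" using s by (simp add: ennreal_less_iff)
    finally show ?case .
  qed
qed


section \<open>Algebra of Schottky generators, and persistence of classical groups\<close>

section \<open>Loxodromic generators and freeness\<close>

text \<open>The eigenvalues x and y have different moduli; expressed through trace and determinant
  this is easily followed under conjugation and scaling.\<close>

definition loxodromic :: "complex^2^2 \<Rightarrow> bool" where
  "loxodromic A \<longleftrightarrow> (\<exists>x y. cmod y < cmod x \<and> A$1$1 + A$2$2 = x + y \<and> det A = x * y)"

text \<open>A common fixed point on the sphere, infinity included.\<close>

definition common_eigenvector :: "complex^2^2 \<Rightarrow> complex^2^2 \<Rightarrow> bool" where
  "common_eigenvector A B \<longleftrightarrow> (\<exists>v \<mu> \<nu>. v \<noteq> 0 \<and> A *v v = \<mu> *s v \<and> B *v v = \<nu> *s v)"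

definition conj_tuple :: "complex^2^2 \<Rightarrow> ('i \<Rightarrow> complex^2^2) \<Rightarrow> 'i \<Rightarrow> complex^2^2" where
  "conj_tuple B M = (\<lambda>i. B ** M i ** adj2 B)"

lemma det_conj_tuple [simp]: "det (conj_tuple B M i) = (det B)\<^sup>2 * det (M i)"
  by (simp add: conj_tuple_def det_mul power2_eq_square)

lemma adj2_conj_mult:
  "adj2 B ** (B ** A ** adj2 B) ** B = scale2 ((det B)\<^sup>2) A" (is ?a)
  "B ** (adj2 B ** A ** B) ** adj2 B = scale2 ((det B)\<^sup>2) A" (is ?b)
proof -
  have "adj2 B ** (B ** A ** adj2 B) ** B = (adj2 B ** B) ** A ** (adj2 B ** B)"
    by (simp only: matrix_mul_assoc)
  then show ?a by (simp add: matrix_mul_lid matrix_mul_rid power2_eq_square)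
  have "B ** (adj2 B ** A ** B) ** adj2 B = (B ** adj2 B) ** A ** (B ** adj2 B)"
    by (simp only: matrix_mul_assoc)
  then show ?b by (simp add: matrix_mul_lid matrix_mul_rid power2_eq_square)
qed

lemma trace_conj: "(B ** A ** adj2 B)$1$1 + (B ** A ** adj2 B)$2$2 = det B * (A$1$1 + A$2$2)"
  by (simp add: det_2 algebra_simps)

lemma loxodromic_conj:
  assumes "det B \<noteq> 0" "loxodromic (B ** A ** adj2 B)" shows "loxodromic A"
proof -
  obtain x y where xy: "cmod y < cmod x" "det B * (A$1$1 + A$2$2) = x + y" "(det B)\<^sup>2 * det A = x * y"
    using assms(2) unfolding loxodromic_def trace_conj by (auto simp: det_mul power2_eq_square mult_ac)
  have "A$1$1 + A$2$2 = x / det B + y / det B" "det A = (x / det B) * (y / det B)"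
    using xy(2,3) assms(1) by (simp_all add: field_simps power2_eq_square)
  moreover have "cmod (y / det B) < cmod (x / det B)"
    using xy(1) assms(1) by (simp add: norm_divide divide_strict_right_mono)
  ultimately show ?thesis unfolding loxodromic_def by blast
qed

lemma common_eigenvector_conj:
  assumes "det B \<noteq> 0" "common_eigenvector A C"
  shows "common_eigenvector (B ** A ** adj2 B) (B ** C ** adj2 B)"
proof -
  obtain v \<mu> \<nu> where v: "v \<noteq> 0" "A *v v = \<mu> *s v" "C *v v = \<nu> *s v"
    using assms(2) unfolding common_eigenvector_def by blast
  have "(B ** X ** adj2 B) *v (B *v v) = (det B * \<mu>) *s (B *v v)" if "X *v v = \<mu> *s v" for X \<mu>
  proof -
    have "(B ** X ** adj2 B) *v (B *v v) = (B ** X ** (adj2 B ** B)) *v v"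
      by (simp only: matrix_vector_mul_assoc matrix_mul_assoc)
    also have "\<dots> = det B *s (B *v (X *v v))"
      by (simp add: matrix_mul_rid vec2_eq_iff algebra_simps)
    also have "\<dots> = (det B * \<mu>) *s (B *v v)"
      unfolding that by (simp add: vec2_eq_iff algebra_simps)
    finally show ?thesis .
  qed
  moreover have "B *v v \<noteq> 0" using multv2_eq_0[OF assms(1)] v(1) by blast
  ultimately show ?thesis unfolding common_eigenvector_def using v by blast
qed

lemma eigenvalues_exist:
  fixes t d :: complex
  obtains x y where "t = x + y" "d = x * y" "cmod y \<le> cmod x"
proof -
  define r where "r = csqrt (t\<^sup>2 - 4 * d)"
  define a b where "a = (t + r) / 2" and "b = (t - r) / 2"
  have r: "r\<^sup>2 = t\<^sup>2 - 4 * d" by (simp add: r_def)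
  have "t = a + b" by (simp add: a_def b_def field_simps)
  moreover have "d = a * b"
  proof -
    have "4 * (a * b) = t\<^sup>2 - r\<^sup>2" by (simp add: a_def b_def field_simps power2_eq_square)
    then show ?thesis unfolding r by simp
  qed
  ultimately show ?thesis using that[of a b] that[of b a] by (cases "cmod b \<le> cmod a") (auto simp: algebra_simps)
qed

lemma trace_power_word:
  assumes "M i $ 1 $ 1 + M i $ 2 $ 2 = x + y" "det (M i) = x * y"
  defines "W \<equiv> \<lambda>n. word_mat M (replicate n (i, True))"
  shows "W n $ 1 $ 1 + W n $ 2 $ 2 = x ^ n + y ^ n" "det (W n) = (x * y) ^ n"
proof -
  let ?A = "M i"
  have W: "W 0 = mat 1" "W (Suc n) = ?A ** W n" for n by (simp_all add: W_def letter_mat_def)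
  \<comment> \<open>Cayley-Hamilton for \<open>M i\<close>; the traces of the powers obey the
    recursion of x^n + y^n.\<close>
  have rec: "W (Suc (Suc n)) $ a $ b = (x + y) * W (Suc n) $ a $ b - (x * y) * W n $ a $ b" for n a b
    unfolding assms(1,2)[symmetric] W(2) det_2
    using exhaust_2[of a] exhaust_2[of b] by (elim disjE) (simp_all add: algebra_simps)
  have "W n $ 1 $ 1 + W n $ 2 $ 2 = x ^ n + y ^ n \<and> W (Suc n) $ 1 $ 1 + W (Suc n) $ 2 $ 2 = x ^ Suc n + y ^ Suc n"
  proof (induction n)
    case 0
    show ?case using assms(1) by (simp add: W)
  next
    case (Suc n)
    have "W (Suc (Suc n)) $ 1 $ 1 + W (Suc (Suc n)) $ 2 $ 2 =
        (x + y) * (W (Suc n) $ 1 $ 1 + W (Suc n) $ 2 $ 2) - (x * y) * (W n $ 1 $ 1 + W n $ 2 $ 2)"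
      unfolding rec by (simp add: algebra_simps)
    also have "\<dots> = x ^ Suc (Suc n) + y ^ Suc (Suc n)"
      using Suc by (simp add: algebra_simps)
    finally show ?case using Suc by simp
  qed
  then show "W n $ 1 $ 1 + W n $ 2 $ 2 = x ^ n + y ^ n" by blast
  show "det (W n) = (x * y) ^ n" by (induction n) (simp_all add: W det_mul assms(2))
qed

context pingpong
begin

text \<open>Were the eigenvalues of equal modulus, the traces of the normalised powers would be bounded;
  but the trace is \<open>c\<close> times the difference of centre and pole, hence comparable to \<open>c\<close>.\<close>

lemma generator_loxodromic: "loxodromic (M i)"
proof (rule ccontr)
  assume nl: "\<not> loxodromic (M i)"
  obtain x y where xy: "M i $ 1 $ 1 + M i $ 2 $ 2 = x + y" "det (M i) = x * y" "cmod y \<le> cmod x"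
    using eigenvalues_exist by blast
  have eq: "cmod y = cmod x" using nl xy unfolding loxodromic_def by force
  have x0: "cmod x \<noteq> 0" using xy(2) invertible[of i] by auto
  define \<omega> :: "nat \<Rightarrow> 'i letter" where "\<omega> = (\<lambda>_. (i, True))"
  have w: "\<omega> \<in> infinite_words" by (simp add: \<omega>_def infinite_words_def)
  have i: "initial \<omega> n = replicate n (i, True)" for n
    unfolding initial_def \<omega>_def by (simp add: map_replicate_const)
  have low: "\<delta>\<^sup>2 / 4 \<le> csize (word_mat M (initial \<omega> n))" if n: "0 < n" for n
  proof -
    let ?A = "word_mat M (initial \<omega> n)"
    have r: "reduced (initial \<omega> n)" "initial \<omega> n \<noteq> []" using reduced_initial[OF w] n by auto
    have last: "last (initial \<omega> n) = (i, True)" using n by (simp add: i)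
    have c: "?A$2$1 \<noteq> 0" by (rule word_21[OF r])
    have "\<delta> \<le> cmod (centre ?A - pole ?A)"
      using pole_distance(1)[OF r centre_in[OF r]] n hd_initial[OF n, of \<omega>] last
      by (simp add: \<omega>_def flip_def)
    also have "centre ?A - pole ?A = (?A$1$1 + ?A$2$2) / ?A$2$1"
      by (simp add: centre_def pole_def add_divide_distrib)
    also have "?A$1$1 + ?A$2$2 = x ^ n + y ^ n"
      unfolding i by (rule trace_power_word(1)[of M i x y, OF xy(1,2)])
    finally have "\<delta> * cmod (?A$2$1) \<le> cmod (x ^ n + y ^ n)"
      using c by (simp add: norm_divide pos_le_divide_eq)
    also have "\<dots> \<le> 2 * cmod x ^ n"
      using norm_triangle_ineq[of "x ^ n" "y ^ n"] eq by (simp add: norm_power)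
    finally have "(\<delta> * cmod (?A$2$1))\<^sup>2 \<le> (2 * cmod x ^ n)\<^sup>2"
      using delta_pos by (intro power_mono) auto
    moreover have "cmod (det ?A) = (cmod x ^ n)\<^sup>2"
      unfolding i trace_power_word(2)[of M i x y, OF xy(1,2)]
      by (simp add: norm_power norm_mult eq power_mult_distrib power2_eq_square)
    ultimately have "\<delta>\<^sup>2 * (cmod (?A$2$1))\<^sup>2 \<le> 4 * cmod (det ?A)" by (simp add: power_mult_distrib)
    then show ?thesis using c by (simp add: csize_def field_simps)
  qed
  have "0 < \<delta>\<^sup>2 / 4" using delta_pos by simp
  then have "\<forall>\<^sub>F n in sequentially. csize (word_mat M (initial \<omega> n)) < \<delta>\<^sup>2 / 4"
    using csize_initial_tendsto[OF w] by (rule order_tendstoD(2)[rotated])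
  then have "\<forall>\<^sub>F n in sequentially. csize (word_mat M (initial \<omega> n)) < \<delta>\<^sup>2 / 4 \<and> 0 < n"
    using eventually_gt_at_top by (rule eventually_conj)
  then obtain n where "csize (word_mat M (initial \<omega> n)) < \<delta>\<^sup>2 / 4" "0 < n"
    by (auto simp: eventually_sequentially)
  then show False using low[of n] by simp
qed

text \<open>A fixed point outside \<open>E (i, False)\<close> is mapped into
  \<open>E (i, True)\<close>, hence lies there.\<close>

lemma fixed_point_location:
  assumes "v \<noteq> 0" "M i *v v = \<mu> *s v"
  shows "\<exists>b. proj v \<in> Some ` E (i, b)"
proof (cases "proj v \<in> Some ` E (i, False)")
  case False
  have "M i *v v \<noteq> 0" using multv2_eq_0[OF invertible] assms(1) by blast
  then have "\<mu> \<noteq> 0" using assms(2) by auto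
  have "moebius_map (M i) (proj v) = proj (\<mu> *s v)"
    using moebius_map_proj[OF invertible assms(1)] assms(2) by simp
  also have "\<dots> = proj v" using \<open>\<mu> \<noteq> 0\<close> by (simp add: proj_def)
  finally have "moebius_map (letter_mat M (i, True)) (proj v) = proj v" by (simp add: letter_mat_def)
  then have "proj v \<in> Some ` E (i, True)"
    using pingpong[of "proj v" "(i, True)"] False by (simp add: flip_def)
  then show ?thesis by blast
qed blast

lemma no_common_eigenvector:
  assumes "i \<noteq> j" shows "\<not> common_eigenvector (M i) (M j)"
proof
  assume "common_eigenvector (M i) (M j)"
  then obtain v \<mu> \<nu> where v: "v \<noteq> 0" "M i *v v = \<mu> *s v" "M j *v v = \<nu> *s v"
    unfolding common_eigenvector_def by blast
  obtain b c where "proj v \<in> Some ` E (i, b)" "proj v \<in> Some ` E (j, c)"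
    using fixed_point_location[OF v(1,2)] fixed_point_location[OF v(1,3)] by blast
  then show False using disjoint_E[of "(i, b)" "(j, c)"] assms by auto
qed

end

lemma schottky_marking_normalise:
  fixes L :: "'i::finite \<Rightarrow> complex^2^2"
  assumes L: "\<And>i. det (L i) \<noteq> 0" and S: "schottky_marking UNIV (\<lambda>i. psl_class (L i))"
  obtains p D D' where "schottky_disks UNIV (\<lambda>i. psl_class (conj_tuple (rotation p) L i)) D D'"
    "\<And>i. None \<notin> D i" "\<And>i. None \<notin> D' i"
proof -
  obtain D D' where D: "schottky_disks UNIV (\<lambda>i. psl_class (L i)) D D'"
    using S unfolding schottky_marking_def by blast
  obtain p where p: "\<And>i. None \<notin> moebius_map (rotation p) ` D i" "\<And>i. None \<notin> moebius_map (rotation p) ` D' i"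
    using exists_rotation[OF D] by auto
  have "schottky_disks UNIV (\<lambda>i. psl_class (conj_tuple (rotation p) L i))
      (\<lambda>i. moebius_map (rotation p) ` D i) (\<lambda>i. moebius_map (rotation p) ` D' i)"
    unfolding conj_tuple_def by (rule schottky_disks_moebius[OF det_rotation_nonzero L D])
  then show ?thesis using p by (rule that)
qed

lemma schottky_marking_pingpong:
  fixes L :: "'i::finite \<Rightarrow> complex^2^2"
  assumes L: "\<And>i. det (L i) \<noteq> 0" and S: "schottky_marking UNIV (\<lambda>i. psl_class (L i))"
  obtains p E \<delta> R where "pingpong E \<delta> R (conj_tuple (rotation p) L)"
proof -
  obtain p D D' where D: "schottky_disks UNIV (\<lambda>i. psl_class (conj_tuple (rotation p) L i)) D D'"
    "\<And>i. None \<notin> D i" "\<And>i. None \<notin> D' i"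
    using schottky_marking_normalise[OF L S] by blast
  have "det (conj_tuple (rotation p) L i) \<noteq> 0" for i using L by simp
  from pingpong_stable[OF this D tendsto_const, of "sequentially"] that show ?thesis by blast
qed

text \<open>All three properties survive conjugation and are read off from ping-pong after a
  rotation. Freeness holds because a nonempty reduced word has nonzero lower left entry, whereas a
  scalar matrix has entry 0.\<close>

lemma schottky_marking_generators:
  fixes L :: "'i::finite \<Rightarrow> complex^2^2"
  assumes L: "\<And>i. det (L i) \<noteq> 0" and S: "schottky_marking UNIV (\<lambda>i. psl_class (L i))"
  shows "loxodromic (L i)"
    and "i \<noteq> j \<Longrightarrow> \<not> common_eigenvector (L i) (L j)"
    and "reduced w \<Longrightarrow> w \<noteq> [] \<Longrightarrow> word_mat L w \<noteq> scale2 c (mat 1)"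
proof -
  obtain p E \<delta> R where pp: "pingpong E \<delta> R (conj_tuple (rotation p) L)"
    by (rule schottky_marking_pingpong[OF L S])
  interpret pingpong E \<delta> R "conj_tuple (rotation p) L" by (rule pp)
  show "loxodromic (L i)"
    using loxodromic_conj[OF det_rotation_nonzero] generator_loxodromic[of i] by (simp add: conj_tuple_def)
  show "\<not> common_eigenvector (L i) (L j)" if "i \<noteq> j"
    using common_eigenvector_conj[OF det_rotation_nonzero] no_common_eigenvector[OF that]
    unfolding conj_tuple_def by blast
  show "word_mat L w \<noteq> scale2 c (mat 1)" if w: "reduced w" "w \<noteq> []"
  proof
    assume e: "word_mat L w = scale2 c (mat 1)"
    obtain d where d: "word_mat (conj_tuple (rotation p) L) w = scale2 d (rotation p ** word_mat L w ** adj2 (rotation p))"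
      using word_mat_conj[OF det_rotation_nonzero, of p L w] unfolding conj_tuple_def by blast
    have "rotation p ** word_mat L w ** adj2 (rotation p) = scale2 (c * det (rotation p)) (mat 1)"
      unfolding e by (simp add: matrix_mul_rid)
    then have "word_mat (conj_tuple (rotation p) L) w $ 2 $ 1 = 0" unfolding d by simp
    then show False using word_21[OF w] by simp
  qed
qed

text \<open>A relation of the free tuple L must reduce to the empty word. Free reduction does not
  depend on the tuple, so the word is scalar for N as well, whether or not N generates a free
  group.\<close>

lemma relations_persist:
  fixes L N :: "'i::finite \<Rightarrow> complex^2^2"
  assumes L: "\<And>i. det (L i) \<noteq> 0" and S: "schottky_marking UNIV (\<lambda>i. psl_class (L i))"
    and N: "\<And>i. det (N i) \<noteq> 0" and rel: "word_mat L w = scale2 c (mat 1)" 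
  shows "\<exists>d. d \<noteq> 0 \<and> word_mat N w = scale2 d (mat 1)"
proof -
  obtain w' where w': "reduced w'"
    "\<And>M. (\<forall>i. det (M i) \<noteq> 0) \<Longrightarrow> \<exists>c. c \<noteq> 0 \<and> word_mat M w = scale2 c (word_mat M w')"
    using free_reduction[of w] by blast
  obtain e where e: "e \<noteq> 0" "word_mat L w = scale2 e (word_mat L w')" using w'(2)[of L] L by blast
  have "word_mat L w' = scale2 (1 / e) (word_mat L w)" using e by simp
  then have "word_mat L w' = scale2 (1 / e * c) (mat 1)" by (simp add: rel)
  then have "w' = []" using schottky_marking_generators(3)[OF L S w'(1)] by blast
  then show ?thesis using w'(2)[of N] N by simp
qed


section \<open>Stability of classical Schottky groups\<close>

definition inverse_word :: "'i letter list \<Rightarrow> 'i letter list" where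
  "inverse_word w = map flip (rev w)"

lemma adj2_letter_mat: "adj2 (letter_mat M x) = letter_mat M (flip x)"
  by (simp add: letter_mat_def flip_def)

lemma adj2_word_mat: "adj2 (word_mat M w) = word_mat M (inverse_word w)"
  by (induction w)
     (simp_all add: inverse_word_def adj2_of_mult adj2_letter_mat word_mat_append matrix_mul_rid)

definition substitute :: "('j \<Rightarrow> 'i letter list) \<Rightarrow> 'j letter list \<Rightarrow> 'i letter list" where
  "substitute v u = concat (map (\<lambda>x. if snd x then v (fst x) else inverse_word (v (fst x))) u)"

lemma word_mat_substitute: "word_mat (\<lambda>j. word_mat M (v j)) u = word_mat M (substitute v u)"
  by (induction u) (simp_all add: substitute_def word_mat_append letter_mat_def adj2_word_mat)

lemma psl_class_conj_back:
  assumes "det B \<noteq> 0"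
  shows "psl_class (adj2 B ** (B ** A ** adj2 B) ** adj2 (adj2 B)) = psl_class A"
  using assms by (simp add: adj2_conj_mult)

lemma classical_schottky_markingI:
  assumes "\<And>i. det (M i) \<noteq> 0" "schottky_disks I (\<lambda>i. psl_class (M i)) D D'"
    and "\<And>i. i \<in> I \<Longrightarrow> circle_on_sphere (riemann_sphere frontier_of D i)"
    and "\<And>i. i \<in> I \<Longrightarrow> circle_on_sphere (riemann_sphere frontier_of D' i)"
  shows "classical_schottky_marking I (\<lambda>i. psl_class (M i))"
proof -
  have "(\<lambda>i. psl_class (M i)) ` I \<subseteq> carrier PSL2C" using assms(1) by auto
  then show ?thesis unfolding classical_schottky_marking_def using assms(2-4) by blast
qed

text \<open>The classical generators are words \<open>v j\<close> in the marking, and the marking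
  consists of words \<open>u i\<close> in them. The tuple N' perturbs the classical generators
  through the words \<open>v j\<close>; its disks persist, and their frontiers remain circles
  because target disks move by Moebius maps. The point is that N' still generates the same group as
  N.\<close>

lemma classical_group_stable:
  fixes L :: "'i::finite \<Rightarrow> complex^2^2" and N :: "'x \<Rightarrow> 'i \<Rightarrow> complex^2^2"
  assumes L: "\<And>i. det (L i) \<noteq> 0" and S: "schottky_marking UNIV (\<lambda>i. psl_class (L i))"
    and k: "0 < k" "classical_schottky_group_of_rank k (generate PSL2C (range (\<lambda>i. psl_class (L i))))"
    and N: "\<And>i. ((\<lambda>x. N x i) \<longlongrightarrow> L i) F"
  shows "\<forall>\<^sub>F x in F. classical_schottky_group_of_rank k (generate PSL2C (range (\<lambda>i. psl_class (N x i))))"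
proof -
  let ?I = "{..<k}" and ?\<Gamma> = "generate PSL2C (range (\<lambda>i. psl_class (L i)))"
  obtain \<gamma> where \<gamma>: "classical_schottky_marking ?I \<gamma>" "?\<Gamma> = generate PSL2C (\<gamma> ` ?I)"
    using k(2) unfolding classical_schottky_group_of_rank_def by blast
  obtain D D' where D: "schottky_disks ?I \<gamma> D D'"
    and circ: "\<And>i. i \<in> ?I \<Longrightarrow> circle_on_sphere (riemann_sphere frontier_of D i)"
      "\<And>i. i \<in> ?I \<Longrightarrow> circle_on_sphere (riemann_sphere frontier_of D' i)"
    using \<gamma>(1) unfolding classical_schottky_marking_def by blast
  have "\<exists>w. \<gamma> j = psl_class (word_mat L w)" if "j \<in> ?I" for j
  proof -
    have "\<gamma> j \<in> ?\<Gamma>" unfolding \<gamma>(2) using that by (blast intro: generate.incl)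
    then show ?thesis using generate_eq_words[of L UNIV, OF L] by auto
  qed
  then obtain v where v: "\<And>j. j \<in> ?I \<Longrightarrow> \<gamma> j = psl_class (word_mat L (v j))" by metis
  define L' where "L' = (\<lambda>j. word_mat L (v j))"
  define N' where "N' x = (\<lambda>j. word_mat (N x) (v j))" for x
  have L': "det (L' j) \<noteq> 0" for j unfolding L'_def by (rule det_word_mat[OF L])
  have img: "\<gamma> ` ?I = (\<lambda>j. psl_class (L' j)) ` ?I" using v by (intro image_cong) (simp_all add: L'_def)
  have "\<exists>u. fst ` set u \<subseteq> ?I \<and> psl_class (L i) = psl_class (word_mat L' u)" for i
  proof -
    have "psl_class (L i) \<in> ?\<Gamma>" by (blast intro: generate.incl)
    then show ?thesis unfolding \<gamma>(2) img generate_eq_words[of L' ?I, OF L'] by auto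
  qed
  then obtain u where u: "\<And>i. fst ` set (u i) \<subseteq> ?I" "\<And>i. psl_class (L i) = psl_class (word_mat L' (u i))"
    by metis
  have same: "generate PSL2C (range (\<lambda>i. psl_class (N x i))) = generate PSL2C ((\<lambda>j. psl_class (N' x j)) ` ?I)"
    if Nx: "\<And>i. det (N x i) \<noteq> 0" for x
  proof -
    interpret group PSL2C by (rule group_PSL2C)
    have N'x: "det (N' x j) \<noteq> 0" for j unfolding N'_def by (rule det_word_mat[OF Nx])
    have "psl_class (N' x j) \<in> generate PSL2C (range (\<lambda>i. psl_class (N x i)))" for j
      using generate_eq_words[of "N x" UNIV, OF Nx] by (auto simp: N'_def)
    moreover have "psl_class (N x i) \<in> generate PSL2C ((\<lambda>j. psl_class (N' x j)) ` ?I)" for i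
    proof -
      \<comment> \<open>Substituting v into \<open>u i\<close> and appending the inverse of
        generator i gives a relation of L. By persistence it holds for \<open>N x\<close>, so
        \<open>N x i\<close> is again a word in N'.\<close>
      let ?w = "substitute v (u i) @ [(i, False)]"
      have w: "word_mat M ?w = word_mat (\<lambda>j. word_mat M (v j)) (u i) ** adj2 (M i)" for M
        by (simp add: word_mat_append word_mat_substitute letter_mat_def matrix_mul_rid)
      obtain c where c: "c \<noteq> 0" "word_mat L' (u i) = scale2 c (L i)"
        using psl_class_eq_iff[OF det_word_mat[of L' "u i", OF L'] L[of i]] u(2)[of i] by auto
      have "word_mat L ?w = scale2 (c * det (L i)) (mat 1)"
        unfolding w using c(2) by (simp add: L'_def)
      from relations_persist[where N = "N x", OF L S Nx this] obtain d
        where d: "d \<noteq> 0" "word_mat (N' x) (u i) ** adj2 (N x i) = scale2 d (mat 1)"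
        unfolding w N'_def by blast
      have "scale2 (det (N x i)) (word_mat (N' x) (u i)) = word_mat (N' x) (u i) ** (adj2 (N x i) ** N x i)"
        by (simp add: matrix_mul_rid)
      also have "\<dots> = scale2 d (N x i)"
        unfolding matrix_mul_assoc d(2) by (simp add: matrix_mul_lid)
      finally have "psl_class (word_mat (N' x) (u i)) = psl_class (N x i)"
        using psl_class_scale2[OF Nx[of i], of "word_mat (N' x) (u i)"] psl_class_scale2[OF d(1), of "N x i"] by simp
      then show ?thesis using generate_eq_words[of "N' x" ?I, OF N'x] u(1)[of i] by (auto intro: image_eqI)
    qed
    ultimately show ?thesis
      using Nx N'x by (intro subset_antisym generate_subgroup_incl generate_is_subgroup) auto
  qed
  have D1: "schottky_disks ?I (\<lambda>j. psl_class (L' j)) D D'"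
    using D v unfolding schottky_disks_def L'_def by simp
  have finI: "finite ?I" "?I \<noteq> {}" using k(1) by auto
  \<comment> \<open>The stability of disks is available only when they avoid infinity; the rotation
    is undone at the end.\<close>
  obtain p where p: "\<And>j. j \<in> ?I \<Longrightarrow> None \<notin> moebius_map (rotation p) ` D j"
    "\<And>j. j \<in> ?I \<Longrightarrow> None \<notin> moebius_map (rotation p) ` D' j"
    using exists_rotation[OF D1 finI] by blast
  let ?\<rho> = "rotation p"
  have D2: "schottky_disks ?I (\<lambda>j. psl_class (conj_tuple ?\<rho> L' j)) (\<lambda>j. moebius_map ?\<rho> ` D j) (\<lambda>j. moebius_map ?\<rho> ` D' j)"
    unfolding conj_tuple_def by (rule schottky_disks_moebius[OF det_rotation_nonzero L' D1])
  have dL: "det (conj_tuple ?\<rho> L' j) \<noteq> 0" for j using L' by simp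
  have "((\<lambda>x. N' x j) \<longlongrightarrow> L' j) F" for j
    unfolding N'_def L'_def by (rule tendsto_word_mat[OF N])
  then have tN: "((\<lambda>x. conj_tuple ?\<rho> (N' x) j) \<longlongrightarrow> conj_tuple ?\<rho> L' j) F" for j
    unfolding conj_tuple_def by (intro tendsto_intros)
  have "\<forall>\<^sub>F x in F. \<forall>i\<in>UNIV. det (N x i) \<noteq> 0"
  proof (rule eventually_ball_finite, simp, intro ballI)
    fix i
    have "((\<lambda>x. det (N x i)) \<longlongrightarrow> det (L i)) F" by (intro tendsto_intros N)
    then show "\<forall>\<^sub>F x in F. det (N x i) \<noteq> 0" using L[of i] by (rule tendsto_imp_eventually_ne)
  qed
  moreover have "\<forall>\<^sub>F x in F. (\<forall>j\<in>?I. det (conj_tuple ?\<rho> (N' x) j) \<noteq> 0) \<and>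
      schottky_disks ?I (\<lambda>j. psl_class (conj_tuple ?\<rho> (N' x) j)) (\<lambda>j. moebius_map ?\<rho> ` D j)
        (\<lambda>j. moebius_map (deviation (conj_tuple ?\<rho> (N' x) j) (conj_tuple ?\<rho> L' j)) ` moebius_map ?\<rho> ` D' j)"
    by (rule schottky_disks_stable[OF finI(1) dL D2 p tN])
  ultimately show ?thesis
  proof eventually_elim
    case (elim x)
    have Nx: "det (N x i) \<noteq> 0" for i using elim by blast
    have N'x: "det (N' x j) \<noteq> 0" for j unfolding N'_def by (rule det_word_mat[OF Nx])
    let ?H = "\<lambda>j. deviation (conj_tuple ?\<rho> (N' x) j) (conj_tuple ?\<rho> L' j)"
    let ?X = "\<lambda>j. moebius_map (adj2 ?\<rho>) ` moebius_map ?\<rho> ` D j"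
    let ?Y = "\<lambda>j. moebius_map (adj2 ?\<rho>) ` moebius_map (?H j) ` moebius_map ?\<rho> ` D' j"
    have dN: "det (conj_tuple ?\<rho> (N' x) j) \<noteq> 0" for j using N'x by simp
    have dH: "det (?H j) \<noteq> 0" for j using det_deviation[OF dL dN] .
    have "schottky_disks ?I (\<lambda>j. psl_class (adj2 ?\<rho> ** conj_tuple ?\<rho> (N' x) j ** adj2 (adj2 ?\<rho>))) ?X ?Y"
      by (rule schottky_disks_moebius) (use elim dN in auto)
    then have X: "schottky_disks ?I (\<lambda>j. psl_class (N' x j)) ?X ?Y"
      unfolding conj_tuple_def psl_class_conj_back[OF det_rotation_nonzero] .
    have "circle_on_sphere (riemann_sphere frontier_of ?X j)" "circle_on_sphere (riemann_sphere frontier_of ?Y j)"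
      if "j \<in> ?I" for j
      using circ[OF that] dH[of j] by (simp_all add: frontier_moebius circle_on_sphere_moebius)
    then have "classical_schottky_marking ?I (\<lambda>j. psl_class (N' x j))"
      by (rule classical_schottky_markingI[OF N'x X])
    then show ?case
      unfolding classical_schottky_group_of_rank_def same[OF Nx] by blast
  qed
qed


lemma classical_group_conj:
  fixes M :: "'i \<Rightarrow> complex^2^2"
  assumes M: "\<And>i. det (M i) \<noteq> 0" and B: "det B \<noteq> 0"
    and cl: "classical_schottky_group_of_rank k (generate PSL2C (range (\<lambda>i. psl_class (M i))))"
  shows "classical_schottky_group_of_rank k (generate PSL2C (range (\<lambda>i. psl_class (conj_tuple B M i))))"
proof -
  let ?I = "{..<k}"
  obtain \<gamma> where \<gamma>: "classical_schottky_marking ?I \<gamma>"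
    "generate PSL2C (range (\<lambda>i. psl_class (M i))) = generate PSL2C (\<gamma> ` ?I)"
    using cl unfolding classical_schottky_group_of_rank_def by blast
  have "\<exists>A. det A \<noteq> 0 \<and> (j \<in> ?I \<longrightarrow> \<gamma> j = psl_class A)" for j
  proof (cases "j \<in> ?I")
    case True
    then have "\<gamma> j \<in> carrier PSL2C" using \<gamma>(1) by (auto simp: classical_schottky_marking_def)
    then show ?thesis using carrier_PSL2CE[of "\<gamma> j"] by (metis zero_neq_one)
  qed (auto intro: exI[of _ "mat 1"])
  then obtain L where L: "\<And>j. det (L j) \<noteq> 0" "\<And>j. j \<in> ?I \<Longrightarrow> \<gamma> j = psl_class (L j)" by metis
  have img: "\<gamma> ` ?I = (\<lambda>j. psl_class (L j)) ` ?I" using L(2) by (intro image_cong) auto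
  obtain D D' where D: "schottky_disks ?I \<gamma> D D'"
    and circ: "\<And>i. i \<in> ?I \<Longrightarrow> circle_on_sphere (riemann_sphere frontier_of D i)"
      "\<And>i. i \<in> ?I \<Longrightarrow> circle_on_sphere (riemann_sphere frontier_of D' i)"
    using \<gamma>(1) unfolding classical_schottky_marking_def by blast
  have D1: "schottky_disks ?I (\<lambda>j. psl_class (L j)) D D'"
    using D L(2) unfolding schottky_disks_def by simp
  have "schottky_disks ?I (\<lambda>j. psl_class (conj_tuple B L j)) (\<lambda>j. moebius_map B ` D j) (\<lambda>j. moebius_map B ` D' j)"
    unfolding conj_tuple_def by (rule schottky_disks_moebius[OF B L(1) D1])
  from classical_schottky_markingI[OF _ this]
  have "classical_schottky_marking ?I (\<lambda>j. psl_class (conj_tuple B L j))"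
    using circ B L(1) by (simp add: frontier_moebius circle_on_sphere_moebius)
  moreover have cL: "det (conj_tuple B L j) \<noteq> 0" for j using L(1) B by simp
  moreover have "generate PSL2C (range (\<lambda>i. psl_class (conj_tuple B M i))) =
      generate PSL2C ((\<lambda>j. psl_class (conj_tuple B L j)) ` ?I)"
  proof -
    have words: "(\<lambda>w. psl_class (word_mat (conj_tuple B X) w)) ` S =
        (\<lambda>A. psl_class B \<otimes>\<^bsub>PSL2C\<^esub> A \<otimes>\<^bsub>PSL2C\<^esub> psl_class (adj2 B)) ` (\<lambda>w. psl_class (word_mat X w)) ` S"
      if X: "\<And>i. det (X i) \<noteq> 0" for X :: "'j \<Rightarrow> complex^2^2" and S
    proof -
      have "psl_class (word_mat (conj_tuple B X) w) =
          psl_class B \<otimes>\<^bsub>PSL2C\<^esub> psl_class (word_mat X w) \<otimes>\<^bsub>PSL2C\<^esub> psl_class (adj2 B)" for w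
      proof -
        obtain c where "c \<noteq> 0" "word_mat (conj_tuple B X) w = scale2 c (B ** word_mat X w ** adj2 B)"
          using word_mat_conj[OF B] unfolding conj_tuple_def by blast
        then show ?thesis using B det_word_mat[of X w, OF X] by (simp add: det_mul)
      qed
      then show ?thesis by (simp add: image_image)
    qed
    have cM: "det (conj_tuple B M i) \<noteq> 0" for i using M B by simp
    have "generate PSL2C (range (\<lambda>i. psl_class (conj_tuple B M i))) =
        (\<lambda>A. psl_class B \<otimes>\<^bsub>PSL2C\<^esub> A \<otimes>\<^bsub>PSL2C\<^esub> psl_class (adj2 B)) ` generate PSL2C (range (\<lambda>i. psl_class (M i)))"
      unfolding generate_eq_words[of M UNIV, OF M] generate_eq_words[of "conj_tuple B M" UNIV, OF cM]
      by (rule words[OF M])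
    also have "\<dots> = generate PSL2C ((\<lambda>j. psl_class (conj_tuple B L j)) ` ?I)"
      unfolding \<gamma>(2) img generate_eq_words[of L ?I, OF L(1)] generate_eq_words[of "conj_tuple B L" ?I, OF cL]
      by (rule words[OF L(1), symmetric])
    finally show ?thesis .
  qed
  ultimately show ?thesis unfolding classical_schottky_group_of_rank_def by blast
qed


section \<open>Openness of the locus in Schottky space\<close>

section \<open>Conjugacy classes\<close>

lemma conjugacy_class_eq:
  assumes "\<And>i. det (M i) \<noteq> 0"
  shows "conjugacy_class (\<lambda>i. psl_class (M i)) = {\<lambda>i. psl_class (conj_tuple B M i) | B. det B \<noteq> 0}"
proof -
  have conj: "(\<lambda>i. psl_class B \<otimes>\<^bsub>PSL2C\<^esub> psl_class (M i) \<otimes>\<^bsub>PSL2C\<^esub> inv\<^bsub>PSL2C\<^esub> psl_class B) =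
      (\<lambda>i. psl_class (conj_tuple B M i))" if "det B \<noteq> 0" for B
    using assms that by (simp add: conj_tuple_def det_mul)
  show ?thesis
  proof (intro Set.set_eqI iffI)
    fix x assume "x \<in> conjugacy_class (\<lambda>i. psl_class (M i))"
    then obtain g where g: "g \<in> carrier PSL2C"
      "x = (\<lambda>i. g \<otimes>\<^bsub>PSL2C\<^esub> psl_class (M i) \<otimes>\<^bsub>PSL2C\<^esub> inv\<^bsub>PSL2C\<^esub> g)"
      unfolding conjugacy_class_def by blast
    obtain B where "det B = 1" "g = psl_class B" using carrier_PSL2CE[OF g(1)] .
    then show "x \<in> {\<lambda>i. psl_class (conj_tuple B M i) | B. det B \<noteq> 0}"
      using g(2) conj[of B] by (intro CollectI exI[of _ B]) simp
  next
    fix x assume "x \<in> {\<lambda>i. psl_class (conj_tuple B M i) | B. det B \<noteq> 0}"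
    then obtain B where "det B \<noteq> 0" "x = (\<lambda>i. psl_class (conj_tuple B M i))" by blast
    then show "x \<in> conjugacy_class (\<lambda>i. psl_class (M i))"
      unfolding conjugacy_class_def using conj[of B] psl_class_in_carrier[of B]
      by (intro CollectI exI[of _ "psl_class B"]) simp
  qed
qed

lemma conj_tuple_mult: "conj_tuple A (conj_tuple B M) = conj_tuple (A ** B) M"
  by (simp add: conj_tuple_def adj2_of_mult matrix_mul_assoc)

lemma conjugacy_class_conj:
  assumes M: "\<And>i. det (M i) \<noteq> 0" and B: "det B \<noteq> 0"
  shows "conjugacy_class (\<lambda>i. psl_class (conj_tuple B M i)) = conjugacy_class (\<lambda>i. psl_class (M i))"
proof -
  have cM: "det (conj_tuple B M i) \<noteq> 0" for i using M B by simp
  show ?thesis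
    unfolding conjugacy_class_eq[of M, OF M] conjugacy_class_eq[of "conj_tuple B M", OF cM]
  proof (intro Set.set_eqI iffI)
    fix x assume "x \<in> {\<lambda>i. psl_class (conj_tuple C (conj_tuple B M) i) | C. det C \<noteq> 0}"
    then obtain C where C: "det C \<noteq> 0" "x = (\<lambda>i. psl_class (conj_tuple (C ** B) M i))"
      unfolding conj_tuple_mult by blast
    then show "x \<in> {\<lambda>i. psl_class (conj_tuple C M i) | C. det C \<noteq> 0}"
      using B by (intro CollectI exI[of _ "C ** B"]) (simp add: det_mul)
  next
    fix x assume "x \<in> {\<lambda>i. psl_class (conj_tuple C M i) | C. det C \<noteq> 0}"
    then obtain C where C: "det C \<noteq> 0" "x = (\<lambda>i. psl_class (conj_tuple C M i))" by blast
    have "psl_class (conj_tuple (C ** adj2 B ** B) M i) = psl_class (conj_tuple C M i)" for i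
    proof -
      have "C ** adj2 B ** B = scale2 (det B) C"
        by (simp add: matrix_mul_assoc[symmetric] matrix_mul_rid)
      then have "conj_tuple (C ** adj2 B ** B) M i = scale2 ((det B)\<^sup>2) (conj_tuple C M i)"
        by (simp add: conj_tuple_def power2_eq_square)
      then show ?thesis using B by simp
    qed
    then have "x = (\<lambda>i. psl_class (conj_tuple (C ** adj2 B) (conj_tuple B M) i))"
      unfolding C(2) conj_tuple_mult by simp
    then show "x \<in> {\<lambda>i. psl_class (conj_tuple C (conj_tuple B M) i) | C. det C \<noteq> 0}"
      using B C(1) by (intro CollectI exI[of _ "C ** adj2 B"]) (simp add: det_mul)
  qed
qed

lemma mem_conjugacy_class_self:
  assumes "\<And>i. det (M i) \<noteq> 0"
  shows "(\<lambda>i. psl_class (M i)) \<in> conjugacy_class (\<lambda>i. psl_class (M i))"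
  unfolding conjugacy_class_eq[of M, OF assms]
  by (rule CollectI, rule exI[of _ "mat 1"]) (simp add: conj_tuple_def matrix_mul_lid matrix_mul_rid)

lemma mem_conjugacy_class_sym:
  assumes "\<And>i. det (M i) \<noteq> 0" "\<gamma> \<in> conjugacy_class (\<lambda>i. psl_class (M i))"
  obtains B where "det B \<noteq> 0" "\<gamma> = (\<lambda>i. psl_class (conj_tuple B M i))"
  using assms(2) unfolding conjugacy_class_eq[of M, OF assms(1)] by blast

lemma carrier_tuple_rep:
  assumes "range \<gamma> \<subseteq> carrier PSL2C"
  obtains M where "\<And>i. det (M i) = 1" "\<gamma> = (\<lambda>i. psl_class (M i))"
proof -
  have "\<exists>A. det A = 1 \<and> \<gamma> i = psl_class A" for i
    using assms carrier_PSL2CE[of "\<gamma> i"] by blast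
  then obtain M where "\<And>i. det (M i) = 1 \<and> \<gamma> i = psl_class (M i)" by metis
  then show ?thesis using that[of M] by (simp add: fun_eq_iff)
qed

lemma topspace_PSL2C_topology: "topspace PSL2C_topology = carrier PSL2C"
  by (auto simp: PSL2C_topology_def carrier_PSL2C SL2C_def)

lemma mem_schottky_space:
  "X \<in> topspace schottky_space \<longleftrightarrow> (\<exists>\<gamma>. schottky_marking UNIV \<gamma> \<and> X = conjugacy_class \<gamma>)"
proof -
  have "(UNIV \<rightarrow>\<^sub>E carrier PSL2C) \<inter> {\<gamma>. schottky_marking UNIV \<gamma>} = {\<gamma> :: 'a \<Rightarrow> psl. schottky_marking UNIV \<gamma>}"
    by (auto simp: schottky_marking_def PiE_def Pi_def extensional_def)
  then show ?thesis
    unfolding schottky_space_def topspace_quotient_topology topspace_subtopology topspace_product_topology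
      topspace_PSL2C_topology
    by auto
qed

lemma small_classical_locus_subset: "small_classical_locus lam \<subseteq> topspace schottky_space"
  by (auto simp: small_classical_locus_def mem_schottky_space)

text \<open>A conjugacy class has a representative whose disks avoid infinity, and for that one all the
  defining conditions persist under perturbation.\<close>

lemma schottky_space_stable:
  fixes M :: "'i::finite \<Rightarrow> complex^2^2" and N :: "'x \<Rightarrow> 'i \<Rightarrow> complex^2^2"
  assumes M: "\<And>i. det (M i) \<noteq> 0"
    and X: "conjugacy_class (\<lambda>i. psl_class (M i)) \<in> topspace schottky_space"
    and N: "\<And>i. ((\<lambda>x. N x i) \<longlongrightarrow> M i) F"
  shows "\<forall>\<^sub>F x in F. (\<forall>i. det (N x i) \<noteq> 0) \<and>
      conjugacy_class (\<lambda>i. psl_class (N x i)) \<in> topspace schottky_space" (is ?a)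
    and "conjugacy_class (\<lambda>i. psl_class (M i)) \<in> small_classical_locus lam \<Longrightarrow>
      \<forall>\<^sub>F x in F. conjugacy_class (\<lambda>i. psl_class (N x i)) \<in> small_classical_locus lam"
proof -
  have evN: "\<forall>\<^sub>F x in F. \<forall>i\<in>UNIV. det (N x i) \<noteq> 0"
  proof (rule eventually_ball_finite, simp, intro ballI)
    fix i
    have "((\<lambda>x. det (N x i)) \<longlongrightarrow> det (M i)) F" by (intro tendsto_intros N)
    then show "\<forall>\<^sub>F x in F. det (N x i) \<noteq> 0" using M[of i] by (rule tendsto_imp_eventually_ne)
  qed
  \<comment> \<open>A point of Schottky space is known only through some representative \<gamma>.
    Conjugation by one B takes M to a rotated copy of \<gamma> whose disks avoid infinity, and
    leaves all classes unchanged, so it suffices to treat \<open>conj_tuple B (N x)\<close>.\<close>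
  have step: "\<exists>B. det B \<noteq> 0 \<and> (\<forall>\<^sub>F x in F. schottky_marking UNIV (\<lambda>i. psl_class (conj_tuple B (N x) i))) \<and>
      (classical_schottky_group_of_rank CARD('i) (generate PSL2C (range \<gamma>)) \<and>
        limit_set_dimension (generate PSL2C (range \<gamma>)) < ennreal lam \<longrightarrow>
       (\<forall>\<^sub>F x in F. classical_schottky_group_of_rank CARD('i) (generate PSL2C (range (\<lambda>i. psl_class (conj_tuple B (N x) i)))) \<and>
        limit_set_dimension (generate PSL2C (range (\<lambda>i. psl_class (conj_tuple B (N x) i)))) < ennreal lam))"
    if \<gamma>: "schottky_marking UNIV \<gamma>" "conjugacy_class (\<lambda>i. psl_class (M i)) = conjugacy_class \<gamma>" for \<gamma> :: "'i \<Rightarrow> psl"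
  proof -
    have "range \<gamma> \<subseteq> carrier PSL2C" using \<gamma>(1) by (simp add: schottky_marking_def)
    then obtain A where A: "\<And>i. det (A i) = 1" "\<gamma> = (\<lambda>i. psl_class (A i))"
      using carrier_tuple_rep by blast
    have dA: "det (A i) \<noteq> 0" for i using A(1) by simp
    have "\<gamma> \<in> conjugacy_class (\<lambda>i. psl_class (M i))"
      unfolding \<gamma>(2) A(2) by (rule mem_conjugacy_class_self[of A, OF dA])
    then obtain B0 where B0: "det B0 \<noteq> 0" "\<gamma> = (\<lambda>i. psl_class (conj_tuple B0 M i))"
      using mem_conjugacy_class_sym[of M, OF M] by blast
    define L where "L = conj_tuple B0 M"
    have L: "det (L i) \<noteq> 0" for i using M B0(1) by (simp add: L_def)
    have \<gamma>L: "\<gamma> = (\<lambda>i. psl_class (L i))" using B0(2) by (simp add: L_def)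
    have SL: "schottky_marking UNIV (\<lambda>i. psl_class (L i))" using \<gamma>(1) \<gamma>L by simp
    obtain p D D' where D: "schottky_disks UNIV (\<lambda>i. psl_class (conj_tuple (rotation p) L i)) D D'"
      "\<And>i. None \<notin> D i" "\<And>i. None \<notin> D' i"
      using schottky_marking_normalise[OF L SL] by blast
    let ?\<rho> = "rotation p" and ?B = "rotation p ** B0"
    define Q where "Q = conj_tuple ?\<rho> L"
    have Q: "det (Q i) \<noteq> 0" for i using L by (simp add: Q_def)
    note D = D[folded Q_def]
    have dB: "det ?B \<noteq> 0" using B0(1) by (simp add: det_mul)
    have NQ: "((\<lambda>x. conj_tuple ?B (N x) i) \<longlongrightarrow> Q i) F" for i
      unfolding Q_def L_def conj_tuple_mult unfolding conj_tuple_def by (intro tendsto_intros N)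
    obtain E \<delta> R where pp: "pingpong E \<delta> R Q" "\<forall>\<^sub>F x in F. pingpong E \<delta> R (conj_tuple ?B (N x))"
      using pingpong_stable[OF Q D NQ] by blast
    have ev1: "\<forall>\<^sub>F x in F. schottky_marking UNIV (\<lambda>i. psl_class (conj_tuple ?B (N x) i))"
      using schottky_disks_stable[where I = UNIV, OF finite_class.finite_UNIV Q D NQ]
    proof eventually_elim
      case (elim x)
      then show ?case unfolding schottky_marking_def by auto
    qed
    have ev2: "\<forall>\<^sub>F x in F. classical_schottky_group_of_rank CARD('i)
        (generate PSL2C (range (\<lambda>i. psl_class (conj_tuple ?B (N x) i))))"
      if cl: "classical_schottky_group_of_rank CARD('i) (generate PSL2C (range \<gamma>))"
    proof -
      have NL: "((\<lambda>x. conj_tuple B0 (N x) i) \<longlongrightarrow> L i) F" for i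
        unfolding L_def conj_tuple_def by (intro tendsto_intros N)
      have "\<forall>\<^sub>F x in F. classical_schottky_group_of_rank CARD('i)
        (generate PSL2C (range (\<lambda>i. psl_class (conj_tuple B0 (N x) i))))"
        by (rule classical_group_stable[OF L SL _ cl[unfolded \<gamma>L] NL]) simp
      with evN show ?thesis
      proof eventually_elim
        case (elim x)
        then have c: "det (conj_tuple B0 (N x) i) \<noteq> 0" for i using B0(1) by simp
        show ?case
          using classical_group_conj[OF c det_rotation_nonzero elim(2)] by (simp add: conj_tuple_mult)
      qed
    qed
    have ev3: "\<forall>\<^sub>F x in F. limit_set_dimension
        (generate PSL2C (range (\<lambda>i. psl_class (conj_tuple ?B (N x) i)))) < ennreal lam"
      if "limit_set_dimension (generate PSL2C (range \<gamma>)) < ennreal lam"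
      using dimension_stable[OF pp NQ L, where p = p and lam = lam] that by (simp add: Q_def conj_tuple_def \<gamma>L)
    show ?thesis
      using dB ev1 ev2 ev3 by (intro exI[of _ ?B]) (simp add: eventually_conj_iff)
  qed
  show ?a
  proof -
    obtain \<gamma> where g: "schottky_marking UNIV \<gamma>" "conjugacy_class (\<lambda>i. psl_class (M i)) = conjugacy_class \<gamma>"
      using X mem_schottky_space by blast
    obtain B where B: "det B \<noteq> 0" "\<forall>\<^sub>F x in F. schottky_marking UNIV (\<lambda>i. psl_class (conj_tuple B (N x) i))"
      using step[OF g] by blast
    from B(2) evN show ?thesis
    proof eventually_elim
      case (elim x)
      then have "conjugacy_class (\<lambda>i. psl_class (conj_tuple B (N x) i)) \<in> topspace schottky_space"
        by (auto simp: mem_schottky_space)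
      then show ?case using elim conjugacy_class_conj[of "N x" B] B(1) by simp
    qed
  qed
  assume "conjugacy_class (\<lambda>i. psl_class (M i)) \<in> small_classical_locus lam"
  then obtain \<gamma> where g: "schottky_marking UNIV \<gamma>" "conjugacy_class (\<lambda>i. psl_class (M i)) = conjugacy_class \<gamma>"
    "classical_schottky_group_of_rank CARD('i) (generate PSL2C (range \<gamma>))"
    "limit_set_dimension (generate PSL2C (range \<gamma>)) < ennreal lam"
    unfolding small_classical_locus_def by blast
  obtain B where B: "det B \<noteq> 0" "\<forall>\<^sub>F x in F. schottky_marking UNIV (\<lambda>i. psl_class (conj_tuple B (N x) i))"
    "\<forall>\<^sub>F x in F. classical_schottky_group_of_rank CARD('i) (generate PSL2C (range (\<lambda>i. psl_class (conj_tuple B (N x) i)))) \<and>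
        limit_set_dimension (generate PSL2C (range (\<lambda>i. psl_class (conj_tuple B (N x) i)))) < ennreal lam"
    using step[OF g(1,2)] g(3,4) by blast
  from B(2,3) evN show "\<forall>\<^sub>F x in F. conjugacy_class (\<lambda>i. psl_class (N x i)) \<in> small_classical_locus lam"
  proof eventually_elim
    case (elim x)
    then have "conjugacy_class (\<lambda>i. psl_class (conj_tuple B (N x) i)) \<in> small_classical_locus lam"
      unfolding small_classical_locus_def by blast
    then show ?case using elim conjugacy_class_conj[of "N x" B] B(1) by simp
  qed
qed


section \<open>The topology of Schottky space through matrix tuples\<close>

lemma open_iff_eventually: "open S \<longleftrightarrow> (\<forall>x\<in>S. \<forall>\<^sub>F y in nhds x. y \<in> S)"
proof
  assume "open S" then show "\<forall>x\<in>S. \<forall>\<^sub>F y in nhds x. y \<in> S"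
    by (simp add: eventually_nhds_in_open)
next
  assume *: "\<forall>x\<in>S. \<forall>\<^sub>F y in nhds x. y \<in> S"
  show "open S"
  proof (subst open_subopen, intro ballI)
    fix x assume "x \<in> S"
    then have "\<exists>T. open T \<and> x \<in> T \<and> (\<forall>y\<in>T. y \<in> S)" using * eventually_nhds[of "\<lambda>y. y \<in> S" x] by blast
    then show "\<exists>T. open T \<and> x \<in> T \<and> T \<subseteq> S" by blast
  qed
qed

lemma open_psl_class_preimage:
  assumes "openin PSL2C_topology V"
  shows "open {A. det A \<noteq> 0 \<and> psl_class A \<in> V}"
  unfolding open_iff_eventually
proof (intro ballI)
  fix A0 assume A0: "A0 \<in> {A. det A \<noteq> 0 \<and> psl_class A \<in> V}"
  then have d0: "det A0 \<noteq> 0" by simp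
  have "openin (top_of_set (carrier SL2C)) {A \<in> carrier SL2C. psl_class A \<in> V}"
    using assms unfolding PSL2C_topology_def openin_quotient_topology by simp
  then obtain T where T: "open T" "{A \<in> carrier SL2C. psl_class A \<in> V} = carrier SL2C \<inter> T"
    unfolding openin_open by auto
  \<comment> \<open>A normalising square root that is continuous near A0: \<open>csqrt\<close> jumps
    along the negative axis, so it is applied to det A / det A0, which is close to 1.\<close>
  define c where "c A = 1 / (csqrt (det A0) * csqrt (det A / det A0))" for A :: "complex^2^2"
  have c0: "c A0 = 1 / csqrt (det A0)" using d0 by (simp add: c_def)
  have "((\<lambda>A. det A / det A0) \<longlongrightarrow> det A0 / det A0) (nhds A0)"
    using d0 by (intro tendsto_divide tendsto_det2 tendsto_const filterlim_ident)
  then have "((\<lambda>A. det A / det A0) \<longlongrightarrow> 1) (nhds A0)" using d0 by simp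
  moreover have "isCont csqrt 1" by (rule continuous_at_csqrt) simp
  ultimately have "((\<lambda>A. csqrt (det A / det A0)) \<longlongrightarrow> csqrt 1) (nhds A0)"
    by (rule isCont_tendsto_compose[rotated])
  then have "(c \<longlongrightarrow> 1 / (csqrt (det A0) * csqrt 1)) (nhds A0)"
    unfolding c_def using d0 by (intro tendsto_intros) auto
  then have tc: "(c \<longlongrightarrow> c A0) (nhds A0)" by (simp add: c0)
  have "((\<lambda>A. scale2 (c A) A) \<longlongrightarrow> scale2 (c A0) A0) (nhds A0)"
    unfolding scale2_def by (intro tendsto_intros tc filterlim_ident)
  moreover have "scale2 (c A0) A0 \<in> T"
  proof -
    have "det (scale2 (c A0) A0) = 1" using d0 by (simp add: c0 power_divide)
    moreover have "psl_class (scale2 (c A0) A0) = psl_class A0" using d0 by (simp add: c0)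
    ultimately have "scale2 (c A0) A0 \<in> {A \<in> carrier SL2C. psl_class A \<in> V}" using A0 by (simp add: SL2C_def)
    then show ?thesis unfolding T(2) by blast
  qed
  ultimately have "\<forall>\<^sub>F A in nhds A0. scale2 (c A) A \<in> T" using topological_tendstoD[OF _ T(1)] by blast
  moreover have "\<forall>\<^sub>F A in nhds A0. det A \<noteq> 0"
    using tendsto_det2[OF filterlim_ident] d0 by (rule tendsto_imp_eventually_ne)
  ultimately show "\<forall>\<^sub>F A in nhds A0. A \<in> {A. det A \<noteq> 0 \<and> psl_class A \<in> V}"
  proof eventually_elim
    case (elim A)
    have c: "c A \<noteq> 0" "(c A)\<^sup>2 * det A = 1"
      using elim(2) d0 by (simp_all add: c_def power_divide power_mult_distrib)
    then have "scale2 (c A) A \<in> carrier SL2C \<inter> T" using elim(1) by (simp add: SL2C_def)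
    then have "psl_class (scale2 (c A) A) \<in> V" unfolding T(2)[symmetric] by blast
    then show ?case using c(1) elim(2) by simp
  qed
qed

text \<open>The projection is open: inside SL(2,C) the saturation of T is its union with the
  negatives.\<close>

lemma openin_psl_class_image:
  assumes "open T"
  shows "openin PSL2C_topology (psl_class ` (carrier SL2C \<inter> T))"
  unfolding PSL2C_topology_def openin_quotient_topology
proof
  have eq: "{A \<in> topspace (top_of_set (carrier SL2C)). psl_class A \<in> psl_class ` (carrier SL2C \<inter> T)} =
      carrier SL2C \<inter> (T \<union> uminus ` T)"
  proof (intro Set.set_eqI iffI)
    fix A assume "A \<in> {A \<in> topspace (top_of_set (carrier SL2C)). psl_class A \<in> psl_class ` (carrier SL2C \<inter> T)}"
    then obtain B where AB: "A \<in> carrier SL2C" "B \<in> carrier SL2C" "B \<in> T" "psl_class A = psl_class B" by auto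
    then have "A \<in> {B, - B}" by (metis (mono_tags, lifting) SL2C_def insertI1 mem_Collect_eq partial_object.select_convs(1) psl_class_det_1)
    then show "A \<in> carrier SL2C \<inter> (T \<union> uminus ` T)" using AB by auto
  next
    fix A assume A: "A \<in> carrier SL2C \<inter> (T \<union> uminus ` T)"
    have d: "det (- X) = det X" for X :: "complex^2^2" by (simp add: det_2)
    have "- A \<in> carrier SL2C" "psl_class (- A) = psl_class A"
      using A by (auto simp: SL2C_def d psl_class_det_1)
    moreover have "A \<in> T \<or> - A \<in> T" using A by auto
    ultimately show "A \<in> {A \<in> topspace (top_of_set (carrier SL2C)). psl_class A \<in> psl_class ` (carrier SL2C \<inter> T)}"
      using A by (auto simp: image_iff intro: rev_bexI)
  qed
  have "open (T \<union> uminus ` T)" using assms open_negations by blast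
  then show "openin (top_of_set (carrier SL2C)) {A \<in> topspace (top_of_set (carrier SL2C)). psl_class A \<in> psl_class ` (carrier SL2C \<inter> T)}"
    unfolding eq by (rule openin_open_Int)
qed auto

definition tuple_vector :: "('k::finite \<Rightarrow> complex^2^2) \<Rightarrow> complex^('k \<times> 2 \<times> 2)" where
  "tuple_vector A = (\<chi> p. A (fst p) $ fst (snd p) $ snd (snd p))"

lemma matrix_entry_nth [simp]: "matrix_entry M i $ a $ b = M $ (i, a, b)"
  by (simp add: matrix_entry_def)

lemma matrix_entry_tuple_vector [simp]: "matrix_entry (tuple_vector A) i = A i"
  by (simp add: vec_eq_iff tuple_vector_def)

lemma tuple_vector_mem [simp]: "tuple_vector A \<in> invertible_tuples \<longleftrightarrow> (\<forall>i. det (A i) \<noteq> 0)"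
  by (simp add: invertible_tuples_def)

lemma tuple_class_tuple_vector: "tuple_class (tuple_vector A) = conjugacy_class (\<lambda>i. psl_class (A i))"
  by (simp add: tuple_class_def)

lemma tendsto_matrix_entry:
  assumes "(f \<longlongrightarrow> M) F" shows "((\<lambda>x. matrix_entry (f x) i) \<longlongrightarrow> matrix_entry M i) F"
  unfolding matrix_entry_def by (intro tendsto_intros assms)

lemma invertible_tuplesD: "M \<in> invertible_tuples \<Longrightarrow> det (matrix_entry M i) \<noteq> 0"
  by (simp add: invertible_tuples_def)

lemma open_invertible_tuples: "open (invertible_tuples :: (complex^('k::finite \<times> 2 \<times> 2)) set)"
proof -
  have "\<forall>\<^sub>F M in nhds M0. M \<in> invertible_tuples" if "M0 \<in> invertible_tuples" for M0 :: "complex^('k \<times> 2 \<times> 2)"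
  proof -
    have "\<forall>\<^sub>F M in nhds M0. \<forall>i\<in>(UNIV :: 'k set). det (matrix_entry M i) \<noteq> 0"
    proof (rule eventually_ball_finite, simp, intro ballI)
      fix i
      have "((\<lambda>M. det (matrix_entry M i)) \<longlongrightarrow> det (matrix_entry M0 i)) (nhds M0)"
        by (intro tendsto_det2 tendsto_matrix_entry filterlim_ident)
      then show "\<forall>\<^sub>F M in nhds M0. det (matrix_entry M i) \<noteq> 0"
        using invertible_tuplesD[OF that] by (rule tendsto_imp_eventually_ne)
    qed
    then show ?thesis by (simp add: invertible_tuples_def)
  qed
  then show ?thesis by (simp add: open_iff_eventually)
qed

lemma schottky_marking_conj:
  assumes "\<And>i. det (M i) \<noteq> 0" "det B \<noteq> 0" "schottky_marking UNIV (\<lambda>i. psl_class (M i))"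
  shows "schottky_marking UNIV (\<lambda>i. psl_class (conj_tuple B M i))"
proof -
  obtain D D' where D: "schottky_disks UNIV (\<lambda>i. psl_class (M i)) D D'"
    using assms(3) unfolding schottky_marking_def by blast
  have "schottky_disks UNIV (\<lambda>i. psl_class (conj_tuple B M i)) (\<lambda>i. moebius_map B ` D i) (\<lambda>i. moebius_map B ` D' i)"
    unfolding conj_tuple_def by (rule schottky_disks_moebius[OF assms(2,1) D])
  moreover have "range (\<lambda>i. psl_class (conj_tuple B M i)) \<subseteq> carrier PSL2C" using assms by auto
  ultimately show ?thesis unfolding schottky_marking_def by blast
qed

text \<open>A class is a point of Schottky space as soon as some member is a Schottky marking;
  conjugation then carries the disks to every member.\<close>

lemma tuple_class_in_schottky_space:
  assumes M: "\<And>i. det (M i) \<noteq> 0"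
  shows "conjugacy_class (\<lambda>i. psl_class (M i)) \<in> topspace schottky_space \<longleftrightarrow>
    schottky_marking UNIV (\<lambda>i. psl_class (M i))"
proof
  assume "conjugacy_class (\<lambda>i. psl_class (M i)) \<in> topspace schottky_space"
  then obtain \<gamma> where \<gamma>: "schottky_marking UNIV \<gamma>" "conjugacy_class (\<lambda>i. psl_class (M i)) = conjugacy_class \<gamma>"
    using mem_schottky_space by blast
  have "range \<gamma> \<subseteq> carrier PSL2C" using \<gamma>(1) by (simp add: schottky_marking_def)
  then obtain A where A: "\<And>i. det (A i) = 1" "\<gamma> = (\<lambda>i. psl_class (A i))"
    using carrier_tuple_rep by blast
  have dA: "det (A i) \<noteq> 0" for i using A(1) by simp
  have "(\<lambda>i. psl_class (M i)) \<in> conjugacy_class (\<lambda>i. psl_class (A i))"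
    unfolding A(2)[symmetric] \<gamma>(2)[symmetric] by (rule mem_conjugacy_class_self[of M, OF M])
  then obtain B where B: "det B \<noteq> 0" "(\<lambda>i. psl_class (M i)) = (\<lambda>i. psl_class (conj_tuple B A i))"
    using mem_conjugacy_class_sym[of A, OF dA] by blast
  show "schottky_marking UNIV (\<lambda>i. psl_class (M i))"
    unfolding B(2) using schottky_marking_conj[of A, OF dA B(1)] \<gamma>(1) A(2) by simp
qed (auto simp: mem_schottky_space)

lemma open_schottky_space_subset:
  fixes U :: "('k::finite \<Rightarrow> psl) set set"
  assumes stable: "\<And>M0 :: complex^('k \<times> 2 \<times> 2). M0 \<in> invertible_tuples \<Longrightarrow> tuple_class M0 \<in> U \<Longrightarrow>
    \<forall>\<^sub>F M in nhds M0. tuple_class M \<in> U"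
  shows "open {M \<in> invertible_tuples. tuple_class M \<in> U}"
  unfolding open_iff_eventually
proof
  fix M0 :: "complex^('k \<times> 2 \<times> 2)" assume M0: "M0 \<in> {M \<in> invertible_tuples. tuple_class M \<in> U}"
  have "\<forall>\<^sub>F M in nhds M0. M \<in> invertible_tuples"
    using M0 open_invertible_tuples by (intro eventually_nhds_in_open) auto
  moreover have "\<forall>\<^sub>F M in nhds M0. tuple_class M \<in> U" using stable M0 by blast
  ultimately show "\<forall>\<^sub>F M in nhds M0. M \<in> {M \<in> invertible_tuples. tuple_class M \<in> U}"
    by eventually_elim simp
qed

lemma open_topspace_preimage:
  "open {M \<in> invertible_tuples. tuple_class M \<in> topspace (schottky_space :: ('k::finite \<Rightarrow> psl) set topology)}"
proof (rule open_schottky_space_subset)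
  fix M0 :: "complex^('k \<times> 2 \<times> 2)"
  assume M0: "M0 \<in> invertible_tuples" "tuple_class M0 \<in> topspace schottky_space"
  show "\<forall>\<^sub>F M in nhds M0. tuple_class M \<in> topspace (schottky_space :: ('k \<Rightarrow> psl) set topology)"
    using schottky_space_stable(1)[where N = matrix_entry, OF invertible_tuplesD[OF M0(1)]
        M0(2)[unfolded tuple_class_def] tendsto_matrix_entry[OF filterlim_ident]]
    by eventually_elim (simp add: tuple_class_def)
qed

text \<open>Reduces the quotient topology to open sets of matrix tuples. One direction uses
  continuity of the projection to PSL(2,C) and the openness of the Schottky condition, by which
  relatively open sets are open; the other uses that the projection is open in each
  component.\<close>

lemma openin_schottky_space:
  fixes U :: "('k::finite \<Rightarrow> psl) set set"
  shows "openin schottky_space U \<longleftrightarrow>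
    U \<subseteq> topspace schottky_space \<and> open {M \<in> invertible_tuples. tuple_class M \<in> U}"
proof -
  let ?P = "product_topology (\<lambda>_::'k. PSL2C_topology) UNIV" and ?S = "{\<gamma> :: 'k \<Rightarrow> psl. schottky_marking UNIV \<gamma>}"
  let ?g = "\<lambda>M i. psl_class (matrix_entry M i)"
  have topP: "topspace (subtopology ?P ?S) = ?S"
    by (auto simp: topspace_PSL2C_topology schottky_marking_def PiE_def Pi_def extensional_def)
  have Uop: "openin schottky_space U \<longleftrightarrow> U \<subseteq> topspace schottky_space \<and>
      openin (subtopology ?P ?S) {\<gamma> \<in> ?S. conjugacy_class \<gamma> \<in> U}"
    unfolding schottky_space_def openin_quotient_topology topspace_quotient_topology topP ..
  show ?thesis
    unfolding Uop
  proof (intro conj_cong refl iffI)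
    assume sub: "U \<subseteq> topspace schottky_space"
      and "openin (subtopology ?P ?S) {\<gamma> \<in> ?S. conjugacy_class \<gamma> \<in> U}"
    then obtain T where T: "openin ?P T" "{\<gamma> \<in> ?S. conjugacy_class \<gamma> \<in> U} = T \<inter> ?S"
      unfolding openin_subtopology by blast
    have cont: "continuous_map (top_of_set invertible_tuples) ?P ?g"
      unfolding continuous_map_componentwise_UNIV
    proof
      fix i :: 'k
      show "continuous_map (top_of_set invertible_tuples) PSL2C_topology (\<lambda>M. ?g M i)"
        unfolding continuous_map_def
      proof (intro conjI allI impI)
        show "(\<lambda>M. ?g M i) \<in> topspace (top_of_set invertible_tuples) \<rightarrow> topspace PSL2C_topology"
          by (auto simp: topspace_PSL2C_topology invertible_tuples_def)
        fix V assume V: "openin PSL2C_topology V"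
        have "open ((\<lambda>M. matrix_entry M i) -` {A. det A \<noteq> 0 \<and> psl_class A \<in> V})"
        proof (rule open_vimage[OF open_psl_class_preimage[OF V]])
          show "continuous_on UNIV (\<lambda>M::complex^('k \<times> 2 \<times> 2). matrix_entry M i)"
            unfolding continuous_on_def by (intro ballI tendsto_matrix_entry tendsto_ident_at)
        qed
        then have "openin (top_of_set invertible_tuples)
            (invertible_tuples \<inter> (\<lambda>M. matrix_entry M i) -` {A. det A \<noteq> 0 \<and> psl_class A \<in> V})"
          by (rule openin_open_Int)
        also have "invertible_tuples \<inter> (\<lambda>M. matrix_entry M i) -` {A. det A \<noteq> 0 \<and> psl_class A \<in> V} =
            {M \<in> topspace (top_of_set invertible_tuples). ?g M i \<in> V}"
          by (auto simp: invertible_tuples_def)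
        finally show "openin (top_of_set invertible_tuples) {M \<in> topspace (top_of_set invertible_tuples). ?g M i \<in> V}" .
      qed
    qed
    have "openin (top_of_set invertible_tuples) {M \<in> topspace (top_of_set invertible_tuples). ?g M \<in> T}"
      using openin_continuous_map_preimage[OF cont T(1)] .
    then have "open {M \<in> topspace (top_of_set invertible_tuples). ?g M \<in> T}"
      using open_invertible_tuples openin_open_eq by blast
    then have "open ({M \<in> topspace (top_of_set invertible_tuples). ?g M \<in> T} \<inter>
        {M \<in> invertible_tuples. tuple_class M \<in> topspace (schottky_space :: ('k \<Rightarrow> psl) set topology)})"
      by (rule open_Int[OF _ open_topspace_preimage])
    also have "{M \<in> topspace (top_of_set invertible_tuples). ?g M \<in> T} \<inter>
        {M \<in> invertible_tuples. tuple_class M \<in> topspace (schottky_space :: ('k \<Rightarrow> psl) set topology)} =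
        {M \<in> invertible_tuples. tuple_class M \<in> U}"
    proof (intro Set.set_eqI)
      fix M :: "complex^('k \<times> 2 \<times> 2)"
      show "M \<in> {M \<in> topspace (top_of_set invertible_tuples). ?g M \<in> T} \<inter>
          {M \<in> invertible_tuples. tuple_class M \<in> topspace (schottky_space :: ('k \<Rightarrow> psl) set topology)} \<longleftrightarrow>
          M \<in> {M \<in> invertible_tuples. tuple_class M \<in> U}"
      proof (cases "M \<in> invertible_tuples")
        case True
        note iff = tuple_class_in_schottky_space[of "matrix_entry M", OF invertible_tuplesD[OF True], folded tuple_class_def]
        have "?g M \<in> {\<gamma> \<in> ?S. conjugacy_class \<gamma> \<in> U} \<longleftrightarrow> ?g M \<in> T \<inter> ?S" unfolding T(2) ..
        then show ?thesis using True iff sub by (auto simp: tuple_class_def)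
      qed simp
    qed
    finally show "open {M \<in> invertible_tuples. tuple_class M \<in> U}" .
  next
    assume sub: "U \<subseteq> topspace schottky_space" and op: "open {M \<in> invertible_tuples. tuple_class M \<in> U}"
    let ?T = "{\<gamma>. range \<gamma> \<subseteq> carrier PSL2C \<and> conjugacy_class \<gamma> \<in> U}"
    have "openin ?P ?T"
    proof (subst openin_subopen, intro ballI)
      fix \<gamma> assume \<gamma>: "\<gamma> \<in> ?T"
      then obtain A where A: "\<And>i. det (A i) = 1" "\<gamma> = (\<lambda>i. psl_class (A i))"
        using carrier_tuple_rep[of \<gamma>] by blast
      have "tuple_vector A \<in> {M \<in> invertible_tuples. tuple_class M \<in> U}"
        using \<gamma> A by (simp add: tuple_class_tuple_vector)
      then obtain B where B: "\<And>p. open (B p) \<and> tuple_vector A $ p \<in> B p"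
        "\<And>M. (\<And>p. M $ p \<in> B p) \<Longrightarrow> M \<in> {M \<in> invertible_tuples. tuple_class M \<in> U}"
        using op unfolding open_vec_def by blast
      define T where "T i = {X :: complex^2^2. \<forall>a b. X $ a $ b \<in> B (i, a, b)}" for i
      have opT: "open (T i)" for i
      proof -
        have "T i = (\<Inter>a. \<Inter>b. (\<lambda>X. X $ a $ b) -` B (i, a, b))" by (auto simp: T_def)
        moreover have "open ((\<lambda>X :: complex^2^2. X $ a $ b) -` B (i, a, b))" for a b
          using B(1) by (intro open_vimage continuous_intros) auto
        ultimately show ?thesis by (simp add: open_INT)
      qed
      let ?V = "\<lambda>i. psl_class ` (carrier SL2C \<inter> T i)"
      let ?W = "PiE UNIV ?V"
      have "openin ?P ?W"
        by (rule product_topology_basis) (use openin_psl_class_image[OF opT] in auto)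
      moreover have "\<gamma> \<in> ?W"
      proof -
        have "A i \<in> T i" for i using B(1) by (auto simp: T_def tuple_vector_def)
        then show ?thesis using A by (auto simp: SL2C_def PiE_def extensional_def)
      qed
      moreover have "?W \<subseteq> ?T"
      proof
        fix \<gamma>' assume g: "\<gamma>' \<in> ?W"
        then have "\<exists>X. X \<in> carrier SL2C \<and> X \<in> T i \<and> \<gamma>' i = psl_class X" for i
          by (auto simp: PiE_def Pi_def)
        then obtain A' where A': "\<And>i. A' i \<in> carrier SL2C" "\<And>i. A' i \<in> T i" "\<And>i. \<gamma>' i = psl_class (A' i)" by metis
        have "tuple_vector A' $ p \<in> B p" for p
          using A'(2)[of "fst p"] by (cases p) (auto simp: T_def tuple_vector_def)
        then have "tuple_vector A' \<in> {M \<in> invertible_tuples. tuple_class M \<in> U}" by (rule B(2))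
        then have "conjugacy_class (\<lambda>i. psl_class (A' i)) \<in> U" by (simp add: tuple_class_tuple_vector)
        moreover have "\<gamma>' = (\<lambda>i. psl_class (A' i))" using A'(3) by blast
        moreover have "range (\<lambda>i. psl_class (A' i)) \<subseteq> carrier PSL2C"
          using A'(1) by (auto simp: SL2C_def)
        ultimately show "\<gamma>' \<in> ?T" by simp
      qed
      ultimately show "\<exists>T. openin ?P T \<and> \<gamma> \<in> T \<and> T \<subseteq> ?T" by blast
    qed
    moreover have "{\<gamma> \<in> ?S. conjugacy_class \<gamma> \<in> U} = ?S \<inter> ?T" by (auto simp: schottky_marking_def)
    ultimately show "openin (subtopology ?P ?S) {\<gamma> \<in> ?S. conjugacy_class \<gamma> \<in> U}"
      by (simp add: openin_subtopology_Int2)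
  qed
qed

lemma openin_small_classical_locus: "openin schottky_space (small_classical_locus lam :: ('k::finite \<Rightarrow> psl) set set)"
  unfolding openin_schottky_space
proof (intro conjI small_classical_locus_subset open_schottky_space_subset)
  fix M0 :: "complex^('k \<times> 2 \<times> 2)"
  assume M0: "M0 \<in> invertible_tuples" "tuple_class M0 \<in> small_classical_locus lam"
  have "tuple_class M0 \<in> topspace schottky_space" using M0(2) small_classical_locus_subset by blast
  from schottky_space_stable(2)[where N = matrix_entry, OF invertible_tuplesD[OF M0(1)]
        this[unfolded tuple_class_def] tendsto_matrix_entry[OF filterlim_ident] M0(2)[unfolded tuple_class_def]]
  show "\<forall>\<^sub>F M in nhds M0. tuple_class M \<in> (small_classical_locus lam :: ('k \<Rightarrow> psl) set set)"
    by (simp add: tuple_class_def)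
qed


section \<open>Complex structure, and restriction of charts to an open set\<close>

section \<open>Holomorphic functions of several variables\<close>

text \<open>The derivative is real linear by \<open>has_derivative\<close>, so complex homogeneity
  completes complex linearity.\<close>

definition holomorphic_at :: "(complex^'a::finite \<Rightarrow> complex) \<Rightarrow> complex^'a \<Rightarrow> bool" where
  "holomorphic_at f x \<longleftrightarrow> (\<exists>f'. (f has_derivative f') (at x) \<and> (\<forall>c v. f' (c *s v) = c * f' v))"

named_theorems hol_intros

lemma holomorphic_at_const [hol_intros]: "holomorphic_at (\<lambda>_. c) x"
  unfolding holomorphic_at_def by (rule exI[of _ "\<lambda>_. 0"]) simp

lemma holomorphic_at_nth [hol_intros]: "holomorphic_at (\<lambda>v. v $ i) x"
  unfolding holomorphic_at_def
  by (rule exI[of _ "\<lambda>v. v $ i"]) (auto intro: bounded_linear_imp_has_derivative bounded_linear_vec_nth)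

lemma holomorphic_at_add [hol_intros]:
  assumes "holomorphic_at f x" "holomorphic_at g x" shows "holomorphic_at (\<lambda>v. f v + g v) x"
proof -
  obtain f' g' where "(f has_derivative f') (at x)" "\<forall>c v. f' (c *s v) = c * f' v"
    "(g has_derivative g') (at x)" "\<forall>c v. g' (c *s v) = c * g' v"
    using assms unfolding holomorphic_at_def by blast
  then show ?thesis unfolding holomorphic_at_def
    by (intro exI[of _ "\<lambda>v. f' v + g' v"]) (auto intro: has_derivative_add simp: algebra_simps)
qed

lemma holomorphic_at_diff [hol_intros]:
  assumes "holomorphic_at f x" "holomorphic_at g x" shows "holomorphic_at (\<lambda>v. f v - g v) x"
proof -
  obtain f' g' where "(f has_derivative f') (at x)" "\<forall>c v. f' (c *s v) = c * f' v"
    "(g has_derivative g') (at x)" "\<forall>c v. g' (c *s v) = c * g' v"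
    using assms unfolding holomorphic_at_def by blast
  then show ?thesis unfolding holomorphic_at_def
    by (intro exI[of _ "\<lambda>v. f' v - g' v"]) (auto intro: has_derivative_diff simp: algebra_simps)
qed

lemma holomorphic_at_mult [hol_intros]:
  assumes "holomorphic_at f x" "holomorphic_at g x" shows "holomorphic_at (\<lambda>v. f v * g v) x"
proof -
  obtain f' g' where "(f has_derivative f') (at x)" "\<forall>c v. f' (c *s v) = c * f' v"
    "(g has_derivative g') (at x)" "\<forall>c v. g' (c *s v) = c * g' v"
    using assms unfolding holomorphic_at_def by blast
  then show ?thesis unfolding holomorphic_at_def
    by (intro exI[of _ "\<lambda>v. f x * g' v + f' v * g x"]) (auto intro: has_derivative_mult simp: algebra_simps)
qed

lemma holomorphic_at_compose:
  assumes "holomorphic_at f x" "(h has_field_derivative d) (at (f x))"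
  shows "holomorphic_at (\<lambda>v. h (f v)) x"
proof -
  obtain f' where f': "(f has_derivative f') (at x)" "\<forall>c v. f' (c *s v) = c * f' v"
    using assms(1) unfolding holomorphic_at_def by blast
  have "((\<lambda>v. h (f v)) has_derivative (\<lambda>v. d * f' v)) (at x)"
    using has_derivative_compose[OF f'(1) assms(2)[unfolded has_field_derivative_def]] .
  then show ?thesis unfolding holomorphic_at_def using f'(2)
    by (intro exI[of _ "\<lambda>v. d * f' v"]) simp
qed

lemma holomorphic_at_divide [hol_intros]:
  assumes "holomorphic_at f x" "holomorphic_at g x" "g x \<noteq> 0" shows "holomorphic_at (\<lambda>v. f v / g v) x"
proof -
  have "holomorphic_at (\<lambda>v. f v * inverse (g v)) x"
    by (intro holomorphic_at_mult assms holomorphic_at_compose[OF assms(2) DERIV_inverse[OF assms(3)]])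
  then show ?thesis by (simp add: divide_inverse)
qed

lemma holomorphic_at_csqrt:
  assumes "holomorphic_at f x" "f x \<notin> \<real>\<^sub>\<le>\<^sub>0" shows "holomorphic_at (\<lambda>v. csqrt (f v)) x"
  by (rule holomorphic_at_compose[OF assms(1) has_field_derivative_csqrt[OF assms(2)]])

lemma has_derivative_componentwise_holomorphic:
  fixes f :: "complex^'a::finite \<Rightarrow> complex^'b::finite"
  assumes "\<And>j. holomorphic_at (\<lambda>v. f v $ j) x"
  shows "\<exists>f'. (f has_derivative f') (at x) \<and> Vector_Spaces.linear (*s) (*s) f'"
proof -
  have "\<exists>g. \<forall>j. ((\<lambda>v. f v $ j) has_derivative g j) (at x) \<and> (\<forall>c v. g j (c *s v) = c * g j v)"
    using assms unfolding holomorphic_at_def by (intro choice allI) blast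
  then obtain g where g: "\<And>j. ((\<lambda>v. f v $ j) has_derivative g j) (at x)" "\<And>j c v. g j (c *s v) = c * g j v"
    by blast
  have add: "g j (u + v) = g j u + g j v" for j u v
    using has_derivative_bounded_linear[OF g(1)] by (rule linear_add[OF bounded_linear.linear])
  have bl: "bounded_linear (\<lambda>z :: complex. axis j z :: complex^'b)" for j
  proof -
    have "linear (\<lambda>z :: complex. axis j z :: complex^'b)"
      by (rule linearI) (auto simp: vec_eq_iff axis_def)
    then show ?thesis by (simp add: linear_conv_bounded_linear)
  qed
  have eq: "(\<chi> j. h j) = (\<Sum>j\<in>UNIV. axis j (h j))" for h :: "'b \<Rightarrow> complex"
    by (simp add: vec_eq_iff axis_def if_distrib cong: if_cong)
  have "((\<lambda>v. \<Sum>j\<in>UNIV. axis j (f v $ j)) has_derivative (\<lambda>v. \<Sum>j\<in>UNIV. axis j (g j v))) (at x)"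
    by (intro has_derivative_sum bounded_linear.has_derivative[OF bl] g(1))
  then have "(f has_derivative (\<lambda>v. \<chi> j. g j v)) (at x)"
    unfolding eq[symmetric] by simp
  moreover have "Vector_Spaces.linear (*s) (*s) (\<lambda>v. \<chi> j. g j v)"
    unfolding Vector_Spaces.linear_iff
    by (intro conjI vec.vector_space_axioms) (auto simp: vec_eq_iff add g(2))
  ultimately show ?thesis by blast
qed

lemma holomorphic_map_on_continuous: "holomorphic_map_on f S \<Longrightarrow> continuous_on S f"
  unfolding holomorphic_map_on_def
  by (meson continuous_at_imp_continuous_on has_derivative_continuous)


section \<open>Charts of an open subset\<close>

lemma image_chart_open:
  assumes "openin X U" "open (\<phi> ` U)" "homeomorphic_map (subtopology X U) (top_of_set (\<phi> ` U)) \<phi>"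
    and "openin X V" "V \<subseteq> U"
  shows "open (\<phi> ` V)"
proof -
  have "openin (subtopology X U) V" using assms(4,5) by (simp add: openin_subset_topspace_eq openin_open_subtopology assms(1))
  then have "openin (top_of_set (\<phi> ` U)) (\<phi> ` V)"
    using assms(3) homeomorphic_map_openness_eq by blast
  then show ?thesis using assms(2) openin_open_eq by blast
qed

text \<open>Locally the transition map is \<psi> after \<open>tuple_class\<close>, composed with a
  holomorphic lift of the inverse of \<phi>; the definition of the charts makes both factors
  holomorphic.\<close>

lemma schottky_chart_transition:
  fixes \<phi> \<psi> :: "('k::finite \<Rightarrow> psl) set \<Rightarrow> complex^'n::finite"
  assumes \<phi>: "(U, \<phi>) \<in> schottky_charts" and \<psi>: "(V, \<psi>) \<in> schottky_charts" and S: "openin schottky_space S"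
  shows "holomorphic_map_on (\<lambda>w. \<psi> (inv_into (U \<inter> S) \<phi> w)) (\<phi> ` (U \<inter> S \<inter> (V \<inter> S)))"
  unfolding holomorphic_map_on_def
proof (intro conjI ballI)
  have U: "openin schottky_space U" "open (\<phi> ` U)"
    "homeomorphic_map (subtopology schottky_space U) (top_of_set (\<phi> ` U)) \<phi>"
    and lift: "\<And>w. w \<in> \<phi> ` U \<Longrightarrow> \<exists>W s. w \<in> W \<and> W \<subseteq> \<phi> ` U \<and> holomorphic_map_on s W \<and>
        (\<forall>v\<in>W. s v \<in> invertible_tuples \<and> tuple_class (s v) \<in> U \<and> \<phi> (tuple_class (s v)) = v)"
    using \<phi> unfolding schottky_charts_def by blast+
  have V: "openin schottky_space V"
    and hol: "holomorphic_map_on (\<lambda>M. \<psi> (tuple_class M)) {M \<in> invertible_tuples. tuple_class M \<in> V}"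
    using \<psi> unfolding schottky_charts_def by blast+
  let ?T = "U \<inter> S \<inter> (V \<inter> S)"
  have inj: "inj_on \<phi> U"
  proof -
    have "topspace (subtopology schottky_space U) = U" using openin_subset[OF U(1)] by auto
    then show ?thesis using homeomorphic_imp_injective_map[OF U(3)] by simp
  qed
  show op: "open (\<phi> ` ?T)"
    by (rule image_chart_open[OF U]) (use U(1) V S in auto)
  fix w assume w: "w \<in> \<phi> ` ?T"
  obtain W s where W: "w \<in> W" "W \<subseteq> \<phi> ` U" "holomorphic_map_on s W"
    "\<And>v. v \<in> W \<Longrightarrow> s v \<in> invertible_tuples \<and> tuple_class (s v) \<in> U \<and> \<phi> (tuple_class (s v)) = v"
    using lift[of w] w by blast
  obtain s' where s': "(s has_derivative s') (at w)" "Vector_Spaces.linear (*s) (*s) s'"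
    using W(1,3) unfolding holomorphic_map_on_def by blast
  have opW: "open W" using W(3) by (simp add: holomorphic_map_on_def)
  have cls: "tuple_class (s v) = inv_into (U \<inter> S) \<phi> v" "tuple_class (s v) \<in> V" if v: "v \<in> W \<inter> \<phi> ` ?T" for v
  proof -
    obtain x where x: "x \<in> ?T" "v = \<phi> x" using v by blast
    have "tuple_class (s v) = x" using W(4)[of v] v x inj by (auto dest: inj_onD)
    moreover have "inv_into (U \<inter> S) \<phi> v = x"
      unfolding x(2) using x(1) inj by (intro inv_into_f_f) (auto intro: inj_on_subset)
    ultimately show "tuple_class (s v) = inv_into (U \<inter> S) \<phi> v" "tuple_class (s v) \<in> V" using x by auto
  qed
  have "s w \<in> {M \<in> invertible_tuples. tuple_class M \<in> V}" using W(1,4) cls(2) w by blast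
  then obtain h' where h': "((\<lambda>M. \<psi> (tuple_class M)) has_derivative h') (at (s w))" "Vector_Spaces.linear (*s) (*s) h'"
    using hol unfolding holomorphic_map_on_def by blast
  have "((\<lambda>v. \<psi> (tuple_class (s v))) has_derivative (\<lambda>v. h' (s' v))) (at w)"
    by (rule has_derivative_compose[OF s'(1) h'(1)])
  then have "((\<lambda>v. \<psi> (inv_into (U \<inter> S) \<phi> v)) has_derivative (\<lambda>v. h' (s' v))) (at w)"
    by (rule has_derivative_transform_within_open[where s = "W \<inter> \<phi> ` ?T"]) (use opW op W(1) w cls in auto)
  moreover have "Vector_Spaces.linear (*s) (*s) (\<lambda>v. h' (s' v))"
    using s'(2) h'(2) unfolding Vector_Spaces.linear_iff by simp
  ultimately show "\<exists>f'. ((\<lambda>w. \<psi> (inv_into (U \<inter> S) \<phi> w)) has_derivative f') (at w) \<and> Vector_Spaces.linear (*s) (*s) f'"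
    by blast
qed

lemma second_countable_euclidean: "second_countable (euclidean :: 'a::second_countable_topology topology)"
proof -
  obtain \<B> :: "'a set set" where B: "countable \<B>" "topological_basis \<B>"
    using ex_countable_basis by blast
  show ?thesis unfolding second_countable_def
  proof (intro exI[of _ \<B>] conjI ballI allI impI)
    show "openin euclidean V" if "V \<in> \<B>" for V using topological_basis_open[OF B(2) that] by simp
    fix U :: "'a set" and x assume "openin euclidean U \<and> x \<in> U"
    then have "open U" "x \<in> U" by simp_all
    then obtain V where "V \<in> \<B>" "x \<in> V" "V \<subseteq> U" by (rule topological_basisE[OF B(2)])
    then show "\<exists>V\<in>\<B>. x \<in> V \<and> V \<subseteq> U" by (intro bexI conjI)
  qed (rule B(1))
qed

text \<open>A homeomorphism onto a subset of complex space supplies the Hausdorff property and a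
  countable base; both pass to the subspace S, and since S is open the restricted charts keep open
  images.\<close>

lemma complex_manifold_of_global_chart:
  fixes \<phi> :: "('k::finite \<Rightarrow> psl) set \<Rightarrow> complex^'n::finite"
  assumes \<phi>: "(topspace schottky_space, \<phi>) \<in> schottky_charts" and S: "openin schottky_space S"
  shows "complex_manifold (subtopology schottky_space S)
    (induced_charts S (schottky_charts :: (('k \<Rightarrow> psl) set set \<times> (('k \<Rightarrow> psl) set \<Rightarrow> complex^'n)) set))"
proof -
  let ?X = "schottky_space :: ('k \<Rightarrow> psl) set topology"
  have "homeomorphic_map ?X (top_of_set (\<phi> ` topspace ?X)) \<phi>"
    using \<phi> unfolding schottky_charts_def by simp
  then have hom: "?X homeomorphic_space top_of_set (\<phi> ` topspace ?X)"
    by (rule homeomorphic_map_imp_homeomorphic_space)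
  have "Hausdorff_space ?X"
    using homeomorphic_Hausdorff_space[OF hom] Hausdorff_space_subtopology[OF Hausdorff_space_euclidean] by blast
  then have haus: "Hausdorff_space (subtopology ?X S)" by (rule Hausdorff_space_subtopology)
  have "second_countable ?X"
    using homeomorphic_space_second_countability[OF hom] second_countable_subtopology[OF second_countable_euclidean] by blast
  then have sc: "second_countable (subtopology ?X S)" by (rule second_countable_subtopology)
  have sub: "S \<subseteq> topspace ?X" by (rule openin_subset[OF S])
  show ?thesis
    unfolding complex_manifold_def
  proof (intro conjI haus sc)
    show "\<forall>(U, \<psi>)\<in>induced_charts S schottky_charts. openin (subtopology ?X S) U \<and> open (\<psi> ` U) \<and>
        homeomorphic_map (subtopology (subtopology ?X S) U) (top_of_set (\<psi> ` U)) (\<psi> :: _ \<Rightarrow> complex^'n)"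
    proof (intro ballI, clarify)
      fix U' and \<psi> :: "('k \<Rightarrow> psl) set \<Rightarrow> complex^'n" assume "(U', \<psi>) \<in> induced_charts S schottky_charts"
      then obtain U where U: "(U, \<psi>) \<in> schottky_charts" "U' = U \<inter> S" by (auto simp: induced_charts_def)
      then have c: "openin ?X U" "open (\<psi> ` U)" "homeomorphic_map (subtopology ?X U) (top_of_set (\<psi> ` U)) \<psi>"
        unfolding schottky_charts_def by blast+
      have opU: "openin ?X (U \<inter> S)" using c(1) S by (rule openin_Int)
      have 1: "openin (subtopology ?X S) U'" using c(1) by (simp add: U(2) openin_subtopology_Int)
      have 2: "open (\<psi> ` U')" unfolding U(2) by (rule image_chart_open[OF c opU]) simp
      have "homeomorphic_map (subtopology (subtopology ?X U) U') (subtopology (top_of_set (\<psi> ` U)) (\<psi> ` U')) \<psi>"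
        using openin_subset[OF c(1)] by (intro homeomorphic_map_subtopologies[OF c(3)]) (auto simp: U(2))
      moreover have "subtopology (subtopology ?X U) U' = subtopology (subtopology ?X S) U'"
        by (simp add: subtopology_subtopology U(2) Int_ac)
      moreover have "subtopology (top_of_set (\<psi> ` U)) (\<psi> ` U') = top_of_set (\<psi> ` U')"
        by (simp add: subtopology_subtopology U(2) Int_absorb1 image_mono)
      ultimately have 3: "homeomorphic_map (subtopology (subtopology ?X S) U') (top_of_set (\<psi> ` U')) \<psi>"
        by simp
      show "openin (subtopology ?X S) U' \<and> open (\<psi> ` U') \<and>
        homeomorphic_map (subtopology (subtopology ?X S) U') (top_of_set (\<psi> ` U')) \<psi>"
        using 1 2 3 by blast
    qed
    show "(\<Union>(U, \<psi> :: _ \<Rightarrow> complex^'n)\<in>induced_charts S schottky_charts. U) = topspace (subtopology ?X S)"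
    proof
      show "(\<Union>(U, \<psi> :: _ \<Rightarrow> complex^'n)\<in>induced_charts S schottky_charts. U) \<subseteq> topspace (subtopology ?X S)"
        using sub by (auto simp: induced_charts_def)
      have "(topspace ?X \<inter> S, \<phi>) \<in> induced_charts S schottky_charts"
        unfolding induced_charts_def using \<phi> by (intro image_eqI[of _ _ "(topspace ?X, \<phi>)"]) auto
      then show "topspace (subtopology ?X S) \<subseteq> (\<Union>(U, \<psi> :: _ \<Rightarrow> complex^'n)\<in>induced_charts S schottky_charts. U)"
        by (simp only: topspace_subtopology) blast
    qed
    show "\<forall>(U, \<phi> :: _ \<Rightarrow> complex^'n)\<in>induced_charts S schottky_charts. \<forall>(V, \<psi> :: _ \<Rightarrow> complex^'n)\<in>induced_charts S schottky_charts.
        holomorphic_map_on (\<lambda>w. \<psi> (inv_into U \<phi> w)) (\<phi> ` (U \<inter> V))"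
      using schottky_chart_transition[OF _ _ S] by (auto simp: induced_charts_def)
  qed
qed


section \<open>Global holomorphic coordinates\<close>

section \<open>Eigenvalues and spectral projections of loxodromic matrices\<close>

definition trace2 :: "complex^2^2 \<Rightarrow> complex" where
  "trace2 A = A$1$1 + A$2$2"

text \<open>The larger and the smaller eigenvalue of a loxodromic matrix: the quotient of their difference
  by the trace has positive real part, so the principal branch of the square root is the right one.\<close>

definition eig_large :: "complex^2^2 \<Rightarrow> complex" where
  "eig_large A = trace2 A / 2 * (1 + csqrt (1 - 4 * det A / (trace2 A * trace2 A)))"

definition eig_small :: "complex^2^2 \<Rightarrow> complex" where
  "eig_small A = trace2 A / 2 * (1 - csqrt (1 - 4 * det A / (trace2 A * trace2 A)))"

text \<open>The spectral projection (A - y) / (x - y) onto the eigenline of the larger eigenvalue x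
  along that of y. For loxodromic A it conjugates with A and does not change when A is
  scaled.\<close>

definition attracting :: "complex^2^2 \<Rightarrow> complex^2^2" where
  "attracting A = scale2 (1 / (eig_large A - eig_small A)) (A - scale2 (eig_small A) (mat 1))"

definition repelling :: "complex^2^2 \<Rightarrow> complex^2^2" where
  "repelling A = scale2 (1 / (eig_small A - eig_large A)) (A - scale2 (eig_large A) (mat 1))"

lemma trace2_scale2 [simp]: "trace2 (scale2 c A) = c * trace2 A"
  by (simp add: trace2_def algebra_simps)

lemma trace2_conj: "trace2 (B ** A ** adj2 B) = det B * trace2 A"
  unfolding trace2_def by (rule trace_conj)

text \<open>With r = (x - y) / (x + y) the argument of the root is r^2, and Re r has the sign of
  |x|^2 - |y|^2, hence is positive. So the principal root is r, and r^2 avoids the branch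
  cut.\<close>

lemma eigenvalues:
  assumes "cmod y < cmod x" "trace2 A = x + y" "det A = x * y"
  shows "eig_large A = x" "eig_small A = y" "trace2 A \<noteq> 0"
    "1 - 4 * det A / (trace2 A * trace2 A) \<notin> \<real>\<^sub>\<le>\<^sub>0"
proof -
  have t: "x + y \<noteq> 0"
  proof
    assume "x + y = 0" then have "x = - y" by (simp add: eq_neg_iff_add_eq_0)
    then show False using assms(1) by simp
  qed
  define r where "r = (x - y) / (x + y)"
  have "(x - y) * cnj (x + y) = complex_of_real ((cmod x)\<^sup>2 - (cmod y)\<^sup>2) + (x * cnj y - cnj (x * cnj y))"
    unfolding of_real_diff complex_norm_square by (simp add: algebra_simps)
  then have "Re ((x - y) * cnj (x + y)) = (cmod x)\<^sup>2 - (cmod y)\<^sup>2" by simp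
  moreover have "r = (x - y) * cnj (x + y) / complex_of_real ((cmod (x + y))\<^sup>2)"
    unfolding r_def complex_norm_square using t complex_cnj_zero_iff[of "x + y"] by (simp del: complex_cnj_add complex_cnj_zero_iff)
  ultimately have "Re r = ((cmod x)\<^sup>2 - (cmod y)\<^sup>2) / (cmod (x + y))\<^sup>2"
    by (simp only: Re_divide_of_real)
  moreover have "(cmod y)\<^sup>2 < (cmod x)\<^sup>2" using assms(1) by (intro power_strict_mono) auto
  ultimately have Re: "0 < Re r" using t by simp
  have arg: "1 - 4 * det A / (trace2 A * trace2 A) = r\<^sup>2"
    using t unfolding assms(2,3) r_def by (simp add: power_divide divide_simps power2_eq_square) (simp add: algebra_simps)
  have cs: "csqrt (1 - 4 * det A / (trace2 A * trace2 A)) = r"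
    unfolding arg by (rule csqrt_square) (use Re in simp)
  have tr: "(x + y) * r = x - y" using t by (simp add: r_def)
  have "eig_large A = ((x + y) + (x + y) * r) / 2" "eig_small A = ((x + y) - (x + y) * r) / 2"
    unfolding eig_large_def eig_small_def cs unfolding assms(2) by (simp_all add: field_simps)
  then show "eig_large A = x" "eig_small A = y" unfolding tr by simp_all
  show "trace2 A \<noteq> 0" using t assms(2) by simp
  show "1 - 4 * det A / (trace2 A * trace2 A) \<notin> \<real>\<^sub>\<le>\<^sub>0"
  proof
    assume "1 - 4 * det A / (trace2 A * trace2 A) \<in> \<real>\<^sub>\<le>\<^sub>0"
    then obtain u where u: "r\<^sup>2 = complex_of_real u" "u \<le> 0" unfolding arg nonpos_Reals_def by auto
    have "Im (r\<^sup>2) = 2 * Re r * Im r" "Re (r\<^sup>2) = (Re r)\<^sup>2 - (Im r)\<^sup>2" by (simp_all add: power2_eq_square)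
    then have "Im r = 0" "(Re r)\<^sup>2 - (Im r)\<^sup>2 \<le> 0" using u Re by simp_all
    then show False using Re by simp
  qed
qed

text \<open>The kernel of A - x is read off from the first row, or from the second if the first
  vanishes; if both vanish, any vector will do.\<close>

lemma eigenvector_exists:
  assumes "trace2 A = x + y" "det A = x * y"
  obtains v where "v \<noteq> 0" "A *v v = x *s v"
proof -
  have d: "A$1$1 * A$2$2 - A$1$2 * A$2$1 = x * y" "A$1$1 + A$2$2 = x + y"
    using assms by (simp_all add: det_2 trace2_def)
  have e: "y = A$1$1 + A$2$2 - x" using d(2) by (simp add: algebra_simps)
  have z: "(A$1$1 - x) * (A$2$2 - x) = A$1$2 * A$2$1"
    using d(1) unfolding e by (simp add: algebra_simps)
  consider "A$1$2 \<noteq> 0 \<or> A$1$1 \<noteq> x" | "A$1$2 = 0" "A$1$1 = x" "A$2$2 \<noteq> x \<or> A$2$1 \<noteq> 0"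
    | "A$1$2 = 0" "A$1$1 = x" "A$2$2 = x" "A$2$1 = 0" by blast
  then show ?thesis
  proof cases
    case 1
    then show ?thesis using z
      by (intro that[of "vector [A$1$2, x - A$1$1]"]) (auto simp: vec2_eq_iff algebra_simps)
  next
    case 2
    then show ?thesis using z
      by (intro that[of "vector [x - A$2$2, A$2$1]"]) (auto simp: vec2_eq_iff algebra_simps)
  next
    case 3
    then show ?thesis by (intro that[of "vector [1, 0]"]) (auto simp: vec2_eq_iff)
  qed
qed

text \<open>Scaling and conjugation multiply both eigenvalues by \<kappa> det B, so their quotient
  is unchanged and the projections are merely conjugated.\<close>

lemma spectral_conj:
  assumes "det B \<noteq> 0" "\<kappa> \<noteq> 0" and X: "cmod y < cmod x" "trace2 X = x + y" "det X = x * y"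
    and A: "A = scale2 \<kappa> (B ** X ** adj2 B)"
  shows "eig_large A = \<kappa> * det B * x" "eig_small A = \<kappa> * det B * y"
    "attracting A = scale2 (1 / det B) (B ** attracting X ** adj2 B)"
    "repelling A = scale2 (1 / det B) (B ** repelling X ** adj2 B)"
    "trace2 A \<noteq> 0" "1 - 4 * det A / (trace2 A * trace2 A) \<notin> \<real>\<^sub>\<le>\<^sub>0" "eig_large A \<noteq> 0" "eig_large A \<noteq> eig_small A"
proof -
  have s: "cmod (\<kappa> * det B * y) < cmod (\<kappa> * det B * x)" using assms by (simp add: norm_mult)
  have t: "trace2 A = \<kappa> * det B * x + \<kappa> * det B * y"
    unfolding A trace2_scale2 trace2_conj X(2) by (simp add: algebra_simps)
  have d: "det A = (\<kappa> * det B * x) * (\<kappa> * det B * y)"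
    unfolding A det_scale2 det_mul det_adj2 X(3) by (simp add: power2_eq_square algebra_simps)
  note e = eigenvalues[OF s t d] and eX = eigenvalues[OF X]
  show "eig_large A = \<kappa> * det B * x" "eig_small A = \<kappa> * det B * y" "trace2 A \<noteq> 0"
    "1 - 4 * det A / (trace2 A * trace2 A) \<notin> \<real>\<^sub>\<le>\<^sub>0" by (rule e)+
  show "eig_large A \<noteq> 0" using X(1) assms(1,2) by (auto simp: e)
  have xy: "x \<noteq> y" using X(1) by auto
  then show "eig_large A \<noteq> eig_small A" using assms(1,2) by (simp add: e)
  have shift: "A - scale2 (\<kappa> * det B * z) (mat 1) = scale2 \<kappa> (B ** (X - scale2 z (mat 1)) ** adj2 B)" for z
    unfolding A by (simp add: mat2_eq_iff det_2 algebra_simps)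
  have q: "1 / (\<kappa> * det B * u - \<kappa> * det B * v) * \<kappa> = 1 / det B * (1 / (u - v))" if "u \<noteq> v" for u v
    using that assms(1,2) by (simp add: right_diff_distrib[symmetric])
  show "attracting A = scale2 (1 / det B) (B ** attracting X ** adj2 B)"
    unfolding attracting_def e eX shift scale2_scale2 scale2_mult q[OF xy] ..
  show "repelling A = scale2 (1 / det B) (B ** repelling X ** adj2 B)"
    unfolding repelling_def e eX shift scale2_scale2 scale2_mult q[OF xy[symmetric]] ..
qed

lemma conj_mult: "(B ** Y ** adj2 B) ** (B ** Z ** adj2 B) = scale2 (det B) (B ** (Y ** Z) ** adj2 B)"
proof -
  have "(B ** Y ** adj2 B) ** (B ** Z ** adj2 B) = B ** Y ** (adj2 B ** B) ** Z ** adj2 B"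
    by (simp only: matrix_mul_assoc)
  then show ?thesis by (simp add: matrix_mul_rid matrix_mul_assoc)
qed


section \<open>The global chart\<close>

text \<open>The normal form of a Schottky group: the first generator has attracting fixed point \<open>0\<close> and
  repelling fixed point \<open>\<infinity>\<close>, and the second one has attracting fixed point \<open>1\<close>.\<close>

definition normal_tuple :: "'k \<Rightarrow> 'k \<Rightarrow> ('k \<times> nat \<Rightarrow> complex) \<Rightarrow> 'k \<Rightarrow> complex^2^2" where
  "normal_tuple i1 i2 u i =
    (if i = i1 then mat2 (u (i, 0)) 0 0 1
     else if i = i2 then mat2 (u (i, 0)) (u (i, 1)) 1 (u (i, 0) + u (i, 1) - 1)
     else mat2 (u (i, 0)) (u (i, 1)) 1 (u (i, 2)))"

text \<open>One multiplier, two entries of the second generator and three of each other one: 1 + 2 +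
  3 (k - 2) = 3 k - 3 coordinates.\<close>

definition coordinate_index :: "'k \<Rightarrow> 'k \<Rightarrow> ('k \<times> nat) set" where
  "coordinate_index i1 i2 = {(i, j). j < (if i = i1 then 1 else if i = i2 then 2 else 3)}"

text \<open>The second generator of the normal form has eigenvalues
  \<open>u (i2, 0) + u (i2, 1)\<close>, with eigenvector (1, 1), and \<open>u (i2, 0) - 1\<close>;
  the inequalities make 0 and 1 the attracting points. The last condition says that the second
  generator does not fix 0.\<close>

definition admissible :: "'k \<Rightarrow> 'k \<Rightarrow> ('k \<times> nat \<Rightarrow> complex) \<Rightarrow> bool" where
  "admissible i1 i2 u \<longleftrightarrow> cmod (u (i1, 0)) < 1 \<and> cmod (u (i2, 0) - 1) < cmod (u (i2, 0) + u (i2, 1)) \<and> u (i2, 1) \<noteq> 0"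

text \<open>With \<open>P\<close>, \<open>Q\<close>, \<open>R\<close> the projections to the three fixed points, the entries of a generator in the
  adapted basis are the traces below; they are visibly invariant under conjugation.\<close>

definition lower_left :: "'k \<Rightarrow> 'k \<Rightarrow> ('k \<Rightarrow> complex^2^2) \<Rightarrow> 'k \<Rightarrow> complex" where
  "lower_left i1 i2 M i =
    trace2 (attracting (M i1) ** M i ** repelling (M i1) ** attracting (M i2)) /
    trace2 (attracting (M i1) ** attracting (M i2))"

definition coordinate :: "'k \<Rightarrow> 'k \<Rightarrow> ('k \<Rightarrow> complex^2^2) \<Rightarrow> 'k \<times> nat \<Rightarrow> complex" where
  "coordinate i1 i2 M p =
    (if fst p = i1 then eig_small (M i1) / eig_large (M i1)
     else if snd p = 0 then trace2 (repelling (M i1) ** M (fst p)) / lower_left i1 i2 M (fst p)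
     else if snd p = 1 then trace2 (repelling (M i1) ** M (fst p) ** attracting (M i1) ** attracting (M i2)) /
       trace2 (repelling (M i1) ** attracting (M i2)) / lower_left i1 i2 M (fst p)
     else trace2 (attracting (M i1) ** M (fst p)) / lower_left i1 i2 M (fst p))"

definition regular_tuple :: "'k \<Rightarrow> 'k \<Rightarrow> ('k \<Rightarrow> complex^2^2) \<Rightarrow> bool" where
  "regular_tuple i1 i2 M \<longleftrightarrow>
    (\<forall>A\<in>{M i1, M i2}. trace2 A \<noteq> 0 \<and> 1 - 4 * det A / (trace2 A * trace2 A) \<notin> \<real>\<^sub>\<le>\<^sub>0 \<and>
       eig_large A \<noteq> 0 \<and> eig_large A \<noteq> eig_small A) \<and>
    trace2 (attracting (M i1) ** attracting (M i2)) \<noteq> 0 \<and>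
    trace2 (repelling (M i1) ** attracting (M i2)) \<noteq> 0 \<and>
    (\<forall>i. i \<noteq> i1 \<longrightarrow> lower_left i1 i2 M i \<noteq> 0)"

text \<open>In the adapted basis the projections P and Q of the first generator are matrix units and
  R has rank one. Thus tr(P M Q R) is the lower left entry of M times an entry of R, which division
  by tr(P R) removes; the other coordinates work alike. Dividing by \<open>lower_left\<close>
  cancels the scalar of each generator.\<close>

lemma coordinate_normal_tuple:
  assumes ne: "i1 \<noteq> i2" and B: "det B \<noteq> 0" and \<kappa>: "\<And>i. \<kappa> i \<noteq> 0" and u: "admissible i1 i2 u"
    and M: "\<And>i. M i = scale2 (\<kappa> i) (B ** normal_tuple i1 i2 u i ** adj2 B)"
  shows "regular_tuple i1 i2 M" "p \<in> coordinate_index i1 i2 \<Longrightarrow> coordinate i1 i2 M p = u p"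
proof -
  define m a b where "m = u (i1, 0)" and "a = u (i2, 0)" and "b = u (i2, 1)"
  have adm: "cmod m < 1" "cmod (a - 1) < cmod (a + b)" "b \<noteq> 0"
    using u by (simp_all add: admissible_def m_def a_def b_def)
  \<comment> \<open>b = -1 would make the eigenvalues a + b and a - 1 of the second generator
    equal.\<close>
  have b1: "b + 1 \<noteq> 0"
  proof
    assume "b + 1 = 0"
    then have "b = - 1" by (simp add: eq_neg_iff_add_eq_0)
    then show False using adm(2) by simp
  qed
  let ?X = "mat2 m 0 0 1" and ?Y = "mat2 a b 1 (a + b - 1)"
  have XY: "normal_tuple i1 i2 u i1 = ?X" "normal_tuple i1 i2 u i2 = ?Y"
    using ne by (simp_all add: normal_tuple_def m_def a_def b_def)
  have X: "cmod m < cmod (1 :: complex)" "trace2 ?X = 1 + m" "det ?X = 1 * m"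
    using adm by (simp_all add: trace2_def)
  have Y: "cmod (a - 1) < cmod (a + b)" "trace2 ?Y = (a + b) + (a - 1)" "det ?Y = (a + b) * (a - 1)"
    using adm by (simp_all add: trace2_def algebra_simps)
  have m1: "m \<noteq> 1" using adm(1) by auto
  have aX: "attracting ?X = mat2 0 0 0 1" and rX: "repelling ?X = mat2 1 0 0 0"
    using m1 by (simp_all add: attracting_def repelling_def eigenvalues[OF X] mat2_eq_iff)
  have aY: "attracting ?Y = scale2 (1 / (b + 1)) (mat2 1 b 1 b)"
    by (simp add: attracting_def eigenvalues[OF Y] mat2_eq_iff algebra_simps)
  note sX = spectral_conj[OF B \<kappa> X M[of i1, unfolded XY], unfolded aX rX]
  note sY = spectral_conj[OF B \<kappa> Y M[of i2, unfolded XY], unfolded aY]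
  define d where "d = det B"
  have d: "d \<noteq> 0" using B by (simp add: d_def)
  note cs = sX(3,4) sY(3) M scale2_mult scale2_scale2 conj_mult trace2_scale2 trace2_conj d_def[symmetric]
  have PR: "trace2 (attracting (M i1) ** attracting (M i2)) = b / (b + 1)"
    unfolding sX(3) sY(3) using d by (simp add: cs del: M) (simp add: trace2_def)
  have QR: "trace2 (repelling (M i1) ** attracting (M i2)) = 1 / (b + 1)"
    unfolding sX(4) sY(3) using d by (simp add: cs del: M) (simp add: trace2_def)
  have ll: "lower_left i1 i2 M i = \<kappa> i * d * normal_tuple i1 i2 u i $ 2 $ 1" for i
    unfolding lower_left_def PR unfolding sX(3,4) sY(3) M[of i]
    using d adm(3) b1 by (simp add: cs del: M) (simp add: trace2_def)
  have ll1: "lower_left i1 i2 M i = \<kappa> i * d" if "i \<noteq> i1" for i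
    using that by (simp add: ll normal_tuple_def)
  show "regular_tuple i1 i2 M"
    unfolding regular_tuple_def PR QR
    using sX(5-8) sY(5-8) adm(3) b1 ll1 \<kappa> d by auto
  assume p: "p \<in> coordinate_index i1 i2"
  obtain i j where ij: "p = (i, j)" by (cases p)
  show "coordinate i1 i2 M p = u p"
  proof (cases "i = i1")
    case True
    then have "p = (i1, 0)" using p ij by (simp add: coordinate_index_def)
    then show ?thesis using B \<kappa> by (simp add: coordinate_def sX(1,2) m_def)
  next
    case False
    have 0: "trace2 (repelling (M i1) ** M i) / lower_left i1 i2 M i = normal_tuple i1 i2 u i $ 1 $ 1"
      unfolding ll1[OF False] unfolding sX(4) M[of i]
      using d \<kappa> by (simp add: cs del: M) (simp add: trace2_def)
    have 1: "trace2 (repelling (M i1) ** M i ** attracting (M i1) ** attracting (M i2)) /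
       trace2 (repelling (M i1) ** attracting (M i2)) / lower_left i1 i2 M i = normal_tuple i1 i2 u i $ 1 $ 2"
      unfolding ll1[OF False] QR unfolding sX(3,4) sY(3) M[of i]
      using d \<kappa> b1 by (simp add: cs del: M) (simp add: trace2_def)
    have 2: "trace2 (attracting (M i1) ** M i) / lower_left i1 i2 M i = normal_tuple i1 i2 u i $ 2 $ 2"
      unfolding ll1[OF False] unfolding sX(3) M[of i]
      using d \<kappa> by (simp add: cs del: M) (simp add: trace2_def)
    have "j = 0 \<or> j = 1 \<or> j = 2 \<and> i \<noteq> i2" using p ij False by (auto simp: coordinate_index_def split: if_splits)
    then show ?thesis
    proof (elim disjE conjE)
      assume "j = 0"
      then have "coordinate i1 i2 M p = normal_tuple i1 i2 u i $ 1 $ 1"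
        unfolding 0[symmetric] coordinate_def using False ij by simp
      then show ?thesis using False ij \<open>j = 0\<close> by (simp add: normal_tuple_def)
    next
      assume "j = 1"
      then have "coordinate i1 i2 M p = normal_tuple i1 i2 u i $ 1 $ 2"
        unfolding 1[symmetric] coordinate_def using False ij by simp
      then show ?thesis using False ij \<open>j = 1\<close> by (simp add: normal_tuple_def)
    next
      assume "j = 2" "i \<noteq> i2"
      then have "coordinate i1 i2 M p = normal_tuple i1 i2 u i $ 2 $ 2"
        unfolding 2[symmetric] coordinate_def using False ij by simp
      then show ?thesis using False ij \<open>j = 2\<close> \<open>i \<noteq> i2\<close> by (simp add: normal_tuple_def)
    qed
  qed
qed

text \<open>The columns of B are eigenvectors q and p of the first generator for the smaller and the
  larger eigenvalue, scaled so that their sum is the eigenvector r of the second; thus infinity, 0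
  and 1 become the three fixed points. Absence of common eigenvectors makes both coefficients of r
  nonzero, the lower left entries nonzero (infinity is not fixed) and the last admissibility
  condition true (0 is not fixed).\<close>

lemma normal_form_exists:
  fixes M :: "'k \<Rightarrow> complex^2^2"
  assumes ne: "i1 \<noteq> i2" and M: "\<And>i. det (M i) \<noteq> 0" and lox: "\<And>i. loxodromic (M i)"
    and nce: "\<And>i j. i \<noteq> j \<Longrightarrow> \<not> common_eigenvector (M i) (M j)"
  obtains B \<kappa> u where "det B \<noteq> 0" "\<And>i. \<kappa> i \<noteq> 0" "admissible i1 i2 u"
    "\<And>i. M i = scale2 (\<kappa> i) (B ** normal_tuple i1 i2 u i ** adj2 B)"
proof -
  obtain x y where xy: "cmod y < cmod x" "trace2 (M i1) = x + y" "det (M i1) = x * y"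
    using lox[of i1] unfolding loxodromic_def trace2_def by blast
  obtain \<nu> \<nu>' where nu: "cmod \<nu>' < cmod \<nu>" "trace2 (M i2) = \<nu> + \<nu>'" "det (M i2) = \<nu> * \<nu>'"
    using lox[of i2] unfolding loxodromic_def trace2_def by blast
  obtain p where p: "p \<noteq> 0" "M i1 *v p = x *s p" using eigenvector_exists[OF xy(2,3)] .
  obtain q where q: "q \<noteq> 0" "M i1 *v q = y *s q"
    using eigenvector_exists[of "M i1" y x] xy(2,3) by (auto simp: add.commute mult.commute)
  obtain r where r: "r \<noteq> 0" "M i2 *v r = \<nu> *s r" using eigenvector_exists[OF nu(2,3)] .
  have x0: "x \<noteq> 0" using xy(1) by auto
  have xny: "x \<noteq> y" using xy(1) by auto
  have scaled: "A *v (t *s v) = \<mu> *s (t *s v)" if "A *v v = \<mu> *s v" for A :: "complex^2^2" and t \<mu> v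
  proof -
    have "A *v (t *s v) = t *s (A *v v)" by (simp add: vec2_eq_iff algebra_simps)
    then show ?thesis unfolding that by (simp add: vec2_eq_iff mult_ac)
  qed
  define D where "D = q$1 * p$2 - p$1 * q$2"
  have D: "D \<noteq> 0"
  proof
    assume D0: "D = 0"
    have "\<exists>t. q = t *s p"
    proof (cases "p$1 = 0")
      case True
      then have "p$2 \<noteq> 0" using p(1) by (simp add: vec2_eq_iff)
      then show ?thesis using D0 True by (intro exI[of _ "q$2 / p$2"]) (simp add: vec2_eq_iff D_def)
    next
      case False
      then show ?thesis using D0 by (intro exI[of _ "q$1 / p$1"]) (simp add: vec2_eq_iff D_def field_simps)
    qed
    then obtain t where t: "q = t *s p" by blast
    have Mq: "M i1 *v q = x *s q" unfolding t by (rule scaled[OF p(2)])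
    have "x *s q = y *s q" by (rule trans[OF sym[OF Mq] q(2)])
    then have "x * q$1 = y * q$1" "x * q$2 = y * q$2" by (metis vector_smult_component)+
    moreover have "q$1 \<noteq> 0 \<or> q$2 \<noteq> 0" using q(1) by (auto simp: vec2_eq_iff)
    ultimately show False using xny by auto
  qed
  define \<alpha> \<beta> where "\<alpha> = (r$1 * p$2 - p$1 * r$2) / D" and "\<beta> = (q$1 * r$2 - r$1 * q$2) / D"
  have rdec: "r$1 = \<alpha> * q$1 + \<beta> * p$1" "r$2 = \<alpha> * q$2 + \<beta> * p$2"
  proof -
    have "D * (\<alpha> * q$1 + \<beta> * p$1) = (r$1 * p$2 - p$1 * r$2) * q$1 + (q$1 * r$2 - r$1 * q$2) * p$1"
      using D by (simp add: \<alpha>_def \<beta>_def distrib_left)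
    also have "\<dots> = D * r$1" by (simp add: D_def algebra_simps)
    finally show "r$1 = \<alpha> * q$1 + \<beta> * p$1" using D by simp
    have "D * (\<alpha> * q$2 + \<beta> * p$2) = (r$1 * p$2 - p$1 * r$2) * q$2 + (q$1 * r$2 - r$1 * q$2) * p$2"
      using D by (simp add: \<alpha>_def \<beta>_def distrib_left)
    also have "\<dots> = D * r$2" by (simp add: D_def algebra_simps)
    finally show "r$2 = \<alpha> * q$2 + \<beta> * p$2" using D by simp
  qed
  have \<alpha>: "\<alpha> \<noteq> 0"
  proof
    assume "\<alpha> = 0"
    then have "r = \<beta> *s p" using rdec by (simp add: vec2_eq_iff)
    then have "M i1 *v r = x *s r" using scaled[OF p(2)] by simp
    then show False using nce[OF ne] r unfolding common_eigenvector_def by blast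
  qed
  have \<beta>: "\<beta> \<noteq> 0"
  proof
    assume "\<beta> = 0"
    then have "r = \<alpha> *s q" using rdec by (simp add: vec2_eq_iff)
    then have "M i1 *v r = y *s r" using scaled[OF q(2)] by simp
    then show False using nce[OF ne] r unfolding common_eigenvector_def by blast
  qed
  define B where "B = mat2 (\<alpha> * q$1) (\<beta> * p$1) (\<alpha> * q$2) (\<beta> * p$2)"
  have dB: "det B = \<alpha> * \<beta> * D" by (simp add: B_def D_def algebra_simps)
  have detB: "det B \<noteq> 0" using \<alpha> \<beta> D by (simp add: dB)
  define X where "X i = scale2 (1 / det B) (adj2 B ** M i ** B)" for i
  have MX: "M i ** B = B ** X i" for i
  proof -
    have "B ** X i = scale2 (1 / det B) ((B ** adj2 B) ** M i ** B)" by (simp add: X_def matrix_mul_assoc del: adj2_mult)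
    also have "\<dots> = M i ** B" using detB by (simp add: matrix_mul_lid)
    finally show ?thesis ..
  qed
  have Mi: "M i = scale2 (1 / det B) (B ** X i ** adj2 B)" for i
  proof -
    have "scale2 (1 / det B) (B ** X i ** adj2 B) = scale2 (1 / det B) (M i ** (B ** adj2 B))"
      by (simp only: MX[symmetric] matrix_mul_assoc)
    then show ?thesis using detB by (simp add: matrix_mul_rid)
  qed
  have cancel: "v = w" if "B *v v = B *v w" for v w
  proof -
    have "B *v (v - w) = 0" using that by (simp add: matrix_vector_mult_diff_distrib del: multv2_nth)
    then show ?thesis using multv2_eq_0[OF detB, of "v - w"] by (simp del: multv2_nth)
  qed
  have Xeig: "X i *v w = \<mu> *s w \<longleftrightarrow> M i *v (B *v w) = \<mu> *s (B *v w)" for i w \<mu>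
  proof -
    have a: "M i *v (B *v w) = B *v (X i *v w)" by (simp only: matrix_vector_mul_assoc MX)
    have b: "\<mu> *s (B *v w) = B *v (\<mu> *s w)" by (simp add: vec2_eq_iff algebra_simps)
    show ?thesis unfolding a b by (metis cancel)
  qed
  let ?e1 = "vector [1, 0] :: complex^2" and ?e2 = "vector [0, 1] :: complex^2" and ?f = "vector [1, 1] :: complex^2"
  have Be: "B *v ?e1 = \<alpha> *s q" "B *v ?e2 = \<beta> *s p" "B *v ?f = r"
    using rdec by (simp_all add: B_def vec2_eq_iff)
  have X1: "X i1 *v ?e1 = y *s ?e1" "X i1 *v ?e2 = x *s ?e2"
    unfolding Xeig Be by (rule scaled[OF q(2)], rule scaled[OF p(2)])
  have X2: "X i2 *v ?f = \<nu> *s ?f" unfolding Xeig Be by (rule r(2))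
  have c0: "X i $ 2 $ 1 \<noteq> 0" if i: "i \<noteq> i1" for i
  proof
    assume "X i $ 2 $ 1 = 0"
    then have "X i *v ?e1 = X i $ 1 $ 1 *s ?e1" by (simp add: vec2_eq_iff)
    then have "M i *v (\<alpha> *s q) = X i $ 1 $ 1 *s (\<alpha> *s q)" unfolding Xeig Be .
    moreover have "M i1 *v (\<alpha> *s q) = y *s (\<alpha> *s q)" by (rule scaled[OF q(2)])
    moreover have "\<alpha> *s q \<noteq> 0" using \<alpha> q(1) by (auto simp: vec2_eq_iff)
    ultimately show False using nce[OF i] unfolding common_eigenvector_def by blast
  qed
  \<comment> \<open>The scalar that normalises the lower left entry to 1, and for i1 the lower right
    one.\<close>
  define c where "c i = (if i = i1 then x else X i $ 2 $ 1)" for i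
  define u where "u p = (if fst p = i1 then y / x else if snd p = 0 then X (fst p) $ 1 $ 1 / c (fst p)
    else if snd p = 1 then X (fst p) $ 1 $ 2 / c (fst p) else X (fst p) $ 2 $ 2 / c (fst p))" for p :: "'k \<times> nat"
  have c: "c i \<noteq> 0" for i using x0 c0 by (simp add: c_def)
  have rows: "X i2 $ 1 $ 1 + X i2 $ 1 $ 2 = \<nu>" "X i2 $ 2 $ 1 + X i2 $ 2 $ 2 = \<nu>"
    using X2 by (simp_all add: vec2_eq_iff)
  have XN: "X i = scale2 (c i) (normal_tuple i1 i2 u i)" for i
  proof (cases "i = i1")
    case True
    then show ?thesis using X1 x0 by (simp add: mat2_eq_iff normal_tuple_def u_def c_def vec2_eq_iff)
  next
    case False
    have c21: "X i $ 2 $ 1 = c i" using False by (simp add: c_def)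
    show ?thesis
    proof (cases "i = i2")
      case True
      have "c i2 * (X i2 $ 1 $ 1 / c i2 + X i2 $ 1 $ 2 / c i2 - 1) = X i2 $ 2 $ 2"
        using c[of i2] rows c21 True by (simp add: distrib_left right_diff_distrib) (simp add: algebra_simps)
      then show ?thesis using False True c[of i2] c21 by (simp add: mat2_eq_iff normal_tuple_def u_def)
    next
      case nF: False
      then show ?thesis using False c[of i] c21 by (simp add: mat2_eq_iff normal_tuple_def u_def)
    qed
  qed
  define \<kappa> where "\<kappa> i = c i / det B" for i
  have M': "M i = scale2 (\<kappa> i) (B ** normal_tuple i1 i2 u i ** adj2 B)" for i
    unfolding Mi[of i] XN[of i] \<kappa>_def by simp
  have adm: "admissible i1 i2 u"
    unfolding admissible_def
  proof (intro conjI)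
    show "cmod (u (i1, 0)) < 1" using xy(1) x0 by (simp add: u_def norm_divide divide_less_eq)
    have c2: "c i2 = X i2 $ 2 $ 1" using ne by (simp add: c_def)
    have "c i2 * (u (i2, 0) + u (i2, 1)) = \<nu>"
      using ne c[of i2] rows(1) by (simp add: u_def distrib_left)
    moreover have "c i2 * (u (i2, 0) - 1) = \<nu>'"
    proof -
      have "trace2 (M i2) = trace2 (X i2)" unfolding Mi[of i2] using detB by (simp add: trace2_conj)
      then have "X i2 $ 1 $ 1 + X i2 $ 2 $ 2 = \<nu> + \<nu>'" using nu(2) by (simp add: trace2_def)
      moreover have "X i2 $ 1 $ 1 - X i2 $ 2 $ 1 = (X i2 $ 1 $ 1 + X i2 $ 2 $ 2) - (X i2 $ 2 $ 1 + X i2 $ 2 $ 2)"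
        by simp
      ultimately have "X i2 $ 1 $ 1 - X i2 $ 2 $ 1 = \<nu>'" unfolding rows(2) by simp
      then show ?thesis using ne c[of i2] by (simp add: u_def right_diff_distrib c2)
    qed
    ultimately have "cmod (c i2) * cmod (u (i2, 0) - 1) < cmod (c i2) * cmod (u (i2, 0) + u (i2, 1))"
      using nu(1) by (metis norm_mult)
    then show "cmod (u (i2, 0) - 1) < cmod (u (i2, 0) + u (i2, 1))" using c[of i2] by simp
    show "u (i2, 1) \<noteq> 0"
    proof
      assume "u (i2, 1) = 0"
      then have "X i2 $ 1 $ 2 = 0" using ne c[of i2] by (simp add: u_def)
      then have "X i2 *v ?e2 = X i2 $ 2 $ 2 *s ?e2" by (simp add: vec2_eq_iff)
      then have "M i2 *v (\<beta> *s p) = X i2 $ 2 $ 2 *s (\<beta> *s p)" unfolding Xeig Be .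
      moreover have "M i1 *v (\<beta> *s p) = x *s (\<beta> *s p)" by (rule scaled[OF p(2)])
      moreover have "\<beta> *s p \<noteq> 0" using \<beta> p(1) by (auto simp: vec2_eq_iff)
      ultimately show False using nce[OF ne] unfolding common_eigenvector_def by blast
    qed
  qed
  have "\<kappa> i \<noteq> 0" for i using c detB by (simp add: \<kappa>_def)
  then show ?thesis using that[OF detB _ adm M'] by blast
qed

definition holomorphic_matrix_at :: "(complex^'a::finite \<Rightarrow> complex^2^2) \<Rightarrow> complex^'a \<Rightarrow> bool" where
  "holomorphic_matrix_at f x \<longleftrightarrow> (\<forall>a b. holomorphic_at (\<lambda>v. f v $ a $ b) x)"

lemma holomorphic_matrix_mult:
  "holomorphic_matrix_at f x \<Longrightarrow> holomorphic_matrix_at g x \<Longrightarrow> holomorphic_matrix_at (\<lambda>v. f v ** g v) x"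
  unfolding holomorphic_matrix_at_def mult2_nth by (intro allI hol_intros) auto

lemma holomorphic_trace2: "holomorphic_matrix_at f x \<Longrightarrow> holomorphic_at (\<lambda>v. trace2 (f v)) x"
  unfolding holomorphic_matrix_at_def trace2_def by (intro hol_intros) auto

lemma holomorphic_eigenvalues:
  assumes f: "holomorphic_matrix_at f x" and "trace2 (f x) \<noteq> 0"
    "1 - 4 * det (f x) / (trace2 (f x) * trace2 (f x)) \<notin> \<real>\<^sub>\<le>\<^sub>0"
  shows "holomorphic_at (\<lambda>v. eig_large (f v)) x" "holomorphic_at (\<lambda>v. eig_small (f v)) x"
proof -
  have "holomorphic_at (\<lambda>v. det (f v)) x"
    using f unfolding holomorphic_matrix_at_def det_2 by (intro hol_intros) auto
  then have "holomorphic_at (\<lambda>v. csqrt (1 - 4 * det (f v) / (trace2 (f v) * trace2 (f v)))) x"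
    using assms by (intro holomorphic_at_csqrt hol_intros holomorphic_trace2) auto
  then show "holomorphic_at (\<lambda>v. eig_large (f v)) x" "holomorphic_at (\<lambda>v. eig_small (f v)) x"
    unfolding eig_large_def eig_small_def by (intro hol_intros holomorphic_trace2 f; simp)+
qed

lemma holomorphic_projections:
  assumes f: "holomorphic_matrix_at f x" and "trace2 (f x) \<noteq> 0"
    "1 - 4 * det (f x) / (trace2 (f x) * trace2 (f x)) \<notin> \<real>\<^sub>\<le>\<^sub>0" "eig_large (f x) \<noteq> eig_small (f x)"
  shows "holomorphic_matrix_at (\<lambda>v. attracting (f v)) x" "holomorphic_matrix_at (\<lambda>v. repelling (f v)) x"
proof -
  note e = holomorphic_eigenvalues[OF assms(1-3)]
  have "holomorphic_at (\<lambda>v. f v $ a $ b) x" for a b using f by (simp add: holomorphic_matrix_at_def)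
  then show "holomorphic_matrix_at (\<lambda>v. attracting (f v)) x" "holomorphic_matrix_at (\<lambda>v. repelling (f v)) x"
    unfolding holomorphic_matrix_at_def attracting_def repelling_def scale2_nth vector_minus_component
    using assms(4) by (intro allI hol_intros e; simp)+
qed

lemma holomorphic_coordinate:
  assumes "regular_tuple i1 i2 (matrix_entry M0)"
  shows "holomorphic_at (\<lambda>M. coordinate i1 i2 (matrix_entry M) p) M0"
proof -
  have ent: "holomorphic_matrix_at (\<lambda>M. matrix_entry M i) M0" for i
    unfolding holomorphic_matrix_at_def matrix_entry_nth by (intro allI hol_intros)
  have reg: "trace2 (matrix_entry M0 i) \<noteq> 0"
    "1 - 4 * det (matrix_entry M0 i) / (trace2 (matrix_entry M0 i) * trace2 (matrix_entry M0 i)) \<notin> \<real>\<^sub>\<le>\<^sub>0"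
    "eig_large (matrix_entry M0 i) \<noteq> 0" "eig_large (matrix_entry M0 i) \<noteq> eig_small (matrix_entry M0 i)"
    if "i \<in> {i1, i2}" for i
    using assms that unfolding regular_tuple_def by auto
  note pr1 = holomorphic_projections[OF ent reg(1,2,4), of i1, simplified]
    and pr2 = holomorphic_projections[OF ent reg(1,2,4), of i2, simplified]
    and ev = holomorphic_eigenvalues[OF ent reg(1,2), of i1, simplified]
  note tr = holomorphic_trace2[OF holomorphic_matrix_mult] holomorphic_matrix_mult ent pr1 pr2
  have ll: "holomorphic_at (\<lambda>M. lower_left i1 i2 (matrix_entry M) i) M0" for i
    unfolding lower_left_def using assms by (intro holomorphic_at_divide tr) (auto simp: regular_tuple_def)
  show ?thesis
  proof (cases "fst p = i1")
    case True
    then show ?thesis unfolding coordinate_def using reg(3)[of i1] by (simp add: holomorphic_at_divide ev)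
  next
    case False
    then have l0: "lower_left i1 i2 (matrix_entry M0) (fst p) \<noteq> 0"
      "trace2 (repelling (matrix_entry M0 i1) ** attracting (matrix_entry M0 i2)) \<noteq> 0"
      using assms by (auto simp: regular_tuple_def)
    have 1: "holomorphic_at (\<lambda>M. trace2 (repelling (matrix_entry M i1) ** matrix_entry M (fst p)) /
        lower_left i1 i2 (matrix_entry M) (fst p)) M0"
      by (intro holomorphic_at_divide tr ll l0)
    have 2: "holomorphic_at (\<lambda>M. trace2 (repelling (matrix_entry M i1) ** matrix_entry M (fst p) **
        attracting (matrix_entry M i1) ** attracting (matrix_entry M i2)) /
        trace2 (repelling (matrix_entry M i1) ** attracting (matrix_entry M i2)) /
        lower_left i1 i2 (matrix_entry M) (fst p)) M0"
      by (intro holomorphic_at_divide tr ll l0)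
    have 3: "holomorphic_at (\<lambda>M. trace2 (attracting (matrix_entry M i1) ** matrix_entry M (fst p)) /
        lower_left i1 i2 (matrix_entry M) (fst p)) M0"
      by (intro holomorphic_at_divide tr ll l0)
    show ?thesis unfolding coordinate_def
      using False 1 2 3 by (cases "snd p = 0"; cases "snd p = 1"; simp)
  qed
qed

lemma conjugate_tuples_scaled:
  assumes M: "\<And>i. det (M i) \<noteq> 0" and N: "\<And>i. det (N i) \<noteq> 0"
    and eq: "conjugacy_class (\<lambda>i. psl_class (M i)) = conjugacy_class (\<lambda>i. psl_class (N i))"
  obtains B \<kappa> where "det B \<noteq> 0" "\<And>i. \<kappa> i \<noteq> 0" "\<And>i. M i = scale2 (\<kappa> i) (B ** N i ** adj2 B)"
proof -
  have "(\<lambda>i. psl_class (M i)) \<in> conjugacy_class (\<lambda>i. psl_class (N i))"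
    unfolding eq[symmetric] by (rule mem_conjugacy_class_self[of M, OF M])
  then obtain B where B: "det B \<noteq> 0" "(\<lambda>i. psl_class (M i)) = (\<lambda>i. psl_class (conj_tuple B N i))"
    using mem_conjugacy_class_sym[of N, OF N] by blast
  have "\<exists>c. c \<noteq> 0 \<and> M i = scale2 c (B ** N i ** adj2 B)" for i
    using psl_class_eq_iff[OF M[of i], of "conj_tuple B N i"] fun_cong[OF B(2), of i] B(1) N[of i]
    by (auto simp: conj_tuple_def det_mul)
  then obtain \<kappa> where "\<And>i. \<kappa> i \<noteq> 0 \<and> M i = scale2 (\<kappa> i) (B ** N i ** adj2 B)" by metis
  then show ?thesis using that B(1) by blast
qed

lemma conjugacy_class_scaled:
  assumes N: "\<And>i. det (N i) \<noteq> 0" and B: "det B \<noteq> 0" and \<kappa>: "\<And>i. \<kappa> i \<noteq> 0"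
    and M: "\<And>i. M i = scale2 (\<kappa> i) (B ** N i ** adj2 B)"
  shows "conjugacy_class (\<lambda>i. psl_class (M i)) = conjugacy_class (\<lambda>i. psl_class (N i))"
proof -
  have "(\<lambda>i. psl_class (M i)) = (\<lambda>i. psl_class (conj_tuple B N i))"
    using \<kappa> by (simp add: M conj_tuple_def)
  then show ?thesis using conjugacy_class_conj[of N, OF N B] by simp
qed

text \<open>The section s sends a coordinate vector to its normal tuple, and \<Phi> computes the
  coordinates of any Schottky tuple by conjugation-invariant formulas. Since \<Phi> inverts s up to
  conjugation, \<phi> is a homeomorphism, pulls back to the holomorphic map \<Phi> and has an
  inverse that lifts through s.\<close>

lemma global_schottky_chart:
  fixes i1 i2 :: "'k::finite" and e :: "'k \<times> nat \<Rightarrow> 'n::finite"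
  assumes ne: "i1 \<noteq> i2" and e: "bij_betw e (coordinate_index i1 i2) UNIV"
  obtains \<phi> :: "('k \<Rightarrow> psl) set \<Rightarrow> complex^'n" where "(topspace schottky_space, \<phi>) \<in> schottky_charts"
proof -
  let ?X = "schottky_space :: ('k \<Rightarrow> psl) set topology" and ?J = "coordinate_index i1 i2"
  \<comment> \<open>The bijection e is controlled on \<open>coordinate_index\<close> only; other
    values of \<open>hat v\<close> are accidental, and neither \<open>normal_tuple\<close> nor
    \<open>admissible\<close> reads them.\<close>
  define hat where "hat v p = v $ e p" for v :: "complex^'n" and p
  define N where "N v = normal_tuple i1 i2 (hat v)" for v
  define s where "s v = tuple_vector (N v)" for v
  define W where "W = {v. admissible i1 i2 (hat v) \<and> s v \<in> invertible_tuples \<and> tuple_class (s v) \<in> topspace ?X}"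
  define \<Phi> :: "complex^('k \<times> 2 \<times> 2) \<Rightarrow> complex^'n" where
    "\<Phi> M = (\<chi> n. coordinate i1 i2 (matrix_entry M) (inv_into ?J e n))" for M
  define \<Omega> where "\<Omega> = {M \<in> invertible_tuples. tuple_class M \<in> topspace ?X}"
  have inj: "inj_on e ?J" and surj: "e ` ?J = UNIV" using e by (auto simp: bij_betw_def)
  have sN: "matrix_entry (s v) = N v" for v by (rule ext) (simp add: s_def)
  have cls: "tuple_class (s v) = conjugacy_class (\<lambda>i. psl_class (N v i))" for v
    by (simp add: tuple_class_def sN)
  have N_cong: "N v = normal_tuple i1 i2 u" if "\<And>p. p \<in> ?J \<Longrightarrow> hat v p = u p" for u v
    using that ne by (auto simp: N_def normal_tuple_def coordinate_index_def fun_eq_iff)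
  have adm_cong: "admissible i1 i2 (hat v) \<longleftrightarrow> admissible i1 i2 u" if "\<And>p. p \<in> ?J \<Longrightarrow> hat v p = u p" for u v
    using that ne by (auto simp: admissible_def coordinate_index_def)
  have coords: "\<Phi> M = v" "regular_tuple i1 i2 (matrix_entry M)"
    if "admissible i1 i2 (hat v)" "det B \<noteq> 0" "\<And>i. \<kappa> i \<noteq> 0"
      "\<And>i. matrix_entry M i = scale2 (\<kappa> i) (B ** N v i ** adj2 B)" for M v B \<kappa>
  proof -
    note c = coordinate_normal_tuple[OF ne that(2,3,1) that(4)[unfolded N_def]]
    show "regular_tuple i1 i2 (matrix_entry M)" by (rule c(1))
    have "\<Phi> M $ n = v $ n" for n
    proof -
      have n: "inv_into ?J e n \<in> ?J" "e (inv_into ?J e n) = n"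
        using surj by (auto intro: inv_into_into f_inv_into_f)
      then show ?thesis using c(2)[OF n(1)] by (simp add: \<Phi>_def hat_def)
    qed
    then show "\<Phi> M = v" by (simp add: vec_eq_iff)
  qed
  have lift: "\<exists>v B \<kappa>. v \<in> W \<and> det B \<noteq> 0 \<and> (\<forall>i. \<kappa> i \<noteq> 0) \<and>
      (\<forall>i. matrix_entry M i = scale2 (\<kappa> i) (B ** N v i ** adj2 B)) \<and> tuple_class (s v) = tuple_class M"
    if M: "M \<in> \<Omega>" for M
  proof -
    have dM: "det (matrix_entry M i) \<noteq> 0" for i using M by (simp add: \<Omega>_def invertible_tuplesD)
    have S: "schottky_marking UNIV (\<lambda>i. psl_class (matrix_entry M i))"
      using M tuple_class_in_schottky_space[of "matrix_entry M", OF dM] by (simp add: \<Omega>_def tuple_class_def)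
    obtain B \<kappa> u where B: "det B \<noteq> 0" "\<And>i. \<kappa> i \<noteq> 0" "admissible i1 i2 u"
      "\<And>i. matrix_entry M i = scale2 (\<kappa> i) (B ** normal_tuple i1 i2 u i ** adj2 B)"
      using normal_form_exists[of i1 i2 "matrix_entry M", OF ne dM schottky_marking_generators(1,2)[of "matrix_entry M", OF dM S]] by blast
    define v where "v = (\<chi> n. u (inv_into ?J e n))"
    have hv: "hat v p = u p" if "p \<in> ?J" for p using inj that by (simp add: hat_def v_def)
    have Nv: "N v = normal_tuple i1 i2 u" by (rule N_cong[OF hv])
    have dN: "det (N v i) \<noteq> 0" for i
      using dM[of i] unfolding B(4) Nv by (auto simp: det_mul)
    have "conjugacy_class (\<lambda>i. psl_class (matrix_entry M i)) = conjugacy_class (\<lambda>i. psl_class (N v i))"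
      by (rule conjugacy_class_scaled[OF dN B(1,2)]) (simp add: B(4) Nv)
    then have eq: "tuple_class (s v) = tuple_class M" by (simp only: tuple_class_def sN)
    have "v \<in> W"
      using adm_cong[OF hv] B(3) dN eq M by (simp add: W_def s_def \<Omega>_def)
    then show ?thesis using B Nv eq by (intro exI[of _ v] exI[of _ B] exI[of _ \<kappa>]) simp
  qed
  \<comment> \<open>A choice without ambiguity: the next fact shows that \<Phi> recovers v from any
    tuple in the class.\<close>
  define \<phi> where "\<phi> X = (SOME v. v \<in> W \<and> tuple_class (s v) = X)" for X
  have \<Phi>_inv: "\<Phi> M = v" if Mv: "M \<in> invertible_tuples" "v \<in> W" "tuple_class (s v) = tuple_class M" for M v
  proof -
    have dM: "det (matrix_entry M i) \<noteq> 0" and dN: "det (N v i) \<noteq> 0" for i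
      using Mv by (simp_all add: invertible_tuplesD W_def s_def)
    obtain B \<kappa> where B: "det B \<noteq> 0" "\<And>i. \<kappa> i \<noteq> 0" "\<And>i. matrix_entry M i = scale2 (\<kappa> i) (B ** N v i ** adj2 B)"
      using conjugate_tuples_scaled[of "matrix_entry M" "N v", OF dM dN Mv(3)[unfolded tuple_class_def sN, symmetric]] by blast
    show ?thesis by (rule coords(1)[OF _ B]) (use Mv(2) in \<open>simp add: W_def\<close>)
  qed
  have \<phi>_tuple: "\<phi> (tuple_class M) = \<Phi> M" "\<phi> (tuple_class M) \<in> W" "tuple_class (s (\<phi> (tuple_class M))) = tuple_class M"
    if M: "M \<in> \<Omega>" for M
  proof -
    have "\<exists>v. v \<in> W \<and> tuple_class (s v) = tuple_class M" using lift[OF M] by blast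
    then have *: "\<phi> (tuple_class M) \<in> W \<and> tuple_class (s (\<phi> (tuple_class M))) = tuple_class M"
      unfolding \<phi>_def by (rule someI_ex)
    then show "\<phi> (tuple_class M) \<in> W" "tuple_class (s (\<phi> (tuple_class M))) = tuple_class M" by auto
    show "\<phi> (tuple_class M) = \<Phi> M" using \<Phi>_inv[of M "\<phi> (tuple_class M)"] * M by (simp add: \<Omega>_def)
  qed
  have sW: "s v \<in> \<Omega>" "\<phi> (tuple_class (s v)) = v" if v: "v \<in> W" for v
  proof -
    show "s v \<in> \<Omega>" using v by (simp add: W_def \<Omega>_def)
    then show "\<phi> (tuple_class (s v)) = v" using \<phi>_tuple(1)[of "s v"] \<Phi>_inv[of "s v" v] v by (simp add: W_def)
  qed
  have top_rep: "\<exists>M\<in>\<Omega>. X = tuple_class M" if X: "X \<in> topspace ?X" for X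
  proof -
    obtain \<gamma> where \<gamma>: "schottky_marking UNIV \<gamma>" "X = conjugacy_class \<gamma>" using X mem_schottky_space by blast
    then obtain A where A: "\<And>i. det (A i) = 1" "\<gamma> = (\<lambda>i. psl_class (A i))"
      using carrier_tuple_rep[of \<gamma>] by (auto simp: schottky_marking_def)
    then show ?thesis using X \<gamma>(2) by (intro bexI[of _ "tuple_vector A"]) (auto simp: \<Omega>_def tuple_class_tuple_vector)
  qed
  have \<phi>_image: "\<phi> ` topspace ?X = W"
  proof
    show "\<phi> ` topspace ?X \<subseteq> W" using top_rep \<phi>_tuple(2) by blast
    show "W \<subseteq> \<phi> ` topspace ?X"
    proof
      fix v assume v: "v \<in> W"
      then have "tuple_class (s v) \<in> topspace ?X" by (simp add: W_def)
      then show "v \<in> \<phi> ` topspace ?X" using sW(2)[OF v] by (metis imageI)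
    qed
  qed
  have op\<Omega>: "open \<Omega>" unfolding \<Omega>_def by (rule open_topspace_preimage)
  have hol\<Phi>: "holomorphic_map_on (\<lambda>M. \<phi> (tuple_class M)) \<Omega>"
    unfolding holomorphic_map_on_def
  proof (intro conjI op\<Omega> ballI)
    fix M0 assume M0: "M0 \<in> \<Omega>"
    obtain v B \<kappa> where "v \<in> W" "det B \<noteq> 0" "\<forall>i. \<kappa> i \<noteq> 0"
      "\<forall>i. matrix_entry M0 i = scale2 (\<kappa> i) (B ** N v i ** adj2 B)" using lift[OF M0] by blast
    then have "regular_tuple i1 i2 (matrix_entry M0)" using coords(2)[of v B \<kappa> M0] by (simp add: W_def)
    then have "\<exists>f'. (\<Phi> has_derivative f') (at M0) \<and> Vector_Spaces.linear (*s) (*s) f'"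
      by (intro has_derivative_componentwise_holomorphic) (simp add: \<Phi>_def holomorphic_coordinate)
    then obtain f' where f': "(\<Phi> has_derivative f') (at M0)" "Vector_Spaces.linear (*s) (*s) f'" by blast
    have "((\<lambda>M. \<phi> (tuple_class M)) has_derivative f') (at M0)"
      by (rule has_derivative_transform_within_open[OF f'(1) op\<Omega> M0]) (simp add: \<phi>_tuple(1))
    then show "\<exists>f'. ((\<lambda>M. \<phi> (tuple_class M)) has_derivative f') (at M0) \<and> Vector_Spaces.linear (*s) (*s) f'"
      using f'(2) by blast
  qed
  have hols: "holomorphic_at (\<lambda>v. s v $ q) v0" for q v0
  proof -
    obtain i a b where q: "q = (i, a, b)" by (metis prod.exhaust)
    have "s v $ q = N v i $ a $ b" for v by (simp add: s_def tuple_vector_def q)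
    moreover have "holomorphic_at (\<lambda>v. N v i $ a $ b) v0"
      using exhaust_2[of a] exhaust_2[of b]
      by (elim disjE; cases "i = i1"; cases "i = i2")
         (simp_all add: N_def normal_tuple_def hat_def holomorphic_at_const holomorphic_at_nth holomorphic_at_add holomorphic_at_diff)
    ultimately show ?thesis by simp
  qed
  have ders: "\<exists>f'. (s has_derivative f') (at v0) \<and> Vector_Spaces.linear (*s) (*s) f'" for v0
    by (rule has_derivative_componentwise_holomorphic[OF hols])
  have conts: "continuous_on UNIV s"
    using ders by (metis continuous_at_imp_continuous_on has_derivative_continuous)
  have opW: "open W"
  proof -
    have "W = {v. cmod (hat v (i1, 0)) < 1} \<inter> {v. cmod (hat v (i2, 0) - 1) < cmod (hat v (i2, 0) + hat v (i2, 1))}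
        \<inter> {v. hat v (i2, 1) \<noteq> 0} \<inter> s -` \<Omega>"
      by (auto simp: W_def \<Omega>_def admissible_def)
    moreover have "open (s -` \<Omega>)" using op\<Omega> conts by (rule open_vimage)
    ultimately show ?thesis unfolding hat_def
      by (auto intro!: open_Int open_Collect_less open_Collect_neq continuous_intros)
  qed
  have hom: "homeomorphic_map (subtopology ?X (topspace ?X)) (top_of_set (\<phi> ` topspace ?X)) \<phi>"
    unfolding homeomorphic_map_maps homeomorphic_maps_def \<phi>_image subtopology_topspace
  proof (intro exI[of _ "\<lambda>v. tuple_class (s v)"] conjI ballI)
    show "continuous_map ?X (top_of_set W) \<phi>"
      unfolding continuous_map_def
    proof (intro conjI allI impI)
      show "\<phi> \<in> topspace ?X \<rightarrow> topspace (top_of_set W)" using \<phi>_image by auto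
      fix V assume "openin (top_of_set W) V"
      then have V: "open V" using opW openin_open_eq by blast
      have "open ((\<lambda>M. \<phi> (tuple_class M)) -` V \<inter> \<Omega>)"
        using continuous_on_open_vimage[OF op\<Omega>] holomorphic_map_on_continuous[OF hol\<Phi>] V by blast
      also have "(\<lambda>M. \<phi> (tuple_class M)) -` V \<inter> \<Omega> = {M \<in> invertible_tuples. tuple_class M \<in> {x \<in> topspace ?X. \<phi> x \<in> V}}"
        by (auto simp: \<Omega>_def)
      finally show "openin ?X {x \<in> topspace ?X. \<phi> x \<in> V}" by (simp add: openin_schottky_space)
    qed
    show "continuous_map (top_of_set W) ?X (\<lambda>v. tuple_class (s v))"
      unfolding continuous_map_def
    proof (intro conjI allI impI)
      show "(\<lambda>v. tuple_class (s v)) \<in> topspace (top_of_set W) \<rightarrow> topspace ?X" by (auto simp: W_def)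
      fix V assume "openin ?X V"
      then have "open {M \<in> invertible_tuples. tuple_class M \<in> V}" by (simp add: openin_schottky_space)
      then have "open (s -` {M \<in> invertible_tuples. tuple_class M \<in> V})" using conts by (rule open_vimage)
      then have "openin (top_of_set W) (W \<inter> s -` {M \<in> invertible_tuples. tuple_class M \<in> V})"
        by (rule openin_open_Int)
      also have "W \<inter> s -` {M \<in> invertible_tuples. tuple_class M \<in> V} = {x \<in> topspace (top_of_set W). tuple_class (s x) \<in> V}"
        by (auto simp: W_def)
      finally show "openin (top_of_set W) {x \<in> topspace (top_of_set W). tuple_class (s x) \<in> V}" .
    qed
    show "tuple_class (s (\<phi> X)) = X" if "X \<in> topspace ?X" for X using top_rep[OF that] \<phi>_tuple(3) by blast
    show "\<phi> (tuple_class (s v)) = v" if "v \<in> topspace (top_of_set W)" for v using that sW(2) by simp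
  qed
  have "(topspace ?X, \<phi>) \<in> schottky_charts"
    unfolding schottky_charts_def
  proof (intro CollectI case_prodI conjI ballI)
    show "openin ?X (topspace ?X)" by simp
    show "open (\<phi> ` topspace ?X)" using opW \<phi>_image by simp
    show "homeomorphic_map (subtopology ?X (topspace ?X)) (top_of_set (\<phi> ` topspace ?X)) \<phi>" by (rule hom)
    show "holomorphic_map_on (\<lambda>M. \<phi> (tuple_class M)) {M \<in> invertible_tuples. tuple_class M \<in> topspace ?X}"
      using hol\<Phi> by (simp add: \<Omega>_def)
    fix w assume w: "w \<in> \<phi> ` topspace ?X"
    have "holomorphic_map_on s W" using opW ders by (simp add: holomorphic_map_on_def)
    then show "\<exists>W s. w \<in> W \<and> W \<subseteq> \<phi> ` topspace ?X \<and> holomorphic_map_on s W \<and>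
        (\<forall>v\<in>W. s v \<in> invertible_tuples \<and> tuple_class (s v) \<in> topspace ?X \<and> \<phi> (tuple_class (s v)) = v)"
      using w \<phi>_image sW by (intro exI[of _ W] exI[of _ s]) (auto simp: \<Omega>_def)
  qed
  then show ?thesis using that by blast
qed

lemma card_coordinate_index:
  fixes i1 i2 :: "'k::finite"
  assumes "i1 \<noteq> i2" shows "finite (coordinate_index i1 i2)" "card (coordinate_index i1 i2) = 3 * CARD('k) - 3"
proof -
  have eq: "coordinate_index i1 i2 = {(i1, 0)} \<union> {i2} \<times> {..<2} \<union> (UNIV - {i1, i2}) \<times> {..<3}"
    using assms by (auto simp: coordinate_index_def split: if_splits)
  show "finite (coordinate_index i1 i2)" unfolding eq by simp
  have c: "card (UNIV - {i1, i2} :: 'k set) = CARD('k) - 2"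
    using assms by (simp add: card_Diff_subset)
  have disj: "{i2} \<times> {..<2} \<inter> (UNIV - {i1, i2}) \<times> {..<3} = ({} :: ('k \<times> nat) set)" by auto
  have "2 \<le> CARD('k)" using assms card_mono[of UNIV "{i1, i2}"] by simp
  moreover have "card (coordinate_index i1 i2) = 1 + 2 + (CARD('k) - 2) * 3"
    unfolding eq using assms c by (subst card_Un_disjoint; simp add: card_cartesian_product disj)+
  ultimately show "card (coordinate_index i1 i2) = 3 * CARD('k) - 3" by simp
qed

theorem corollary1p2:
  fixes lam :: real and k :: nat
  assumes "lam > 0"
    and "\<And>\<Gamma>. kleinian_group \<Gamma> \<Longrightarrow> non_elementary \<Gamma> \<Longrightarrow> limit_set_dimension \<Gamma> < ennreal lam
           \<Longrightarrow> classical_schottky_group \<Gamma>"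
    and "k \<ge> 2"
    and "CARD('k::finite) = k"
    and "CARD('n::finite) = 3 * k - 3"
  shows "complex_manifold
           (subtopology schottky_space (small_classical_locus lam :: ('k \<Rightarrow> psl) set set))
           (induced_charts (small_classical_locus lam)
              (schottky_charts :: (('k \<Rightarrow> psl) set set \<times> (('k \<Rightarrow> psl) set \<Rightarrow> complex^'n)) set))"
proof -
  have "\<not> CARD('k) \<le> Suc 0" using assms(3,4) by simp
  then obtain i1 i2 :: 'k where ne: "i1 \<noteq> i2"
    using card_le_Suc0_iff_eq[of "UNIV :: 'k set"] by auto
  note idx = card_coordinate_index[OF ne]
  have "card (coordinate_index i1 i2) = CARD('n)" using idx(2) assms(4,5) by simp
  then obtain e :: "'k \<times> nat \<Rightarrow> 'n" where e: "bij_betw e (coordinate_index i1 i2) UNIV"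
    using finite_same_card_bij[OF idx(1) finite_class.finite_UNIV] by blast
  obtain \<phi> :: "('k \<Rightarrow> psl) set \<Rightarrow> complex^'n" where "(topspace schottky_space, \<phi>) \<in> schottky_charts"
    using global_schottky_chart[OF ne e] .
  then show ?thesis by (rule complex_manifold_of_global_chart[OF _ openin_small_classical_locus])
qed

end
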